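(* Consider the three-transmitter Gaussian multiple-access channel with a helper $$B=X_1+X_2+hX_3+N_B,\qquad E=X_1+X_2+X_3+N_E,$$ where $h\in\mathbb R$ is a constant known to all terminals, $N_B\sim\mathcal N(0,\sigma_B^2)$ and $N_E\sim\mathcal N(0,\sigma_E^2)$ are independent white Gaussian noises, independent of $(X_1,X_2,X_3)$, with input power constraints $\frac1n\sum_{i=1}^nx_{t,i}^2\le P_t$ for $t=1,2,3$, and innocent symbols $x_{0,1}=x_{0,2}=x_{0,3}=0$. Transmitter 1 knows message $M_1$, transmitter 2 knows message $M_2$, and transmitter 3 (the helper) knows both $M_1$ and $M_2$. The covert capacity region of this channel is the set of non-negative pairs $(R_1,R_2)$ with $$R_1\le\tfrac12\log\Big(1+\tfrac{(h-1)^2\tilde P_1}{\sigma_B^2}\Big),\quad R_2\le\tfrac12\log\Big(1+\tfrac{(h-1)^2\tilde P_2}{\sigma_B^2}\Big),\quad R_1+R_2\le\tfrac12\log\Big(1+\tfrac{(h-1)^2\tilde P_3}{\sigma_B^2}\Big),$$ where $\tilde P_1=\min\{P_1,P_3\}$, $\tilde P_2=\min\{P_2,P_3\}$, and $\tilde P_3=\min\{P_1+P_2,P_3\}$.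
   Context: Logarithms are base 2. $B$ is observed by the legitimate receiver and $E$ by the warden; the channel is used $n$ times independently. $M_1,M_2$ are independent and uniform on $\mathcal M_s=\{1,\dots,\lfloor2^{nR_s}\rfloor\}$. A $(2^{nR_1},2^{nR_2},n)$ code consists of encoders mapping $m_1\mapsto x_1^n$, $m_2\mapsto x_2^n$, $(m_1,m_2)\mapsto x_3^n$, with every codeword satisfying its power constraint, and a decoder mapping $B^n$ to $(\hat M_1,\hat M_2)$. When there is no communication the warden's output has distribution $q_0^{\otimes n}$ with $q_0=\mathcal N(0,\sigma_E^2)$. A pair $(R_1,R_2)$ is achievable if there is a sequence of codes such that $\mathbb P\{(\hat M_1,\hat M_2)\ne(M_1,M_2)\}\to0$ and the total variation distance between the distribution $p_{E^n}$ induced by the code (over uniform messages and noise) and $q_0^{\otimes n}$ tends to $0$ as $n\to\infty$. The covert capacity region is the closure of the set of achievable pairs. *)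

theory Defs
  imports "HOL-Probability.Probability"
begin

definition gaussian :: "real \<Rightarrow> real measure" where
  "gaussian \<sigma> = density lborel (normal_density 0 \<sigma>)"

text \<open>Length-\<open>n\<close> real sequences are extensional functions on \<open>{..<n}\<close>.\<close>

abbreviation seq_space :: "nat \<Rightarrow> (nat \<Rightarrow> real) measure" where
  "seq_space n \<equiv> (\<Pi>\<^sub>M i\<in>{..<n}. borel)"

definition white_noise :: "nat \<Rightarrow> real \<Rightarrow> (nat \<Rightarrow> real) measure" where
  "white_noise n \<sigma> = (\<Pi>\<^sub>M i\<in>{..<n}. gaussian \<sigma>)"

definition tv_dist :: "'a measure \<Rightarrow> 'a measure \<Rightarrow> real" where
  "tv_dist M N = (SUP A\<in>sets M. \<bar>measure M A - measure N A\<bar>)"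

definition messages :: "nat \<Rightarrow> real \<Rightarrow> nat set" where
  "messages n R = {1..nat \<lfloor>2 powr (real n * R)\<rfloor>}"

text \<open>Only the coordinates \<open>i < n\<close> of a codeword are ever used. The third encoder is the
  helper's, which sees both messages.\<close>

record mac_code =
  enc1 :: "nat \<Rightarrow> nat \<Rightarrow> real"
  enc2 :: "nat \<Rightarrow> nat \<Rightarrow> real"
  enc3 :: "nat \<Rightarrow> nat \<Rightarrow> nat \<Rightarrow> real"
  dec :: "(nat \<Rightarrow> real) \<Rightarrow> nat \<times> nat"

definition power_ok :: "nat \<Rightarrow> real \<Rightarrow> (nat \<Rightarrow> real) \<Rightarrow> bool" where
  "power_ok n P x \<longleftrightarrow> 1 / real n * (\<Sum>i<n. (x i)\<^sup>2) \<le> P"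

definition is_code ::
    "real \<Rightarrow> real \<Rightarrow> real \<Rightarrow> real \<Rightarrow> real \<Rightarrow> nat \<Rightarrow> mac_code \<Rightarrow> bool" where
  "is_code P1 P2 P3 R1 R2 n c \<longleftrightarrow>
     (\<forall>m1\<in>messages n R1. power_ok n P1 (enc1 c m1)) \<and>
     (\<forall>m2\<in>messages n R2. power_ok n P2 (enc2 c m2)) \<and>
     (\<forall>m1\<in>messages n R1. \<forall>m2\<in>messages n R2. power_ok n P3 (enc3 c m1 m2)) \<and>
     dec c \<in> seq_space n \<rightarrow>\<^sub>M count_space (messages n R1 \<times> messages n R2)"

text \<open>The sample space of \<open>n\<close> channel uses: outcomes are \<open>(m1, m2, zB, zE)\<close>, with independent
  uniform messages and independent noise sequences of standard deviations \<open>\<sigma>B\<close> and \<open>\<sigma>E\<close>.\<close>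

type_synonym outcome = "nat \<times> nat \<times> (nat \<Rightarrow> real) \<times> (nat \<Rightarrow> real)"

definition mac_space :: "real \<Rightarrow> real \<Rightarrow> real \<Rightarrow> real \<Rightarrow> nat \<Rightarrow> outcome measure" where
  "mac_space \<sigma>B \<sigma>E R1 R2 n =
     uniform_count_measure (messages n R1) \<Otimes>\<^sub>M uniform_count_measure (messages n R2) \<Otimes>\<^sub>M
     white_noise n \<sigma>B \<Otimes>\<^sub>M white_noise n \<sigma>E"

definition B_out :: "real \<Rightarrow> nat \<Rightarrow> mac_code \<Rightarrow> outcome \<Rightarrow> nat \<Rightarrow> real" where
  "B_out h n c = (\<lambda>(m1, m2, zB, zE).
     \<lambda>i\<in>{..<n}. enc1 c m1 i + enc2 c m2 i + h * enc3 c m1 m2 i + zB i)"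

definition E_out :: "nat \<Rightarrow> mac_code \<Rightarrow> outcome \<Rightarrow> nat \<Rightarrow> real" where
  "E_out n c = (\<lambda>(m1, m2, zB, zE).
     \<lambda>i\<in>{..<n}. enc1 c m1 i + enc2 c m2 i + enc3 c m1 m2 i + zE i)"

definition error_prob ::
    "real \<Rightarrow> real \<Rightarrow> real \<Rightarrow> real \<Rightarrow> real \<Rightarrow> nat \<Rightarrow> mac_code \<Rightarrow> real" where
  "error_prob h \<sigma>B \<sigma>E R1 R2 n c =
     measure (mac_space \<sigma>B \<sigma>E R1 R2 n)
       {\<omega> \<in> space (mac_space \<sigma>B \<sigma>E R1 R2 n).
          dec c (B_out h n c \<omega>) \<noteq> (case \<omega> of (m1, m2, zB, zE) \<Rightarrow> (m1, m2))}"

definition warden_law ::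
    "real \<Rightarrow> real \<Rightarrow> real \<Rightarrow> real \<Rightarrow> nat \<Rightarrow> mac_code \<Rightarrow> (nat \<Rightarrow> real) measure" where
  "warden_law \<sigma>B \<sigma>E R1 R2 n c =
     distr (mac_space \<sigma>B \<sigma>E R1 R2 n) (seq_space n) (E_out n c)"

text \<open>With the innocent symbol 0 at every transmitter the warden sees noise only, so its
  output law under no communication is \<open>white_noise n \<sigma>E\<close>.\<close>

definition achievable ::
    "real \<Rightarrow> real \<Rightarrow> real \<Rightarrow> real \<Rightarrow> real \<Rightarrow> real \<Rightarrow> real \<Rightarrow> real \<Rightarrow> bool" where
  "achievable h \<sigma>B \<sigma>E P1 P2 P3 R1 R2 \<longleftrightarrow>
     0 \<le> R1 \<and> 0 \<le> R2 \<and>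
     (\<exists>c :: nat \<Rightarrow> mac_code.
        (\<forall>n>0. is_code P1 P2 P3 R1 R2 n (c n)) \<and>
        (\<lambda>n. error_prob h \<sigma>B \<sigma>E R1 R2 n (c n)) \<longlonglongrightarrow> 0 \<and>
        (\<lambda>n. tv_dist (warden_law \<sigma>B \<sigma>E R1 R2 n (c n)) (white_noise n \<sigma>E)) \<longlonglongrightarrow> 0)"

definition covert_capacity_region ::
    "real \<Rightarrow> real \<Rightarrow> real \<Rightarrow> real \<Rightarrow> real \<Rightarrow> real \<Rightarrow> (real \<times> real) set" where
  "covert_capacity_region h \<sigma>B \<sigma>E P1 P2 P3 =
     closure {(R1, R2). achievable h \<sigma>B \<sigma>E P1 P2 P3 R1 R2}"

text \<open>The measures above are probability measures and the outputs are measurable, so neither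
  the error probability nor the warden's law is degenerate.\<close>

lemma prob_space_gaussian: "0 < \<sigma> \<Longrightarrow> prob_space (gaussian \<sigma>)"
  unfolding gaussian_def by (rule prob_space_normal_density)

lemma prob_space_white_noise: "0 < \<sigma> \<Longrightarrow> prob_space (white_noise n \<sigma>)"
  unfolding white_noise_def by (intro prob_space_PiM prob_space_gaussian)

lemma sets_white_noise: "sets (white_noise n \<sigma>) = sets (seq_space n)"
  unfolding white_noise_def gaussian_def by (intro sets_PiM_cong) auto

lemma messages_nonempty: "0 \<le> R \<Longrightarrow> messages n R \<noteq> {}"
  using ge_one_powr_ge_zero[of 2 "real n * R"] by (simp add: messages_def le_nat_iff)

lemma prob_space_mac_space:
  assumes "0 < \<sigma>B" "0 < \<sigma>E" "0 \<le> R1" "0 \<le> R2"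
  shows "prob_space (mac_space \<sigma>B \<sigma>E R1 R2 n)"
  unfolding mac_space_def
  by (intro prob_space_pair prob_space_uniform_count_measure prob_space_white_noise
        assms messages_nonempty) (auto simp: messages_def)

lemma sets_mac_space:
  "sets (mac_space \<sigma>B \<sigma>E R1 R2 n) =
   sets (count_space (messages n R1) \<Otimes>\<^sub>M count_space (messages n R2) \<Otimes>\<^sub>M
         seq_space n \<Otimes>\<^sub>M seq_space n)"
  unfolding mac_space_def
  by (intro sets_pair_measure_cong sets_white_noise) (auto simp: sets_uniform_count_measure)

lemma measurable_output:
  fixes g :: "nat \<Rightarrow> nat \<Rightarrow> nat \<Rightarrow> real"
  assumes z: "z \<in> mac_space \<sigma>B \<sigma>E R1 R2 n \<rightarrow>\<^sub>M seq_space n"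
  shows "(\<lambda>\<omega>. \<lambda>i\<in>{..<n}. g (fst \<omega>) (fst (snd \<omega>)) i + z \<omega> i)
           \<in> mac_space \<sigma>B \<sigma>E R1 R2 n \<rightarrow>\<^sub>M seq_space n"
proof -
  let ?M = "mac_space \<sigma>B \<sigma>E R1 R2 n"
  have countable: "countable (messages n R)" for R
    by (simp add: messages_def)
  have 1: "fst \<in> ?M \<rightarrow>\<^sub>M count_space (messages n R1)"
    unfolding measurable_cong_sets[OF sets_mac_space refl] by measurable
  have 2: "(\<lambda>\<omega>. fst (snd \<omega>)) \<in> ?M \<rightarrow>\<^sub>M count_space (messages n R2)"
    unfolding measurable_cong_sets[OF sets_mac_space refl] by measurable
  have g: "(\<lambda>\<omega>. g (fst \<omega>) (fst (snd \<omega>)) i) \<in> borel_measurable ?M" for i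
    by (rule measurable_compose_countable'[OF measurable_compose_countable'[OF _ 2 countable]
          1 countable]) simp
  have "(\<lambda>\<omega>. z \<omega> i) \<in> borel_measurable ?M" if "i < n" for i
    using that by (intro measurable_compose[OF z] measurable_component_singleton) simp
  with g show ?thesis
    by (intro measurable_restrict borel_measurable_add) auto
qed

lemma measurable_B_out: "B_out h n c \<in> mac_space \<sigma>B \<sigma>E R1 R2 n \<rightarrow>\<^sub>M seq_space n"
proof -
  have "(\<lambda>\<omega>. fst (snd (snd \<omega>))) \<in> mac_space \<sigma>B \<sigma>E R1 R2 n \<rightarrow>\<^sub>M seq_space n"
    unfolding measurable_cong_sets[OF sets_mac_space refl] by measurable
  from measurable_output[OF this, of "\<lambda>m1 m2 i. enc1 c m1 i + enc2 c m2 i + h * enc3 c m1 m2 i"]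
  show ?thesis
    by (simp add: B_out_def case_prod_beta')
qed

lemma measurable_E_out: "E_out n c \<in> mac_space \<sigma>B \<sigma>E R1 R2 n \<rightarrow>\<^sub>M seq_space n"
proof -
  have "(\<lambda>\<omega>. snd (snd (snd \<omega>))) \<in> mac_space \<sigma>B \<sigma>E R1 R2 n \<rightarrow>\<^sub>M seq_space n"
    unfolding measurable_cong_sets[OF sets_mac_space refl] by measurable
  from measurable_output[OF this, of "\<lambda>m1 m2 i. enc1 c m1 i + enc2 c m2 i + enc3 c m1 m2 i"]
  show ?thesis
    by (simp add: E_out_def case_prod_beta')
qed

end

theory Submission
  imports Defs
begin

text \<open>
  Achievability: the helper sends \<open>-(x\<^sub>1 + x\<^sub>2)\<close>, so the warden sees pure noise and the
  receiver sees \<open>(1 - h) (x\<^sub>1 + x\<^sub>2)\<close> plus noise, a Gaussian multiple-access channel. The codewords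
  are Gaussian of powers \<open>Q\<^sub>1\<close>, \<open>Q\<^sub>2\<close> where \<open>Q\<^sub>1 + Q\<^sub>2 < P\<^sub>3\<close>; on the exponentially
  rare message pairs whose codewords violate a power constraint the encoders send 0 instead, which
  changes the warden's law by a vanishing amount. The receiver looks for the unique message pair
  whose signal lies within the noise radius of the output. The union over the power splits
  \<open>(Q\<^sub>1, Q\<^sub>2)\<close> of the resulting pentagons is the whole region.

  Converse: an energy test at the warden shows that covertness forces the average of
  \<open>\<parallel>x\<^sub>1 + x\<^sub>2 + x\<^sub>3\<parallel>\<^sup>2\<close> to be \<open>o(n)\<close>. Hence the signal at the receiver is, up to negligible energy,
  both \<open>(1 - h) (x\<^sub>1 + x\<^sub>2)\<close> and \<open>(h - 1) x\<^sub>3\<close>, and Fano's inequality against a Gaussian reference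
  output law bounds every rate by the capacity at either energy.
\<close>

section \<open>Exponential moments and tails of Gaussian energies\<close>

text \<open>No entropy or mutual information occurs: both directions rest on explicit Gaussian
  integrals and averages over finitely many message pairs. Total variation controls probabilities,
  not expectations; a statement about average energy follows because the power constraints bound the
  energy at the warden by a fixed multiple of \<open>n\<close>, so that the vanishing fraction of
  message pairs with noticeable energy contributes little. For the bounds by P1, P2 and P1 + P2 the
  reference law is centred at \<open>1 - h\<close> times the other transmitter's codeword (single
  rates) or times the mean of x1 + x2 (sum rate), where the independence of the messages cancels the
  cross terms. In the direct part a codebook must serve receiver and warden at once: one bad event
  per message pair, certain as soon as a power constraint fails, lets a single average control both
  criteria. Tail and union bounds need strict inequalities in powers and rates, so pairs are first
  scaled towards 0 and the boundary is reached by the closure; zero powers and zero rates, where no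
  strict inequality is available, appear as separate alternatives.\<close>

definition nsq :: "nat \<Rightarrow> (nat \<Rightarrow> real) \<Rightarrow> real" where
  "nsq n x = (\<Sum>i<n. (x i)\<^sup>2)"

lemma nsq_nonneg [simp]: "0 \<le> nsq n x"
  by (simp add: nsq_def sum_nonneg)

lemma measurable_nsq [measurable (raw)]:
  assumes "\<And>i. i < n \<Longrightarrow> (\<lambda>w. f w i) \<in> borel_measurable M"
  shows "(\<lambda>w. nsq n (f w)) \<in> borel_measurable M"
  unfolding nsq_def using assms by (intro borel_measurable_sum borel_measurable_power) auto

lemma space_gaussian [simp]: "space (gaussian s) = UNIV"
  and sets_gaussian [simp, measurable_cong]: "sets (gaussian s) = sets borel"
  by (simp_all add: gaussian_def)

text \<open>Completing the square: the density times the exponential is a constant times the normal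
  density with mean \<open>m\<close> and deviation \<open>s / sqrt k\<close>, whose total mass is 1.
  The condition on \<open>l\<close> is exactly what makes this deviation real, and it admits
  negative \<open>l\<close>.\<close>

lemma gaussian_exp_quadratic:
  fixes a l s v :: real
  assumes s: "0 < s" and k: "0 < 1 + 2 * l * a\<^sup>2 * s\<^sup>2"
  shows "(\<integral>\<^sup>+z. ennreal (exp (- l * (v + a * z)\<^sup>2)) \<partial>gaussian s) =
    ennreal (exp (- (l / (1 + 2 * l * a\<^sup>2 * s\<^sup>2)) * v\<^sup>2) / sqrt (1 + 2 * l * a\<^sup>2 * s\<^sup>2))"
proof -
  define k where "k = 1 + 2 * l * a\<^sup>2 * s\<^sup>2"
  define m where "m = - (2 * l * a * v * s\<^sup>2 / k)"
  define C where "C = exp (- (l / k) * v\<^sup>2) / sqrt k"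
  have k0: "0 < k" using k by (simp add: k_def)
  have eq: "normal_density 0 s z * exp (- l * (v + a * z)\<^sup>2) =
      C * normal_density m (s / sqrt k) z" for z
  proof -
    have e: "- (z - 0)\<^sup>2 / (2 * s\<^sup>2) + - l * (v + a * z)\<^sup>2 =
        - (l / k) * v\<^sup>2 + - (z - m)\<^sup>2 / (2 * (s / sqrt k)\<^sup>2)"
    proof -
      \<comment> \<open>Clearing the denominators by \<open>2 * s\<^sup>2 * k\<close> reduces the
        identity of exponents to a polynomial one in \<open>k * (z - m)\<close>.\<close>
      have "2 * s\<^sup>2 * k * (- (z - 0)\<^sup>2 / (2 * s\<^sup>2) + - l * (v + a * z)\<^sup>2) =
          - k * z\<^sup>2 - 2 * s\<^sup>2 * k * l * (v + a * z)\<^sup>2"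
        using s by (simp add: field_simps)
      moreover have "2 * s\<^sup>2 * k * (- (l / k) * v\<^sup>2 + - (z - m)\<^sup>2 / (2 * (s / sqrt k)\<^sup>2)) =
          - 2 * s\<^sup>2 * l * v\<^sup>2 - (k * (z - m))\<^sup>2"
        using s k0 by (simp add: field_simps power2_eq_square)
      moreover have "k * (z - m) = k * z + 2 * l * a * v * s\<^sup>2"
        using k0 by (simp add: m_def field_simps)
      moreover have "- k * z\<^sup>2 - 2 * s\<^sup>2 * k * l * (v + a * z)\<^sup>2 =
          - 2 * s\<^sup>2 * l * v\<^sup>2 - (k * z + 2 * l * a * v * s\<^sup>2)\<^sup>2"
        unfolding k_def by (simp add: algebra_simps power2_eq_square)
      ultimately have "2 * s\<^sup>2 * k * (- (z - 0)\<^sup>2 / (2 * s\<^sup>2) + - l * (v + a * z)\<^sup>2) =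
          2 * s\<^sup>2 * k * (- (l / k) * v\<^sup>2 + - (z - m)\<^sup>2 / (2 * (s / sqrt k)\<^sup>2))" by simp
      then show ?thesis using s k0 by simp
    qed
    have "sqrt (2 * pi * (s / sqrt k)\<^sup>2) = sqrt (2 * pi * s\<^sup>2) / sqrt k"
      using k0 by (simp add: power_divide real_sqrt_divide)
    then show ?thesis
      unfolding normal_density_def C_def using k0 e by (simp add: exp_add[symmetric] field_simps)
  qed
  have "(\<integral>\<^sup>+z. ennreal (exp (- l * (v + a * z)\<^sup>2)) \<partial>gaussian s)
      = (\<integral>\<^sup>+z. ennreal (normal_density 0 s z) * ennreal (exp (- l * (v + a * z)\<^sup>2)) \<partial>lborel)"
    unfolding gaussian_def by (subst nn_integral_density) auto
  also have "\<dots> = (\<integral>\<^sup>+z. ennreal C * ennreal (normal_density m (s / sqrt k) z) \<partial>lborel)"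
  proof (rule nn_integral_cong)
    fix z
    have "0 \<le> C" using k0 by (simp add: C_def)
    then show "ennreal (normal_density 0 s z) * ennreal (exp (- l * (v + a * z)\<^sup>2)) =
        ennreal C * ennreal (normal_density m (s / sqrt k) z)"
      by (metis eq ennreal_mult exp_ge_zero normal_density_nonneg)
  qed
  also have "\<dots> = ennreal C * (\<integral>\<^sup>+z. ennreal (normal_density m (s / sqrt k) z) \<partial>lborel)"
    by (intro nn_integral_cmult) auto
  also have "(\<integral>\<^sup>+z. ennreal (normal_density m (s / sqrt k) z) \<partial>lborel) = 1"
  proof -
    interpret prob_space "density lborel (normal_density m (s / sqrt k))"
      by (rule prob_space_normal_density) (use s k0 in simp)
    show ?thesis using emeasure_space_1 by (simp add: emeasure_density)
  qed
  finally show ?thesis by (simp add: C_def k_def)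
qed

lemma space_white_noise: "space (white_noise n s) = space (seq_space n)"
  by (rule sets_eq_imp_space_eq[OF sets_white_noise])

declare sets_white_noise [measurable_cong]

lemma product_gaussian: "0 < s \<Longrightarrow> product_prob_space (\<lambda>_::nat. gaussian s)"
  by (simp add: product_prob_space_def product_sigma_finite_def product_prob_space_axioms_def
      prob_space_gaussian prob_space_imp_sigma_finite)

text \<open>All tail bounds are Chernoff bounds obtained from this formula; upper tails use negative \<open>l\<close>.\<close>

lemma white_noise_exp_quadratic:
  fixes a l s :: real
  assumes s: "0 < s" and k: "0 < 1 + 2 * l * a\<^sup>2 * s\<^sup>2"
  shows "(\<integral>\<^sup>+z. ennreal (exp (- l * nsq n (\<lambda>i. v i + a * z i))) \<partial>white_noise n s) =
    ennreal (exp (- (l / (1 + 2 * l * a\<^sup>2 * s\<^sup>2)) * nsq n v) / sqrt (1 + 2 * l * a\<^sup>2 * s\<^sup>2) ^ n)"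
proof -
  interpret product_prob_space "\<lambda>_::nat. gaussian s"
    by (rule product_gaussian[OF s])
  have "(\<integral>\<^sup>+z. ennreal (exp (- l * nsq n (\<lambda>i. v i + a * z i))) \<partial>white_noise n s)
     = (\<integral>\<^sup>+z. (\<Prod>i<n. ennreal (exp (- l * (v i + a * z i)\<^sup>2))) \<partial>white_noise n s)"
    by (simp add: nsq_def sum_distrib_left exp_sum prod_ennreal)
  also have "\<dots> = (\<Prod>i<n. \<integral>\<^sup>+z. ennreal (exp (- l * (v i + a * z)\<^sup>2)) \<partial>gaussian s)"
    unfolding white_noise_def by (subst product_nn_integral_prod) auto
  also have "\<dots> = ennreal (exp (- (l / (1 + 2 * l * a\<^sup>2 * s\<^sup>2)) * nsq n v) / sqrt (1 + 2 * l *
      a\<^sup>2 * s\<^sup>2) ^ n)"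
    unfolding gaussian_exp_quadratic[OF s k]
    using k by (simp add: prod_ennreal nsq_def sum_distrib_left exp_sum prod_dividef)
  finally show ?thesis .
qed

text \<open>The sign of \<open>f\<close> near 0 is decided by \<open>f' 0 = t - s - k\<close>.\<close>

lemma chernoff_exponent:
  fixes t s k :: real
  defines "f \<equiv> \<lambda>l. l * t - ln (1 + 2 * l * s) / 2 - l * k / (1 + 2 * l * s)"
  shows "t < s + k \<Longrightarrow> \<exists>l>0. 0 < 1 + 2 * l * s \<and> f l < 0"
    and "s + k < t \<Longrightarrow> \<exists>l<0. 0 < 1 + 2 * l * s \<and> f l < 0"
proof -
  have D: "(f has_real_derivative (t - s - k)) (at 0)"
    unfolding f_def by (auto intro!: derivative_eq_intros)
  have f0: "f 0 = 0" by (simp add: f_def)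
  \<comment> \<open>This radius gives |l s| < 1/2 for either sign of \<open>s\<close>; the 1 in the
    denominator covers s = 0.\<close>
  define d where "d = 1 / (2 * (\<bar>s\<bar> + 1))"
  have d0: "0 < d" unfolding d_def by (intro divide_pos_pos) auto
  have dom: "0 < 1 + 2 * l * s" if "\<bar>l\<bar> < d" for l
  proof -
    have "\<bar>l\<bar> * \<bar>s\<bar> \<le> \<bar>l\<bar> * (\<bar>s\<bar> + 1)" by (simp add: algebra_simps)
    also have "\<dots> < d * (\<bar>s\<bar> + 1)" using that by (intro mult_strict_right_mono) auto
    also have "\<dots> = 1 / 2" by (simp add: d_def)
    finally have "\<bar>l * s\<bar> < 1 / 2" by (simp add: abs_mult)
    then show ?thesis by linarith
  qed
  {
    assume "t < s + k"
    with D f0 obtain e where e: "0 < e" "\<And>l. 0 < l \<Longrightarrow> l < e \<Longrightarrow> f l < 0"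
      using DERIV_neg_dec_right[OF D] by auto
    with d0 dom[of "min d e / 2"] show "\<exists>l>0. 0 < 1 + 2 * l * s \<and> f l < 0"
      by (intro exI[of _ "min d e / 2"]) (auto simp: min_def)
  }
  {
    assume "s + k < t"
    with D f0 obtain e where e: "0 < e" "\<And>l. 0 < l \<Longrightarrow> l < e \<Longrightarrow> f (- l) < 0"
      using DERIV_pos_inc_left[OF D] by auto
    with d0 dom[of "- (min d e / 2)"] show "\<exists>l<0. 0 < 1 + 2 * l * s \<and> f l < 0"
      using e(2)[of "min d e / 2"] by (intro exI[of _ "- (min d e / 2)"]) (auto simp: min_def)
  }
qed

text \<open>The pointwise inequality behind every Chernoff bound. The right side is a product so
  that the constant factor can be moved out of the integral.\<close>

lemma indicator_le_exp:
  assumes "x \<in> A \<Longrightarrow> 0 \<le> u + v"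
  shows "indicator A x \<le> ennreal (exp u) * ennreal (exp v)"
  using assms ennreal_leI[of 1 "exp (u + v)"]
  by (auto simp: indicator_def ennreal_mult[symmetric] exp_add[symmetric])

text \<open>Only \<open>a\<^sup>2 + b\<^sup>2\<close>, the variance of a x + b y, enters. The law of
  the sum is never formed: integrating over \<open>y\<close> first replaces \<open>l\<close> by
  \<open>l / k1\<close>, integrating over \<open>x\<close> then follows the same formula, and the
  two normalising factors combine by \<open>prod\<close>.\<close>

lemma pair_exp_quadratic:
  fixes a b l :: real
  assumes k: "0 < 1 + 2 * l * (a\<^sup>2 + b\<^sup>2)"
  shows "(\<integral>\<^sup>+x. \<integral>\<^sup>+y. ennreal (exp (- l * nsq n (\<lambda>i. v i + a * x i + b * y i)))
      \<partial>white_noise n 1 \<partial>white_noise n 1) =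
    ennreal (exp (- (l / (1 + 2 * l * (a\<^sup>2 + b\<^sup>2))) * nsq n v) / sqrt (1 + 2 * l * (a\<^sup>2 +
        b\<^sup>2)) ^ n)"
proof -
  define k1 where "k1 = 1 + 2 * l * b\<^sup>2"
  \<comment> \<open>For negative \<open>l\<close> the omitted term \<open>2 * l * a\<^sup>2\<close>
    is at most 0, so \<open>k1\<close> is at least the quantity assumed positive.\<close>
  have k1: "0 < k1"
  proof (cases "0 \<le> l")
    case False
    then have "l * a\<^sup>2 \<le> 0" by (simp add: mult_nonpos_nonneg)
    with k show ?thesis by (simp add: k1_def algebra_simps)
  qed (simp add: k1_def add_pos_nonneg)
  have prod: "k1 * (1 + 2 * (l / k1) * a\<^sup>2) = 1 + 2 * l * (a\<^sup>2 + b\<^sup>2)"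
    using k1 by (simp add: field_simps) (simp add: k1_def algebra_simps)
  have k2: "0 < 1 + 2 * (l / k1) * a\<^sup>2"
    using prod k k1 by (metis zero_less_mult_pos)
  have "(\<integral>\<^sup>+x. \<integral>\<^sup>+y. ennreal (exp (- l * nsq n (\<lambda>i. v i + a * x i + b * y i)))
      \<partial>white_noise n 1 \<partial>white_noise n 1) =
    (\<integral>\<^sup>+x. ennreal (exp (- (l / k1) * nsq n (\<lambda>i. v i + a * x i))) *
        ennreal (1 / sqrt k1 ^ n) \<partial>white_noise n 1)"
    using white_noise_exp_quadratic[of 1 l b n] k1
    by (intro nn_integral_cong) (simp add: k1_def ennreal_mult[symmetric])
  also have "\<dots> = ennreal (exp (- (l / k1 / (1 + 2 * (l / k1) * a\<^sup>2)) * nsq n v) / sqrt (1 + 2 *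
      (l / k1) * a\<^sup>2) ^ n)
      * ennreal (1 / sqrt k1 ^ n)"
    using white_noise_exp_quadratic[of 1 "l / k1" a n v] k2
    by (subst nn_integral_multc) simp_all
  also have "\<dots> = ennreal (exp (- (l / (1 + 2 * l * (a\<^sup>2 + b\<^sup>2))) * nsq n v) / sqrt (1 + 2 * l *
      (a\<^sup>2 + b\<^sup>2)) ^ n)"
    unfolding prod[symmetric] using k1 k2
    by (simp add: ennreal_mult[symmetric] real_sqrt_mult power_mult_distrib)
  finally show ?thesis .
qed

section \<open>Chernoff bounds in geometric form\<close>

lemma exp_over_sqrt_power:
  assumes "0 < k"
  shows "exp (real n * x) / sqrt k ^ n = exp (x - ln k / 2) ^ n"
proof -
  have "exp (- (ln k / 2)) = 1 / sqrt k"
    using assms by (simp add: exp_minus inverse_eq_divide ln_sqrt[symmetric])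
  then have "exp (x - ln k / 2) = exp x / sqrt k"
    by (simp add: diff_conv_add_uminus exp_add del: add_uminus_conv_diff)
  then show ?thesis by (simp add: power_divide exp_of_nat_mult)
qed

lemma white_noise_upper_tail:
  assumes s: "0 < s" and t: "s\<^sup>2 < t"
  obtains r where "0 \<le> r" "r < 1"
    "\<And>n. (\<integral>\<^sup>+z. indicator {z. real n * t < nsq n z} z \<partial>white_noise n s) \<le> ennreal (r ^ n)"
proof -
  from chernoff_exponent(2)[of "s\<^sup>2" 0 t] t obtain l where
    l: "l < 0" "0 < 1 + 2 * l * s\<^sup>2" "l * t - ln (1 + 2 * l * s\<^sup>2) / 2 < 0" by auto
  have "(\<integral>\<^sup>+z. indicator {z. real n * t < nsq n z} z \<partial>white_noise n s)
      \<le> ennreal (exp (l * t - ln (1 + 2 * l * s\<^sup>2) / 2) ^ n)" for n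
  proof -
    have "(\<integral>\<^sup>+z. indicator {z. real n * t < nsq n z} z \<partial>white_noise n s)
      \<le> (\<integral>\<^sup>+z. ennreal (exp (real n * (l * t))) * ennreal (exp (- l * nsq n (\<lambda>i. 0 + 1 *
          z i))) \<partial>white_noise n s)"
      using l(1) by (intro nn_integral_mono indicator_le_exp) (auto simp: mult_le_cancel_left
          divide_right_mono)
    also have "\<dots> = ennreal (exp (real n * (l * t))) * ennreal (exp (- (l / (1 + 2 * l * s\<^sup>2)) *
        nsq n (\<lambda>_. 0)) / sqrt (1 + 2 * l * s\<^sup>2) ^ n)"
      using white_noise_exp_quadratic[OF s, of l 1 n "\<lambda>_. 0"] l(2)
      by (subst nn_integral_cmult) simp_all
    also have "\<dots> = ennreal (exp (l * t - ln (1 + 2 * l * s\<^sup>2) / 2) ^ n)"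
      using l(2) by (simp add: ennreal_mult[symmetric] nsq_def exp_over_sqrt_power[symmetric])
    finally show ?thesis .
  qed
  with l(3) show ?thesis by (intro that[of "exp (l * t - ln (1 + 2 * l * s\<^sup>2) / 2)"]) auto
qed

text \<open>One rate \<open>r\<close> serves all shifts of energy at least n k: for positive
  \<open>l\<close> the exponential moment decreases with the energy of the shift, so energy exactly
  n k is the worst case. Averages over message pairs at the warden need this uniformity.\<close>

lemma shifted_white_noise_lower_tail:
  assumes s: "0 < s" and t: "t < s\<^sup>2 + k"
  obtains r where "0 \<le> r" "r < 1"
    "\<And>n v. real n * k \<le> nsq n v \<Longrightarrow>
      (\<integral>\<^sup>+z. indicator {z. nsq n (\<lambda>i. v i + z i) \<le> real n * t} z \<partial>white_noise n s) \<le>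
          ennreal (r ^ n)"
proof -
  define f where "f l = l * t - ln (1 + 2 * l * s\<^sup>2) / 2 - l * k / (1 + 2 * l * s\<^sup>2)" for l
  from chernoff_exponent(1)[of t "s\<^sup>2" k] t obtain l where
    l: "0 < l" "0 < 1 + 2 * l * s\<^sup>2" "f l < 0" by (auto simp: f_def)
  have "(\<integral>\<^sup>+z. indicator {z. nsq n (\<lambda>i. v i + z i) \<le> real n * t} z \<partial>white_noise n s)
      \<le> ennreal (exp (f l) ^ n)" if v: "real n * k \<le> nsq n v" for n v
  proof -
    let ?k = "1 + 2 * l * s\<^sup>2"
    have "(\<integral>\<^sup>+z. indicator {z. nsq n (\<lambda>i. v i + z i) \<le> real n * t} z \<partial>white_noise n s)
      \<le> (\<integral>\<^sup>+z. ennreal (exp (real n * (l * t))) * ennreal (exp (- l * nsq n (\<lambda>i. v i + 1 *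
          z i))) \<partial>white_noise n s)"
      using l(1) by (intro nn_integral_mono indicator_le_exp) (auto simp: mult_le_cancel_left
          divide_right_mono)
    also have "\<dots> = ennreal (exp (real n * (l * t))) * ennreal (exp (- (l / ?k) *
        nsq n v) / sqrt ?k ^ n)"
      using white_noise_exp_quadratic[OF s, of l 1 n v] l(2)
      by (subst nn_integral_cmult) simp_all
    also have "\<dots> \<le> ennreal (exp (real n * (l * t)) * (exp (- (l / ?k) * (real n *
        k)) / sqrt ?k ^ n))"
      using l v by (subst ennreal_mult[symmetric])
       (auto intro!: ennreal_leI mult_left_mono divide_right_mono simp: divide_right_mono
           mult_left_mono)
    also have "exp (real n * (l * t)) * (exp (- (l / ?k) * (real n * k)) / sqrt ?k ^ n) =
        exp (real n * (l * t - l * k / ?k)) / sqrt ?k ^ n"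
      by (simp add: exp_diff exp_minus inverse_eq_divide algebra_simps)
    also have "\<dots> = exp (f l) ^ n"
      by (subst exp_over_sqrt_power[OF l(2)]) (simp add: f_def diff_diff_eq2 diff_diff_eq
          add.commute)
    finally show ?thesis .
  qed
  with l(3) show ?thesis by (intro that[of "exp (f l)"]) auto
qed

text \<open>The second alternative covers a vanishing power constraint: with both amplitudes 0 the
  codeword is 0 and the event is empty, although no strict inequality is available.\<close>

lemma codeword_upper_tail:
  assumes t: "a\<^sup>2 + b\<^sup>2 < t \<or> a\<^sup>2 + b\<^sup>2 = 0 \<and> 0 \<le> t"
  obtains r where "0 \<le> r" "r < 1"
    "\<And>n. (\<integral>\<^sup>+x. \<integral>\<^sup>+y. indicator {x. real n * t < nsq n x} (\<lambda>i. a * x i + b * y i)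
        \<partial>white_noise n 1 \<partial>white_noise n 1) \<le> ennreal (r ^ n)"
proof (cases "a\<^sup>2 + b\<^sup>2 < t")
  case True
  let ?s = "a\<^sup>2 + b\<^sup>2"
  from chernoff_exponent(2)[of ?s 0 t] True obtain l where
    l: "l < 0" "0 < 1 + 2 * l * ?s" "l * t - ln (1 + 2 * l * ?s) / 2 < 0" by auto
  have "(\<integral>\<^sup>+x. \<integral>\<^sup>+y. indicator {x. real n * t < nsq n x} (\<lambda>i. a * x i + b * y i)
        \<partial>white_noise n 1 \<partial>white_noise n 1)
      \<le> ennreal (exp (l * t - ln (1 + 2 * l * ?s) / 2) ^ n)" for n
  proof -
    have "(\<integral>\<^sup>+x. \<integral>\<^sup>+y. indicator {x. real n * t < nsq n x} (\<lambda>i. a * x i + b * y i)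
        \<partial>white_noise n 1 \<partial>white_noise n 1)
      \<le> (\<integral>\<^sup>+x. \<integral>\<^sup>+y. ennreal (exp (real n * (l * t))) * ennreal (exp (- l * nsq n (\<lambda>i. 0 + a *
          x i + b * y i)))
        \<partial>white_noise n 1 \<partial>white_noise n 1)"
      using l(1) by (intro nn_integral_mono indicator_le_exp) (auto simp: mult_le_cancel_left
          divide_right_mono)
    also have "\<dots> = ennreal (exp (real n * (l * t))) *
      (\<integral>\<^sup>+x. \<integral>\<^sup>+y. ennreal (exp (- l * nsq n (\<lambda>i. 0 + a * x i + b * y i)))
        \<partial>white_noise n 1 \<partial>white_noise n 1)"
    proof -
      interpret prob_space "white_noise n 1" by (rule prob_space_white_noise) simp
      show ?thesis by (simp add: nn_integral_cmult)
    qed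
    also have "\<dots> = ennreal (exp (real n * (l * t))) *
       ennreal (exp (- (l / (1 + 2 * l * ?s)) * nsq n (\<lambda>_. 0)) / sqrt (1 + 2 * l * ?s) ^ n)"
      by (subst pair_exp_quadratic[OF l(2)]) rule
    also have "\<dots> = ennreal (exp (l * t - ln (1 + 2 * l * ?s) / 2) ^ n)"
      using l(2) by (simp add: ennreal_mult[symmetric] nsq_def exp_over_sqrt_power[symmetric])
    finally show ?thesis .
  qed
  with l(3) show ?thesis by (intro that[of "exp (l * t - ln (1 + 2 * l * ?s) / 2)"]) auto
next
  case False
  with t have "a = 0" "b = 0" "0 \<le> t" by auto
  then have "\<not> real n * t < nsq n (\<lambda>i. a * x i + b * y i)" for n x y
    by (simp add: nsq_def not_less)
  then show ?thesis by (intro that[of 0]) (auto simp: indicator_def)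
qed

text \<open>The output has variance \<open>a\<^sup>2 + b\<^sup>2 + s\<^sup>2\<close> per coordinate.
  Integrating the noise innermost leaves a pair integral with \<open>l / k\<close> in place of
  \<open>l\<close>. The bound supplies the typicality of the output that the estimate for wrong
  codewords presupposes.\<close>

lemma output_lower_tail:
  assumes s: "0 < s" and t: "t < a\<^sup>2 + b\<^sup>2 + s\<^sup>2"
  obtains r where "0 \<le> r" "r < 1"
    "\<And>n. (\<integral>\<^sup>+x. \<integral>\<^sup>+y. \<integral>\<^sup>+z. indicator {x. nsq n x < real n * t} (\<lambda>i. a * x i + b * y i + z i)
        \<partial>white_noise n s \<partial>white_noise n 1 \<partial>white_noise n 1) \<le> ennreal (r ^ n)"
proof -
  let ?s = "a\<^sup>2 + b\<^sup>2 + s\<^sup>2"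
  from chernoff_exponent(1)[of t ?s 0] t obtain l where
    l: "0 < l" "0 < 1 + 2 * l * ?s" "l * t - ln (1 + 2 * l * ?s) / 2 < 0" by auto
  define k where "k = 1 + 2 * l * s\<^sup>2"
  have k: "0 < k" using l(1) by (simp add: k_def add_pos_nonneg)
  have prod: "k * (1 + 2 * (l / k) * (a\<^sup>2 + b\<^sup>2)) = 1 + 2 * l * ?s"
    using k by (simp add: field_simps) (simp add: k_def algebra_simps)
  have k2: "0 < 1 + 2 * (l / k) * (a\<^sup>2 + b\<^sup>2)"
    using prod k l by (metis zero_less_mult_pos)
  have "(\<integral>\<^sup>+x. \<integral>\<^sup>+y. \<integral>\<^sup>+z. indicator {x. nsq n x < real n * t} (\<lambda>i. a * x i + b * y i + z i)
        \<partial>white_noise n s \<partial>white_noise n 1 \<partial>white_noise n 1)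
      \<le> ennreal (exp (l * t - ln (1 + 2 * l * ?s) / 2) ^ n)" for n
  proof -
    interpret S: prob_space "white_noise n s" by (rule prob_space_white_noise[OF s])
    interpret prob_space "white_noise n 1" by (rule prob_space_white_noise) simp
    have "(\<integral>\<^sup>+z. indicator {x. nsq n x < real n * t} (\<lambda>i. a * x i + b * y i + z i) \<partial>white_noise n s)
      \<le> ennreal (exp (real n * (l * t)) / sqrt k ^ n) * ennreal (exp (- (l / k) * nsq n (\<lambda>i. 0 +
          a * x i + b * y i)))"
      for x y
    proof -
      have "(\<integral>\<^sup>+z. indicator {x. nsq n x < real n * t} (\<lambda>i. a * x i + b * y i +
          z i) \<partial>white_noise n s)
       \<le> (\<integral>\<^sup>+z. ennreal (exp (real n * (l * t))) * ennreal (exp (- l * nsq n (\<lambda>i. (a * x i + b *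
           y i) + 1 * z i)))
        \<partial>white_noise n s)"
        using l(1) by (intro nn_integral_mono indicator_le_exp) (auto simp: mult_le_cancel_left
            divide_right_mono)
      also have "\<dots> = ennreal (exp (real n * (l * t))) * ennreal (exp (- (l / k) * nsq n (\<lambda>i. a *
          x i + b * y i)) / sqrt k ^ n)"
        using white_noise_exp_quadratic[OF s, of l 1 n "\<lambda>i. a * x i + b * y i"] k
        by (subst nn_integral_cmult) (simp_all add: k_def)
      also have "\<dots> = ennreal (exp (real n * (l * t)) / sqrt k ^ n) * ennreal (exp (- (l / k) *
          nsq n (\<lambda>i. 0 + a * x i + b * y i)))"
        using k by (simp add: ennreal_mult[symmetric])
      finally show ?thesis .
    qed
    then have "(\<integral>\<^sup>+x. \<integral>\<^sup>+y. \<integral>\<^sup>+z. indicator {x. nsq n x < real n * t} (\<lambda>i. a * x i + b * y i + z i)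
        \<partial>white_noise n s \<partial>white_noise n 1 \<partial>white_noise n 1)
      \<le> (\<integral>\<^sup>+x. \<integral>\<^sup>+y. ennreal (exp (real n * (l * t)) / sqrt k ^ n) * ennreal (exp (- (l / k) *
          nsq n (\<lambda>i. 0 + a * x i + b * y i)))
       \<partial>white_noise n 1 \<partial>white_noise n 1)"
      by (intro nn_integral_mono)
    also have "\<dots> = ennreal (exp (real n * (l * t)) / sqrt k ^ n) *
      (\<integral>\<^sup>+x. \<integral>\<^sup>+y. ennreal (exp (- (l / k) * nsq n (\<lambda>i. 0 + a * x i + b * y i)))
       \<partial>white_noise n 1 \<partial>white_noise n 1)"
      by (simp add: nn_integral_cmult)
    also have "\<dots> = ennreal (exp (real n * (l * t)) / sqrt k ^ n) * ennreal (1 / sqrt (1 + 2 *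
        (l / k) * (a\<^sup>2 + b\<^sup>2)) ^ n)"
      by (subst pair_exp_quadratic[OF k2]) (simp add: nsq_def)
    also have "\<dots> = ennreal (exp (real n * (l * t)) / sqrt (1 + 2 * l * ?s) ^ n)"
      unfolding prod[symmetric] using k k2
      by (simp add: ennreal_mult[symmetric] real_sqrt_mult power_mult_distrib)
    also have "\<dots> = ennreal (exp (l * t - ln (1 + 2 * l * ?s) / 2) ^ n)"
      using l(2) by (simp add: exp_over_sqrt_power[symmetric])
    finally show ?thesis .
  qed
  with l(3) show ?thesis by (intro that[of "exp (l * t - ln (1 + 2 * l * ?s) / 2)"]) auto
qed

text \<open>The Chernoff parameter \<open>1 / (2 s\<^sup>2)\<close> turns the exponent into the capacity
  \<open>ln (S / s\<^sup>2) / 2\<close> as \<open>\<tau> \<rightarrow> s\<^sup>2\<close> and \<open>t \<rightarrow> S\<close>. Without the typicality condition on \<open>u\<close> no bound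
  uniform in \<open>u\<close> of this size holds.\<close>

lemma wrong_codeword_bound:
  fixes a b s :: real
  assumes s: "0 < s"
  defines "S \<equiv> a\<^sup>2 + b\<^sup>2 + s\<^sup>2"
  shows "(\<integral>\<^sup>+x. \<integral>\<^sup>+y. indicator {v. real n * t \<le> nsq n u \<and> nsq n v \<le>
      real n * \<tau>} (\<lambda>i. u i - a * x i - b * y i)
        \<partial>white_noise n 1 \<partial>white_noise n 1) \<le>
    ennreal (exp (\<tau> / (2 * s\<^sup>2) - t / (2 * S) - ln (S / s\<^sup>2) / 2) ^ n)"
proof (cases "real n * t \<le> nsq n u")
  case True
  let ?l = "1 / (2 * s\<^sup>2)"
  interpret prob_space "white_noise n 1" by (rule prob_space_white_noise) simp
  have k: "1 + 2 * ?l * ((- a)\<^sup>2 + (- b)\<^sup>2) = S / s\<^sup>2" using s by (simp add: S_def field_simps)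
  have S: "0 < S" using s by (simp add: S_def add_nonneg_pos)
  have k0: "0 < S / s\<^sup>2" using s S by simp
  have "(\<integral>\<^sup>+x. \<integral>\<^sup>+y. indicator {v. real n * t \<le> nsq n u \<and> nsq n v \<le>
      real n * \<tau>} (\<lambda>i. u i - a * x i - b * y i)
        \<partial>white_noise n 1 \<partial>white_noise n 1)
     \<le> (\<integral>\<^sup>+x. \<integral>\<^sup>+y. ennreal (exp (real n * (?l * \<tau>))) * ennreal (exp (- ?l * nsq n (\<lambda>i. u i +
         (- a) * x i + (- b) * y i)))
        \<partial>white_noise n 1 \<partial>white_noise n 1)"
    using s by (intro nn_integral_mono indicator_le_exp) (auto simp: mult_le_cancel_left
        divide_right_mono)
  also have "\<dots> = ennreal (exp (real n * (?l * \<tau>))) *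
    (\<integral>\<^sup>+x. \<integral>\<^sup>+y. ennreal (exp (- ?l * nsq n (\<lambda>i. u i + (- a) * x i + (- b) * y i)))
        \<partial>white_noise n 1 \<partial>white_noise n 1)"
    by (simp add: nn_integral_cmult del: minus_mult_left mult_minus_left)
  also have "\<dots> = ennreal (exp (real n * (?l * \<tau>))) * ennreal (exp (- (?l / (S / s\<^sup>2)) *
      nsq n u) / sqrt (S / s\<^sup>2) ^ n)"
    using k0 by (subst pair_exp_quadratic) (simp_all only: k)
  also have "\<dots> \<le> ennreal (exp (real n * (?l * \<tau>)) * (exp (- (?l / (S / s\<^sup>2)) * (real n *
      t)) / sqrt (S / s\<^sup>2) ^ n))"
  proof -
    have "- (?l / (S / s\<^sup>2)) * nsq n u \<le> - (?l / (S / s\<^sup>2)) * (real n * t)"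
      using S s True by (intro mult_left_mono_neg) auto
    then show ?thesis using k0
      by (subst ennreal_mult[symmetric]) (auto intro!: ennreal_leI mult_left_mono divide_right_mono)
  qed
  also have "exp (real n * (?l * \<tau>)) * (exp (- (?l / (S / s\<^sup>2)) * (real n *
      t)) / sqrt (S / s\<^sup>2) ^ n)
      = exp (real n * (\<tau> / (2 * s\<^sup>2) - t / (2 * S))) / sqrt (S / s\<^sup>2) ^ n"
    using s S by (simp add: exp_add[symmetric] algebra_simps)
  also have "\<dots> = exp (\<tau> / (2 * s\<^sup>2) - t / (2 * S) - ln (S / s\<^sup>2) / 2) ^ n"
    by (rule exp_over_sqrt_power[OF k0])
  finally show ?thesis .
qed simp

section \<open>Error probability and warden law as message averages\<close>

lemma finite_messages [simp]: "finite (messages n R)"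
  by (simp add: messages_def)

lemma card_messages_pos: "0 \<le> R \<Longrightarrow> 0 < card (messages n R)"
  using messages_nonempty by (simp add: card_gt_0_iff)

lemma measure_mac_space:
  assumes s: "0 < \<sigma>B" "0 < \<sigma>E" and R: "0 \<le> R1" "0 \<le> R2"
    and X: "\<And>m1 m2. m1 \<in> messages n R1 \<Longrightarrow> m2 \<in> messages n R2 \<Longrightarrow> X m1 m2 \<in> sets (white_noise n \<sigma>B)"
    and Y: "\<And>m1 m2. m1 \<in> messages n R1 \<Longrightarrow> m2 \<in> messages n R2 \<Longrightarrow> Y m1 m2 \<in> sets (white_noise n \<sigma>E)"
  shows "measure (mac_space \<sigma>B \<sigma>E R1 R2 n)
      {(m1, m2, zB, zE). m1 \<in> messages n R1 \<and> m2 \<in> messages n R2 \<and> zB \<in> X m1 m2 \<and> zE \<in> Y m1 m2} =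
    (\<Sum>m1\<in>messages n R1. \<Sum>m2\<in>messages n R2.
        measure (white_noise n \<sigma>B) (X m1 m2) * measure (white_noise n \<sigma>E) (Y m1 m2)) /
      (real (card (messages n R1)) * real (card (messages n R2)))"
    (is "measure ?M ?S = _")
proof -
  let ?A = "messages n R1" and ?B = "messages n R2"
  interpret prob_space ?M by (rule prob_space_mac_space[OF s R])
  interpret WB: prob_space "white_noise n \<sigma>B" by (rule prob_space_white_noise[OF s(1)])
  interpret WE: prob_space "white_noise n \<sigma>E" by (rule prob_space_white_noise[OF s(2)])
  interpret WW: pair_prob_space "white_noise n \<sigma>B" "white_noise n \<sigma>E" ..
  interpret U2: prob_space "uniform_count_measure ?B"
    by (rule prob_space_uniform_count_measure) (simp_all add: messages_nonempty R)
  interpret U2W: pair_prob_space "uniform_count_measure ?B" "white_noise n \<sigma>B \<Otimes>\<^sub>M white_noise n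
      \<sigma>E" ..
  let ?T = "\<lambda>p. {fst p} \<times> {snd p} \<times> X (fst p) (snd p) \<times> Y (fst p) (snd p)"
  have S: "?S = (\<Union>p\<in>?A \<times> ?B. ?T p)" by auto
  have sets: "?T p \<in> sets ?M" if "p \<in> ?A \<times> ?B" for p
    unfolding mac_space_def using that X Y
    by (intro pair_measureI) (auto simp: sets_uniform_count_measure)
  have 1: "measure ?M (?T p) = measure (white_noise n \<sigma>B) (X (fst p) (snd p)) *
        measure (white_noise n \<sigma>E) (Y (fst p) (snd p)) / (real (card ?A) * real (card ?B))"
    if p: "p \<in> ?A \<times> ?B" for p
  proof -
    have "emeasure ?M (?T p) = emeasure (uniform_count_measure ?A) {fst p} *
      (emeasure (uniform_count_measure ?B) {snd p} *
       (emeasure (white_noise n \<sigma>B) (X (fst p) (snd p)) *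
           emeasure (white_noise n \<sigma>E) (Y (fst p) (snd p))))"
      unfolding mac_space_def using p X Y
      by (subst U2W.emeasure_pair_measure_Times, (auto simp: sets_uniform_count_measure)[2],
          subst WW.emeasure_pair_measure_Times, (auto simp: sets_uniform_count_measure)[2],
          subst WE.emeasure_pair_measure_Times) auto
    also have "\<dots> = ennreal (measure (white_noise n \<sigma>B) (X (fst p) (snd p)) *
        measure (white_noise n \<sigma>E) (Y (fst p) (snd p)) / (real (card ?A) * real (card ?B)))"
      using p by (auto simp: emeasure_uniform_count_measure WB.emeasure_eq_measure
          WE.emeasure_eq_measure
          ennreal_mult[symmetric] field_simps)
    finally show ?thesis by (simp add: emeasure_eq_measure)
  qed
  have "measure ?M ?S = (\<Sum>p\<in>?A \<times> ?B. measure ?M (?T p))"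
    unfolding S using sets by (intro measure_finite_Union) (auto simp: disjoint_family_on_def
        emeasure_eq_measure)
  also have "\<dots> = (\<Sum>p\<in>?A \<times> ?B. measure (white_noise n \<sigma>B) (X (fst p) (snd p)) *
        measure (white_noise n \<sigma>E) (Y (fst p) (snd p)) / (real (card ?A) * real (card ?B)))"
    using 1 by (rule sum.cong[OF refl])
  finally show ?thesis by (simp add: sum.cartesian_product sum_divide_distrib case_prod_beta)
qed

lemma measurable_shift:
  "(\<lambda>z. \<lambda>i\<in>{..<n}. v i + z i) \<in> seq_space n \<rightarrow>\<^sub>M seq_space n"
  by (intro measurable_restrict borel_measurable_add) auto

lemma measurable_shift_white_noise:
  "(\<lambda>z. \<lambda>i\<in>{..<n}. v i + z i) \<in> white_noise n s \<rightarrow>\<^sub>M seq_space n"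
  using measurable_shift unfolding measurable_cong_sets[OF sets_white_noise refl] .

definition signal_B :: "real \<Rightarrow> mac_code \<Rightarrow> nat \<Rightarrow> nat \<Rightarrow> nat \<Rightarrow> real" where
  "signal_B h c m1 m2 = (\<lambda>i. enc1 c m1 i + enc2 c m2 i + h * enc3 c m1 m2 i)"

definition signal_E :: "mac_code \<Rightarrow> nat \<Rightarrow> nat \<Rightarrow> nat \<Rightarrow> real" where
  "signal_E c m1 m2 = (\<lambda>i. enc1 c m1 i + enc2 c m2 i + enc3 c m1 m2 i)"

definition shifted_noise :: "nat \<Rightarrow> real \<Rightarrow> (nat \<Rightarrow> real) \<Rightarrow> (nat \<Rightarrow> real) measure" where
  "shifted_noise n s v = distr (white_noise n s) (seq_space n) (\<lambda>z. \<lambda>i\<in>{..<n}. v i + z i)"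

lemma space_shifted_noise [simp]: "space (shifted_noise n s v) = space (seq_space n)"
  and sets_shifted_noise [simp, measurable_cong]: "sets (shifted_noise n s v) = sets (seq_space n)"
  by (simp_all add: shifted_noise_def)

lemma prob_space_shifted_noise: "0 < s \<Longrightarrow> prob_space (shifted_noise n s v)"
  unfolding shifted_noise_def
  by (intro prob_space.prob_space_distr prob_space_white_noise measurable_shift_white_noise)

lemma measure_shifted_noise:
  "A \<in> sets (seq_space n) \<Longrightarrow> measure (shifted_noise n s v) A =
    measure (white_noise n s) {z \<in> space (seq_space n). (\<lambda>i\<in>{..<n}. v i + z i) \<in> A}"
  unfolding shifted_noise_def
  by (subst measure_distr) (auto simp: measurable_shift_white_noise
      space_white_noise vimage_def intro!: arg_cong[where f="measure _"])

lemma shifted_preimage_sets: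
  "A \<in> sets (seq_space n) \<Longrightarrow> {z \<in> space (seq_space n). (\<lambda>i\<in>{..<n}. v i +
      z i) \<in> A} \<in> sets (white_noise n s)"
  using measurable_sets[OF measurable_shift, of A n v]
      by (simp add: sets_white_noise vimage_def Int_def conj_commute)

lemma space_mac_space:
  "space (mac_space \<sigma>B \<sigma>E R1 R2 n) = messages n R1 \<times> messages n R2 \<times> space (seq_space n) \<times> space
      (seq_space n)"
  by (simp add: mac_space_def space_pair_measure space_uniform_count_measure space_white_noise)

lemma error_prob_eq:
  assumes s: "0 < \<sigma>B" "0 < \<sigma>E" and R: "0 \<le> R1" "0 \<le> R2"
    and c: "dec c \<in> seq_space n \<rightarrow>\<^sub>M count_space (messages n R1 \<times> messages n R2)"
  shows "error_prob h \<sigma>B \<sigma>E R1 R2 n c =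
    (\<Sum>m1\<in>messages n R1. \<Sum>m2\<in>messages n R2.
        measure (shifted_noise n \<sigma>B (signal_B h c m1 m2)) {y \<in> space (seq_space n). dec c y \<noteq> (m1,
            m2)}) /
      (real (card (messages n R1)) * real (card (messages n R2)))"
proof -
  have A: "{y \<in> space (seq_space n). dec c y \<noteq> (m1, m2)} \<in> sets (seq_space n)" for m1 m2
  proof -
    have "dec c -` (messages n R1 \<times> messages n R2 - {(m1,
        m2)}) \<inter> space (seq_space n) \<in> sets (seq_space n)"
      by (rule measurable_sets[OF c]) auto
    also have "dec c -` (messages n R1 \<times> messages n R2 - {(m1, m2)}) \<inter> space (seq_space n)
      = {y \<in> space (seq_space n). dec c y \<noteq> (m1, m2)}"
      using measurable_space[OF c] by auto
    finally show ?thesis .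
  qed
  interpret WE: prob_space "white_noise n \<sigma>E" by (rule prob_space_white_noise[OF s(2)])
  let ?X = "\<lambda>m1 m2. {z \<in> space (seq_space n). (\<lambda>i\<in>{..<n}. signal_B h c m1 m2 i + z i) \<in>
      {y \<in> space (seq_space n). dec c y \<noteq> (m1, m2)}}"
  have eq: "{\<omega> \<in> space (mac_space \<sigma>B \<sigma>E R1 R2 n). dec c (B_out h n c \<omega>) \<noteq> (case \<omega> of (m1, m2, zB,
      zE) \<Rightarrow> (m1, m2))}
     = {(m1, m2, zB, zE). m1 \<in> messages n R1 \<and> m2 \<in> messages n R2 \<and> zB \<in> ?X m1 m2 \<and> zE \<in> space
         (white_noise n \<sigma>E)}"
    by (auto simp: space_mac_space space_white_noise B_out_def signal_B_def space_PiM)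
  show ?thesis
    unfolding error_prob_def eq
    by (subst measure_mac_space[OF s R]) (use A in \<open>auto simp: shifted_preimage_sets WE.prob_space
        measure_shifted_noise\<close>)
qed

lemma measure_warden_law:
  assumes s: "0 < \<sigma>B" "0 < \<sigma>E" and R: "0 \<le> R1" "0 \<le> R2" and A: "A \<in> sets (seq_space n)"
  shows "measure (warden_law \<sigma>B \<sigma>E R1 R2 n c) A =
    (\<Sum>m1\<in>messages n R1. \<Sum>m2\<in>messages n R2.
        measure (shifted_noise n \<sigma>E (signal_E c m1 m2)) A) /
      (real (card (messages n R1)) * real (card (messages n R2)))"
proof -
  interpret WB: prob_space "white_noise n \<sigma>B" by (rule prob_space_white_noise[OF s(1)])
  let ?Y = "\<lambda>m1 m2. {z \<in> space (seq_space n). (\<lambda>i\<in>{..<n}. signal_E c m1 m2 i + z i) \<in> A}"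
  have "measure (warden_law \<sigma>B \<sigma>E R1 R2 n c) A = measure (mac_space \<sigma>B \<sigma>E R1 R2 n)
     (E_out n c -` A \<inter> space (mac_space \<sigma>B \<sigma>E R1 R2 n))"
    unfolding warden_law_def using A by (intro measure_distr measurable_E_out)
  also have "E_out n c -` A \<inter> space (mac_space \<sigma>B \<sigma>E R1 R2 n) =
    {(m1, m2, zB, zE). m1 \<in> messages n R1 \<and> m2 \<in> messages n R2 \<and> zB \<in> space (white_noise n \<sigma>B) \<and>
        zE \<in> ?Y m1 m2}"
    by (auto simp: space_mac_space space_white_noise E_out_def signal_E_def)
  finally show ?thesis
    by (subst (asm) measure_mac_space[OF s R])
       (use A in \<open>auto simp: shifted_preimage_sets WB.prob_space measure_shifted_noise\<close>)
qed

lemma prob_space_warden_law: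
  assumes s: "0 < \<sigma>B" "0 < \<sigma>E" and R: "0 \<le> R1" "0 \<le> R2"
  shows "prob_space (warden_law \<sigma>B \<sigma>E R1 R2 n c)"
  unfolding warden_law_def
  by (intro prob_space.prob_space_distr prob_space_mac_space assms measurable_E_out)

text \<open>A real supremum dominates its members only when the family is bounded; here every
  difference of probabilities is at most 1 in absolute value.\<close>

lemma tv_dist_upper:
  assumes "prob_space M" "prob_space N" "A \<in> sets M"
  shows "\<bar>measure M A - measure N A\<bar> \<le> tv_dist M N"
proof -
  interpret M: prob_space M by fact
  interpret N: prob_space N by fact
  have b: "\<bar>measure M A - measure N A\<bar> \<le> 1" for A
    using M.prob_le_1[of A] N.prob_le_1[of A] measure_nonneg[of M A] measure_nonneg[of N A]
        by linarith
  have "bdd_above ((\<lambda>A. \<bar>measure M A - measure N A\<bar>) ` sets M)"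
    by (intro bdd_aboveI2[where M=1]) (rule b)
  then show ?thesis unfolding tv_dist_def using assms(3) by (rule cSUP_upper2) simp
qed

section \<open>Fano's inequality with a Gaussian reference\<close>

lemma gaussian_second_moment:
  assumes s: "0 < s"
  shows "integrable (gaussian s) (\<lambda>z. (w + z)\<^sup>2)" "(\<integral>z. (w + z)\<^sup>2 \<partial>gaussian s) = w\<^sup>2 + s\<^sup>2"
proof -
  have sq: "has_bochner_integral lborel (\<lambda>x. normal_density 0 s x * x\<^sup>2) (s\<^sup>2)"
    using normal_moment_even[OF s, of 0 1] by simp
  have lin: "has_bochner_integral lborel (\<lambda>x. normal_density 0 s x * x) 0"
    using normal_moment_nz_1[OF s, of 0] .
  have one: "has_bochner_integral lborel (normal_density 0 s) 1"
    using s by (simp add: has_bochner_integral_iff)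
  have "has_bochner_integral lborel (\<lambda>x. w\<^sup>2 * normal_density 0 s x + 2 * w *
      (normal_density 0 s x * x)
      + normal_density 0 s x * x\<^sup>2) (w\<^sup>2 * 1 + 2 * w * 0 + s\<^sup>2)"
    by (intro has_bochner_integral_add has_bochner_integral_mult_right one lin sq)
  also have "(\<lambda>x. w\<^sup>2 * normal_density 0 s x + 2 * w * (normal_density 0 s x * x) +
      normal_density 0 s x * x\<^sup>2)
     = (\<lambda>x. normal_density 0 s x *\<^sub>R (w + x)\<^sup>2)"
    by (auto simp: fun_eq_iff power2_eq_square algebra_simps)
  finally have h: "has_bochner_integral lborel (\<lambda>x. normal_density 0 s x *\<^sub>R (w + x)\<^sup>2) (w\<^sup>2 +
      s\<^sup>2)" by simp
  show "integrable (gaussian s) (\<lambda>z. (w + z)\<^sup>2)"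
    unfolding gaussian_def by (subst integrable_density) (use h in \<open>auto simp:
        has_bochner_integral_iff\<close>)
  show "(\<integral>z. (w + z)\<^sup>2 \<partial>gaussian s) = w\<^sup>2 + s\<^sup>2"
    unfolding gaussian_def by (subst integral_density) (use h in \<open>auto simp:
        has_bochner_integral_iff\<close>)
qed

lemma white_noise_second_moment:
  assumes s: "0 < s"
  shows "integrable (white_noise n s) (\<lambda>z. nsq n (\<lambda>i. w i + z i))"
    "(\<integral>z. nsq n (\<lambda>i. w i + z i) \<partial>white_noise n s) = nsq n w + real n * s\<^sup>2"
proof -
  interpret product_prob_space "\<lambda>_::nat. gaussian s" by (rule product_gaussian[OF s])
  have comp: "distr (white_noise n s) (gaussian s) (\<lambda>z. z i) = gaussian s" if "i < n" for i
    unfolding white_noise_def using distr_PiM_component[of "{..<n}" "\<lambda>_. gaussian s" i] that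
    by (simp add: prob_space_gaussian s)
  have m: "(\<lambda>z. z i) \<in> white_noise n s \<rightarrow>\<^sub>M gaussian s" if "i < n" for i
    unfolding white_noise_def using that by (intro measurable_component_singleton) auto
  have 1: "integrable (white_noise n s) (\<lambda>z. (w i + z i)\<^sup>2)" if "i < n" for i
    using gaussian_second_moment(1)[OF s, of "w i"] m[OF that]
    by (subst (asm) comp[OF that, symmetric]) (subst (asm) integrable_distr_eq, auto)
  have 2: "(\<integral>z. (w i + z i)\<^sup>2 \<partial>white_noise n s) = (w i)\<^sup>2 + s\<^sup>2" if "i < n" for i
    using gaussian_second_moment(2)[OF s, of "w i"] m[OF that]
    by (subst (asm) comp[OF that, symmetric]) (subst (asm) integral_distr, auto)
  show "integrable (white_noise n s) (\<lambda>z. nsq n (\<lambda>i. w i + z i))"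
    unfolding nsq_def using 1 by auto
  show "(\<integral>z. nsq n (\<lambda>i. w i + z i) \<partial>white_noise n s) = nsq n w + real n * s\<^sup>2"
    unfolding nsq_def using 1 2 by (subst Bochner_Integration.integral_sum) (auto simp: sum.distrib)
qed

text \<open>Logarithm of the density of \<open>N(v, \<sigma>\<^sup>2)\<close> over that of \<open>N(\<mu>, s\<^sup>2)\<close> at \<open>v + z\<close>, where \<open>w =
    v - \<mu>\<close>.\<close>

definition log_ratio :: "nat \<Rightarrow> real \<Rightarrow> real \<Rightarrow> (nat \<Rightarrow> real) \<Rightarrow> (nat \<Rightarrow> real) \<Rightarrow> real" where
  "log_ratio n \<sigma> s w z = real n * ln (s / \<sigma>) + nsq n (\<lambda>i. w i + z i) / (2 * s\<^sup>2) - nsq n z / (2 *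
      \<sigma>\<^sup>2)"

lemma measurable_log_ratio [measurable]: "log_ratio n \<sigma> s w \<in> borel_measurable (white_noise n t)"
  unfolding log_ratio_def white_noise_def by measurable

text \<open>The mean is the relative entropy of the shifted noise with respect to the Gaussian
  reference law. Only \<open>nsq n w\<close> depends on the message, which is how energies enter the
  rate bounds.\<close>

lemma log_ratio_moments:
  assumes s: "0 < \<sigma>"
  shows "integrable (white_noise n \<sigma>) (log_ratio n \<sigma> s w)"
    "(\<integral>z. log_ratio n \<sigma> s w z \<partial>white_noise n \<sigma>) =
      real n * ln (s / \<sigma>) + (nsq n w + real n * \<sigma>\<^sup>2) / (2 * s\<^sup>2) - real n / 2"
proof -
  interpret prob_space "white_noise n \<sigma>" by (rule prob_space_white_noise[OF s])
  note i = white_noise_second_moment[OF s, of n w] white_noise_second_moment[OF s, of n "\<lambda>_. 0",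
      simplified]
  show "integrable (white_noise n \<sigma>) (log_ratio n \<sigma> s w)"
    unfolding log_ratio_def using i by (intro Bochner_Integration.integrable_add
        Bochner_Integration.integrable_diff integrable_divide) auto
  show "(\<integral>z. log_ratio n \<sigma> s w z \<partial>white_noise n \<sigma>) =
      real n * ln (s / \<sigma>) + (nsq n w + real n * \<sigma>\<^sup>2) / (2 * s\<^sup>2) - real n / 2"
    unfolding log_ratio_def using i s
    by (simp add: prob_space nsq_def)
qed

text \<open>The weight replaces the density of the noise at \<open>z\<close> by the reference
  density at v - \<mu> + z; translation invariance of Lebesgue measure does the rest.\<close>

lemma gaussian_change_of_measure:
  assumes s: "0 < \<sigma>" "0 < s" and A: "A \<in> sets borel"
  shows "(\<integral>\<^sup>+z. indicator A (v + z) * ennreal (\<sigma> / s * exp (z\<^sup>2 / (2 * \<sigma>\<^sup>2) - (v - \<mu> + z)\<^sup>2 / (2 *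
      s\<^sup>2))) \<partial>gaussian \<sigma>)
    = emeasure (gaussian s) {x. \<mu> + x \<in> A}"
proof -
  have [measurable]: "{x. \<mu> + x \<in> A} \<in> sets borel"
    using measurable_sets[of "\<lambda>x. \<mu> + x" borel borel A] A by (simp add: vimage_def)
  note A[measurable]
  have eq: "normal_density 0 \<sigma> z * (\<sigma> / s * exp (z\<^sup>2 / (2 * \<sigma>\<^sup>2) - (v - \<mu> + z)\<^sup>2 / (2 * s\<^sup>2)))
     = normal_density 0 s (v - \<mu> + z)" for z
  proof -
    have "exp (- (z - 0)\<^sup>2 / (2 * \<sigma>\<^sup>2)) * exp (z\<^sup>2 / (2 * \<sigma>\<^sup>2) - (v - \<mu> + z)\<^sup>2 / (2 * s\<^sup>2)) =
        exp (- (v - \<mu> + z - 0)\<^sup>2 / (2 * s\<^sup>2))"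
      by (simp add: exp_add[symmetric])
    then show ?thesis
      unfolding normal_density_def using s by (simp add: real_sqrt_mult field_simps)
  qed
  have "(\<integral>\<^sup>+z. indicator A (v + z) * ennreal (\<sigma> / s * exp (z\<^sup>2 / (2 * \<sigma>\<^sup>2) - (v - \<mu> + z)\<^sup>2 / (2 *
      s\<^sup>2))) \<partial>gaussian \<sigma>)
    = (\<integral>\<^sup>+z. ennreal (normal_density 0 \<sigma> z) * (indicator A (v + z) * ennreal (\<sigma> / s *
        exp (z\<^sup>2 / (2 * \<sigma>\<^sup>2) - (v - \<mu> + z)\<^sup>2 / (2 * s\<^sup>2)))) \<partial>lborel)"
    unfolding gaussian_def by (subst nn_integral_density) auto
  also have "\<dots> = (\<integral>\<^sup>+z. indicator {x. \<mu> + x \<in> A} (v - \<mu> + 1 * z) *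
      ennreal (normal_density 0 s (v - \<mu> + 1 * z)) \<partial>lborel)"
    using s by (intro nn_integral_cong) (simp add: indicator_def eq[symmetric] ennreal_mult'' del:
        times_divide_eq_left times_divide_eq_right)
  also have "\<dots> = (\<integral>\<^sup>+x. indicator {x. \<mu> + x \<in> A} x * ennreal (normal_density 0 s x) \<partial>lborel)"
    using nn_integral_real_affine[of "\<lambda>x. indicator {x. \<mu> + x \<in> A} x *
        ennreal (normal_density 0 s x)" 1 "v - \<mu>"]
    by simp
  also have "\<dots> = emeasure (gaussian s) {x. \<mu> + x \<in> A}"
    unfolding gaussian_def by (subst emeasure_density) (auto simp: mult.commute)
  finally show ?thesis .
qed

text \<open>The exponential of minus the log ratio is the likelihood ratio of the reference law
  against the law of the shifted noise. Both sides are identified with the same product measure, for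
  which agreement on boxes suffices; there the likelihood ratio factors over the
  coordinates.\<close>

lemma shifted_noise_change_of_measure:
  assumes s: "0 < \<sigma>" "0 < s"
  shows "distr (density (white_noise n \<sigma>) (\<lambda>z. ennreal (exp (- log_ratio n \<sigma> s (\<lambda>i. v i - \<mu> i) z))))
      (seq_space n) (\<lambda>z. \<lambda>i\<in>{..<n}. v i + z i) = shifted_noise n s \<mu>"
    (is "?L = ?R")
proof -
  interpret W: product_prob_space "\<lambda>_::nat. gaussian \<sigma>" by (rule product_gaussian[OF s(1)])
  interpret S: product_prob_space "\<lambda>_::nat. gaussian s" by (rule product_gaussian[OF s(2)])
  define M where "M i = distr (gaussian s) borel (\<lambda>x. \<mu> i + x)" for i
  interpret P: product_prob_space M
    unfolding product_prob_space_def product_sigma_finite_def product_prob_space_axioms_def M_def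
    by (auto intro!: prob_space_imp_sigma_finite prob_space.prob_space_distr prob_space_gaussian s)
  have sM: "sets (PiM {..<n} M) = sets (seq_space n)" by (intro sets_PiM_cong) (auto simp: M_def)
  have ind: "indicator (Pi\<^sub>E {..<n} A) (\<lambda>i\<in>{..<n}. w i) =
      (\<Prod>i<n. indicator (A i) (w i) :: ennreal)" for A w
    by (auto simp: indicator_def Pi_iff prod_zero_iff)
  have Ms: "emeasure (M i) A = emeasure (gaussian s) {x. \<mu> i + x \<in> A}" if "A \<in> sets borel" for i A
    unfolding M_def using that by (subst emeasure_distr) (auto simp: vimage_def)
  have box: "Pi\<^sub>E {..<n} A \<in> sets (seq_space n)" if "\<And>i. i \<in> {..<n} \<Longrightarrow> A i \<in> sets (M i)" for A
    using that by (intro sets_PiM_I_finite) (auto simp: M_def)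
  have "?R = PiM {..<n} M"
  proof (rule P.PiM_eqI)
    fix A assume A: "\<And>i. i \<in> {..<n} \<Longrightarrow> A i \<in> sets (M i)"
    then have A': "A i \<in> sets borel" if "i < n" for i using that by (auto simp: M_def)
    have "emeasure ?R (Pi\<^sub>E {..<n} A) = (\<integral>\<^sup>+z. indicator (Pi\<^sub>E {..<n} A) (\<lambda>i\<in>{..<n}. \<mu> i +
        z i) \<partial>white_noise n s)"
      unfolding shifted_noise_def using box[OF A]
      by (subst nn_integral_indicator[symmetric], simp, subst nn_integral_distr) (auto
          intro: measurable_shift_white_noise)
    also have "\<dots> = (\<integral>\<^sup>+z. (\<Prod>i<n. indicator (A i) (\<mu> i + z i)) \<partial>white_noise n s)"
      by (simp only: ind)
    also have "\<dots> = (\<Prod>i<n. \<integral>\<^sup>+z. indicator (A i) (\<mu> i + z) \<partial>gaussian s)"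
      unfolding white_noise_def using A'
      by (subst S.product_nn_integral_prod) (auto intro!: borel_measurable_indicator' simp:
          vimage_def)
    also have "\<dots> = (\<Prod>i\<in>{..<n}. emeasure (M i) (A i))"
    proof (rule prod.cong[OF refl])
      fix i assume "i \<in> {..<n}"
      then have "A i \<in> sets borel" using A' by auto
      then show "(\<integral>\<^sup>+z. indicator (A i) (\<mu> i + z) \<partial>gaussian s) = emeasure (M i) (A i)"
        unfolding M_def
        by (subst nn_integral_indicator[symmetric], simp, subst nn_integral_distr) auto
    qed
    finally show "emeasure ?R (Pi\<^sub>E {..<n} A) = (\<Prod>i\<in>{..<n}. emeasure (M i) (A i))" .
  qed (simp_all add: sM)
  moreover have "?L = PiM {..<n} M"
  proof (rule P.PiM_eqI)
    fix A assume A: "\<And>i. i \<in> {..<n} \<Longrightarrow> A i \<in> sets (M i)"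
    then have A': "A i \<in> sets borel" if "i < n" for i using that by (auto simp: M_def)
    let ?f = "\<lambda>i z. \<sigma> / s * exp (z\<^sup>2 / (2 * \<sigma>\<^sup>2) - (v i - \<mu> i + z)\<^sup>2 / (2 * s\<^sup>2))"
    have f: "ennreal (exp (- log_ratio n \<sigma> s (\<lambda>i. v i - \<mu> i) z)) = (\<Prod>i<n. ennreal (?f i (z i)))"
        for z
    proof -
      have "(\<Prod>i<n. ?f i (z i)) = (\<sigma> / s) ^ n * exp (\<Sum>i<n. (z i)\<^sup>2 / (2 * \<sigma>\<^sup>2) - (v i - \<mu> i +
          z i)\<^sup>2 / (2 * s\<^sup>2))"
        by (subst prod.distrib) (simp add: exp_sum)
      also have "(\<sigma> / s) ^ n = exp (- (real n * ln (s / \<sigma>)))"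
        using s by (simp add: exp_minus exp_of_nat_mult power_divide)
      finally have "(\<Prod>i<n. ?f i (z i)) = exp (- log_ratio n \<sigma> s (\<lambda>i. v i - \<mu> i) z)"
        by (simp add: exp_add[symmetric] log_ratio_def nsq_def sum_subtractf sum_divide_distrib)
      then show ?thesis using s by (subst prod_ennreal) auto
    qed
    have "emeasure ?L (Pi\<^sub>E {..<n} A) = (\<integral>\<^sup>+z. ennreal (exp (- log_ratio n \<sigma> s (\<lambda>i. v i - \<mu> i) z))
        * indicator (Pi\<^sub>E {..<n} A) (\<lambda>i\<in>{..<n}. v i + z i) \<partial>white_noise n \<sigma>)"
    proof -
      have [measurable]: "(\<lambda>z. \<lambda>i\<in>{..<n}. v i + z i) \<in> white_noise n \<sigma> \<rightarrow>\<^sub>M seq_space n"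
        by (rule measurable_shift_white_noise)
      note box[OF A, measurable]
      show ?thesis
        by (subst nn_integral_indicator[symmetric], simp add: box[OF A], subst nn_integral_distr)
           (simp_all add: nn_integral_density measurable_shift_white_noise)
    qed
    also have "\<dots> = (\<integral>\<^sup>+z. (\<Prod>i<n. indicator (A i) (v i + z i) *
        ennreal (?f i (z i))) \<partial>white_noise n \<sigma>)"
      by (simp only: ind f prod.distrib mult.commute)
    also have "\<dots> = (\<Prod>i<n. \<integral>\<^sup>+z. indicator (A i) (v i + z) * ennreal (?f i z) \<partial>gaussian \<sigma>)"
      unfolding white_noise_def using A'
      by (subst W.product_nn_integral_prod) (auto intro!: borel_measurable_times
          borel_measurable_indicator' simp: vimage_def)
    also have "\<dots> = (\<Prod>i\<in>{..<n}. emeasure (M i) (A i))"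
    proof (rule prod.cong[OF refl])
      fix i assume "i \<in> {..<n}"
      then have "A i \<in> sets borel" using A' by auto
      then show "(\<integral>\<^sup>+z. indicator (A i) (v i + z) * ennreal (?f i z) \<partial>gaussian \<sigma>) =
          emeasure (M i) (A i)"
        by (simp only: Ms gaussian_change_of_measure[OF s])
    qed
    finally show "emeasure ?L (Pi\<^sub>E {..<n} A) = (\<Prod>i\<in>{..<n}. emeasure (M i) (A i))" .
  qed (simp_all add: sM)
  ultimately show ?thesis by simp
qed

text \<open>Instead of a data-processing inequality, \<open>1 + x \<le> exp x\<close> is applied to
  \<open>x = ln (card I) 1\<^sub>A - log_ratio - ln 2\<close> and integrated; the choice of the weight \<open>ln (card I)\<close>
  balances the guessing probability \<open>1 / card I\<close> under the reference law.\<close>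

lemma gaussian_fano:
  fixes v :: "'m \<Rightarrow> nat \<Rightarrow> real"
  assumes s: "0 < \<sigma>" "0 < s" and I: "finite I" "I \<noteq> {}"
    and A: "\<And>m. m \<in> I \<Longrightarrow> A m \<in> sets (seq_space n)" and disj: "disjoint_family_on A I"
  shows "(\<Sum>m\<in>I. measure (shifted_noise n \<sigma> (v m)) (A m)) * ln (real (card I)) \<le>
    real (card I) * (ln 2 + real n * (ln (s / \<sigma>) + \<sigma>\<^sup>2 / (2 * s\<^sup>2) - 1 / 2)) +
    (\<Sum>m\<in>I. nsq n (\<lambda>i. v m i - \<mu> i)) / (2 * s\<^sup>2)"
proof -
  let ?W = "white_noise n \<sigma>" and ?Q = "shifted_noise n s \<mu>" and ?N = "real (card I)"
  let ?sh = "\<lambda>m z. \<lambda>i\<in>{..<n}. v m i + z i"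
  let ?L = "\<lambda>m. log_ratio n \<sigma> s (\<lambda>i. v m i - \<mu> i)"
  interpret W: prob_space ?W by (rule prob_space_white_noise[OF s(1)])
  interpret Q: prob_space ?Q by (rule prob_space_shifted_noise[OF s(2)])
  have N: "1 \<le> ?N" using I by (simp add: Suc_le_eq card_gt_0_iff)
  have sh[measurable]: "?sh m \<in> ?W \<rightarrow>\<^sub>M seq_space n" for m by (rule measurable_shift_white_noise)
  have one: "measure (shifted_noise n \<sigma> (v m)) (A m) * ln ?N \<le>
      ln 2 + (real n * ln (s / \<sigma>) + (nsq n (\<lambda>i. v m i - \<mu> i) + real n * \<sigma>\<^sup>2) / (2 *
          s\<^sup>2) - real n / 2)
      + (1 + (?N - 1) * measure ?Q (A m)) / 2 - 1" if m: "m \<in> I" for m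
  proof -
    note A[OF m, measurable]
    have Qi: "integrable ?Q (indicator (A m) :: _ \<Rightarrow> real)"
      using A[OF m] by (intro integrable_real_indicator) (auto simp: Q.emeasure_eq_measure)
    \<comment> \<open>This is \<open>exp (ln N * 1_A)\<close> with N = card I, written linearly in
      the indicator so that its integral under the reference law can be read off.\<close>
    let ?f = "\<lambda>y. 1 + (?N - 1) * indicator (A m) y :: real"
    have fi: "integrable ?Q ?f" using Qi by (auto intro!: Bochner_Integration.integrable_add
        integrable_mult_right)
    have fm: "?f \<in> borel_measurable (seq_space n)" by measurable
    have L: "?L m \<in> borel_measurable ?W" by measurable
    have i1: "integrable ?W (\<lambda>z. exp (- ?L m z) *\<^sub>R ?f (?sh m z))"
      using fi fm unfolding shifted_noise_change_of_measure[OF s, of n "v m" \<mu>, symmetric]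
      by (subst (asm) integrable_distr_eq) (simp_all add: integrable_density)
    have "(\<integral>y. ?f y \<partial>?Q) = (\<integral>z. exp (- ?L m z) *\<^sub>R ?f (?sh m z) \<partial>?W)"
      using fm unfolding shifted_noise_change_of_measure[OF s, of n "v m" \<mu>, symmetric]
      by (subst integral_distr) (simp_all add: integral_density)
    also have "(\<integral>y. ?f y \<partial>?Q) = 1 + (?N - 1) * measure ?Q (A m)"
      using Qi A[OF m] by (subst Bochner_Integration.integral_add) (auto simp:
          Q.prob_space[simplified])
    finally have i2: "(\<integral>z. exp (- ?L m z) *\<^sub>R ?f (?sh m z) \<partial>?W) =
        1 + (?N - 1) * measure ?Q (A m)" ..
    have PA: "(\<integral>z. indicator (A m) (?sh m z) \<partial>?W) = measure (shifted_noise n \<sigma> (v m)) (A m)"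
    proof -
      have "(\<integral>z. indicator (A m) (?sh m z) \<partial>?W) = (\<integral>y. indicator (A m) y \<partial>shifted_noise n \<sigma> (v m)
          :: real)"
        unfolding shifted_noise_def by (subst integral_distr) auto
      then show ?thesis using A[OF m] by simp
    qed
    have PI: "integrable ?W (\<lambda>z. indicator (A m) (?sh m z) :: real)"
      by (rule W.integrable_const_bound[where B=1]) auto
    have "(\<integral>z. ln ?N * indicator (A m) (?sh m z) - ?L m z - ln 2 \<partial>?W) \<le>
      (\<integral>z. exp (- ?L m z) *\<^sub>R ?f (?sh m z) / 2 - 1 \<partial>?W)"
    proof (intro integral_mono)
      fix z
      have "1 + (ln ?N * indicator (A m) (?sh m z) - ?L m z - ln 2) \<le>
         exp (ln ?N * indicator (A m) (?sh m z) - ?L m z - ln 2)" by (rule exp_ge_add_one_self)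
      also have "\<dots> = exp (- ?L m z) *\<^sub>R ?f (?sh m z) / 2"
        using N by (auto simp: exp_diff exp_minus exp_add field_simps indicator_def)
      finally show "ln ?N * indicator (A m) (?sh m z) - ?L m z - ln 2 \<le>
         exp (- ?L m z) *\<^sub>R ?f (?sh m z) / 2 - 1" by simp
    qed (use PI i1 log_ratio_moments(1)[OF s(1)] in \<open>auto
        intro!: Bochner_Integration.integrable_diff integrable_mult_right integrable_divide\<close>)
    also have "(\<integral>z. exp (- ?L m z) *\<^sub>R ?f (?sh m z) / 2 - 1 \<partial>?W) =
        (1 + (?N - 1) * measure ?Q (A m)) / 2 - 1"
      using i1 i2 by (subst Bochner_Integration.integral_diff) (auto simp: W.prob_space)
    also have "(\<integral>z. ln ?N * indicator (A m) (?sh m z) - ?L m z - ln 2 \<partial>?W) =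
       ln ?N * measure (shifted_noise n \<sigma> (v m)) (A m) -
        (real n * ln (s / \<sigma>) + (nsq n (\<lambda>i. v m i - \<mu> i) + real n * \<sigma>\<^sup>2) / (2 *
            s\<^sup>2) - real n / 2) - ln 2"
      using PI PA log_ratio_moments[OF s(1), of n s "\<lambda>i. v m i - \<mu> i"]
      by (subst Bochner_Integration.integral_diff, simp, simp,
          subst Bochner_Integration.integral_diff)
         (auto simp: W.prob_space)
    finally show ?thesis
      unfolding mult.commute[of "measure (shifted_noise n \<sigma> (v m)) (A m)" "ln ?N"] by linarith
  qed
  \<comment> \<open>Disjointness of the decoding sets bounds their total reference mass by 1.
    Because \<open>ln 2\<close> halved the exponential terms, the part of the sum depending on these
    masses is then at most (N - 1)/2 - N/2, which is negative.\<close>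
  have Qs: "(\<Sum>m\<in>I. measure ?Q (A m)) \<le> 1"
    using A disj I by (subst Q.finite_measure_finite_Union[symmetric]) auto
  have "(\<Sum>m\<in>I. measure (shifted_noise n \<sigma> (v m)) (A m)) * ln ?N \<le>
     (\<Sum>m\<in>I. ln 2 + (real n * ln (s / \<sigma>) + (nsq n (\<lambda>i. v m i - \<mu> i) + real n * \<sigma>\<^sup>2) / (2 *
         s\<^sup>2) - real n / 2)
      + (1 + (?N - 1) * measure ?Q (A m)) / 2 - 1)"
    unfolding sum_distrib_right by (intro sum_mono one)
  also have "\<dots> = ?N * (ln 2 + real n * (ln (s / \<sigma>) + \<sigma>\<^sup>2 / (2 * s\<^sup>2) - 1 / 2)) +
    (\<Sum>m\<in>I. nsq n (\<lambda>i. v m i - \<mu> i)) / (2 * s\<^sup>2) + (?N - 1) / 2 * (\<Sum>m\<in>I. measure ?Q (A m)) - ?N / 2"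
    by (simp add: sum.distrib sum_subtractf sum_divide_distrib[symmetric]
        sum_distrib_left[symmetric]
         algebra_simps add_divide_distrib diff_divide_distrib)
  also have "\<dots> \<le> ?N * (ln 2 + real n * (ln (s / \<sigma>) + \<sigma>\<^sup>2 / (2 * s\<^sup>2) - 1 / 2)) +
    (\<Sum>m\<in>I. nsq n (\<lambda>i. v m i - \<mu> i)) / (2 * s\<^sup>2)"
    using mult_left_mono[OF Qs, of "(?N - 1) / 2"] N by simp
  finally show ?thesis .
qed

section \<open>Converse\<close>

lemma power_ok_iff: "0 < n \<Longrightarrow> power_ok n P x \<longleftrightarrow> nsq n x \<le> real n * P"
  by (simp add: power_ok_def nsq_def field_simps)

text \<open>For an argument x of at least 1 the floor is at least 1 and exceeds x - 1, hence is at
  least x/2.\<close>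

lemma card_messages_lower: "0 \<le> R \<Longrightarrow> 2 powr (real n * R) / 2 \<le> real (card (messages n R))"
proof -
  assume "0 \<le> R"
  then have 1: "1 \<le> (2::real) powr (real n * R)" by (simp add: ge_one_powr_ge_zero)
  then have "1 \<le> \<lfloor>2 powr (real n * R)\<rfloor>" by (simp add: le_floor_iff)
  then have "1 \<le> real_of_int \<lfloor>2 powr (real n * R)\<rfloor>" by simp
  then have "2 powr (real n * R) / 2 \<le> real_of_int \<lfloor>2 powr (real n * R)\<rfloor>"
    using floor_correct[of "2 powr (real n * R)"] by linarith
  then show ?thesis unfolding messages_def using 1 by simp
qed

lemma card_messages_upper: "real (card (messages n R)) \<le> 2 powr (real n * R)"
  unfolding messages_def by simp

text \<open>A rearrangement of 0 \<le> (e a - b c)^2 / e. With small \<open>e\<close> the main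
  signal keeps a coefficient near 1, while the large coefficient falls on a residual of vanishing
  energy.\<close>

lemma nsq_add_le:
  assumes "0 < e"
  shows "nsq n (\<lambda>i. a i + b * c i) \<le> (1 + e) * nsq n a + (1 + 1 / e) * b\<^sup>2 * nsq n c"
proof -
  have "(a i + b * c i)\<^sup>2 \<le> (1 + e) * (a i)\<^sup>2 + (1 + 1 / e) * b\<^sup>2 * (c i)\<^sup>2" for i
  proof -
    have "0 \<le> (e * a i - b * c i)\<^sup>2 / e" using assms by simp
    then show ?thesis using assms by (simp add: field_simps power2_eq_square)
  qed
  then show ?thesis unfolding nsq_def sum_distrib_left sum.distrib[symmetric] by (intro sum_mono)
qed

lemma nsq_scale: "nsq n (\<lambda>i. a * x i) = a\<^sup>2 * nsq n x"
  by (simp add: nsq_def power_mult_distrib sum_distrib_left)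

section \<open>The energy test at the warden\<close>

lemma emeasure_white_noise_indicator:
  assumes "{z \<in> space (seq_space n). z \<in> A} \<in> sets (white_noise n s)"
  shows "emeasure (white_noise n s) {z \<in> space (seq_space n). z \<in> A} =
      (\<integral>\<^sup>+z. indicator A z \<partial>white_noise n s)"
proof -
  have "(\<integral>\<^sup>+z. indicator A z \<partial>white_noise n s) = (\<integral>\<^sup>+z. indicator {z \<in> space (seq_space n). z \<in> A}
      z \<partial>white_noise n s)"
    by (intro nn_integral_cong) (simp add: space_white_noise indicator_def)
  with assms show ?thesis by simp
qed

lemma sets_nsq_greater: "{y \<in> space (seq_space n). t < nsq n y} \<in> sets (seq_space n)"
  by measurable

text \<open>The test event is that the output energy exceeds a threshold. Pure noise triggers it
  with probability at most r^n, and every message pair of energy at least n \<eta> triggers it with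
  probability at least 1 - r^n, so a large fraction of such pairs would be visible in total
  variation. The rate \<open>r\<close> is the same for all codes.\<close>

lemma covert_energy_fraction:
  assumes s: "0 < \<sigma>B" "0 < \<sigma>E" and R: "0 \<le> R1" "0 \<le> R2" and e: "0 < \<eta>"
  obtains r where "0 \<le> r" "r < 1"
    "\<And>n c. (1 - r ^ n) * (real (card {p \<in> messages n R1 \<times> messages n R2.
        real n * \<eta> \<le> nsq n (signal_E c (fst p) (snd p))}) /
        (real (card (messages n R1)) * real (card (messages n R2))))
      \<le> tv_dist (warden_law \<sigma>B \<sigma>E R1 R2 n c) (white_noise n \<sigma>E) + r ^ n"
proof -
  \<comment> \<open>The threshold lies halfway between the output energy per symbol without a signal
    and with a signal of energy \<eta> per symbol, so both tails decay exponentially.\<close>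
  let ?t = "\<sigma>E\<^sup>2 + \<eta> / 2"
  obtain r1 where r1: "0 \<le> r1" "r1 < 1"
    "\<And>n. (\<integral>\<^sup>+z. indicator {z. real n * ?t < nsq n z} z \<partial>white_noise n \<sigma>E) \<le> ennreal (r1 ^ n)"
    using white_noise_upper_tail[OF s(2), of ?t] e by auto
  obtain r2 where r2: "0 \<le> r2" "r2 < 1"
    "\<And>n v. real n * \<eta> \<le> nsq n v \<Longrightarrow>
      (\<integral>\<^sup>+z. indicator {z. nsq n (\<lambda>i. v i + z i) \<le> real n * ?t} z \<partial>white_noise n \<sigma>E) \<le>
          ennreal (r2 ^ n)"
    using shifted_white_noise_lower_tail[OF s(2), of ?t \<eta>] e by auto
  define r where "r = max r1 r2"
  have r: "0 \<le> r" "r < 1" "r1 \<le> r" "r2 \<le> r" using r1 r2 by (auto simp: r_def)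
  show ?thesis
  proof (rule that[OF r(1,2)])
    fix n c
    let ?A = "{y \<in> space (seq_space n). real n * ?t < nsq n y}"
    let ?M = "messages n R1 \<times> messages n R2"
    let ?G = "{p \<in> ?M. real n * \<eta> \<le> nsq n (signal_E c (fst p) (snd p))}"
    let ?N = "real (card (messages n R1)) * real (card (messages n R2))"
    interpret W: prob_space "white_noise n \<sigma>E" by (rule prob_space_white_noise[OF s(2)])
    have N: "0 < ?N" using R by (simp add: card_messages_pos)
    have A: "?A \<in> sets (seq_space n)" by (rule sets_nsq_greater)
    have "emeasure (white_noise n \<sigma>E) ?A \<le> ennreal (r1 ^ n)"
      using r1(3)[of n] emeasure_white_noise_indicator[of n "{z. real n * ?t < nsq n z}" \<sigma>E] A
      by (simp add: sets_white_noise)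
    then have 1: "measure (white_noise n \<sigma>E) ?A \<le> r1 ^ n"
      using r1(1) by (simp add: W.emeasure_eq_measure)
    have 2: "1 - r2 ^ n \<le> measure (shifted_noise n \<sigma>E v) ?A" if v: "real n * \<eta> \<le> nsq n v" for v
    proof -
      interpret V: prob_space "shifted_noise n \<sigma>E v" by (rule prob_space_shifted_noise[OF s(2)])
      have B: "space (seq_space n) - ?A \<in> sets (seq_space n)" using A by auto
      have eq: "{z \<in> space (seq_space n). (\<lambda>i\<in>{..<n}. v i + z i) \<in> space (seq_space n) - ?A}
        = {z \<in> space (seq_space n). z \<in> {z. nsq n (\<lambda>i. v i + z i) \<le> real n * ?t}}"
        by (auto simp: space_PiM nsq_def not_less)
      have "emeasure (white_noise n \<sigma>E) {z \<in> space (seq_space n). (\<lambda>i\<in>{..<n}. v i +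
          z i) \<in> space (seq_space n) - ?A} \<le> ennreal (r2 ^ n)"
        using r2(3)[OF v] shifted_preimage_sets[OF B, of v \<sigma>E] unfolding eq
        by (subst emeasure_white_noise_indicator) auto
      then have "measure (shifted_noise n \<sigma>E v) (space (seq_space n) - ?A) \<le> r2 ^ n"
        using r2(1) by (subst measure_shifted_noise[OF B]) (simp add: W.emeasure_eq_measure)
      moreover have "measure (shifted_noise n \<sigma>E v) (space (seq_space n) - ?A) =
          1 - measure (shifted_noise n \<sigma>E v) ?A"
        using V.prob_compl[of ?A] A by simp
      ultimately show ?thesis by simp
    qed
    have "(1 - r2 ^ n) * real (card ?G) \<le> (\<Sum>p\<in>?M. measure (shifted_noise n \<sigma>E (signal_E c (fst p)
        (snd p))) ?A)"
    proof -
      have "(1 - r2 ^ n) * real (card ?G) = (\<Sum>p\<in>?G. 1 - r2 ^ n)" by simp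
      also have "\<dots> \<le> (\<Sum>p\<in>?G. measure (shifted_noise n \<sigma>E (signal_E c (fst p) (snd p))) ?A)"
        by (intro sum_mono 2) auto
      also have "\<dots> \<le> (\<Sum>p\<in>?M. measure (shifted_noise n \<sigma>E (signal_E c (fst p) (snd p))) ?A)"
        by (intro sum_mono2) auto
      finally show ?thesis .
    qed
    then have "(1 - r2 ^ n) * real (card ?G) / ?N \<le> measure (warden_law \<sigma>B \<sigma>E R1 R2 n c) ?A"
      unfolding measure_warden_law[OF s R A] using N
      by (intro divide_right_mono) (auto simp: sum.cartesian_product case_prod_beta)
    also have "\<dots> \<le> tv_dist (warden_law \<sigma>B \<sigma>E R1 R2 n c) (white_noise n \<sigma>E) +
        measure (white_noise n \<sigma>E) ?A"
      using tv_dist_upper[OF prob_space_warden_law[OF s R] W.prob_space_axioms, of ?A n c] A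
      by (simp add: warden_law_def)
    also have "\<dots> \<le> tv_dist (warden_law \<sigma>B \<sigma>E R1 R2 n c) (white_noise n \<sigma>E) + r ^ n"
      using 1 power_mono[OF r(3) r1(1), of n] by simp
    finally have "(1 - r2 ^ n) * (real (card ?G) / ?N) \<le>
        tv_dist (warden_law \<sigma>B \<sigma>E R1 R2 n c) (white_noise n \<sigma>E) + r ^ n"
      by simp
    moreover have "(1 - r ^ n) * (real (card ?G) / ?N) \<le> (1 - r2 ^ n) * (real (card ?G) / ?N)"
      using power_mono[OF r(4) r2(1), of n] by (intro mult_right_mono) auto
    ultimately show "(1 - r ^ n) * (real (card ?G) / ?N)
      \<le> tv_dist (warden_law \<sigma>B \<sigma>E R1 R2 n c) (white_noise n \<sigma>E) + r ^ n" by linarith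
  qed
qed

text \<open>Pairs of energy below n \<eta> contribute at most \<eta> to the normalised average. The
  others contribute at most |K| times their fraction, which vanishes by the energy test.\<close>

lemma covert_energy_vanishes:
  assumes s: "0 < \<sigma>B" "0 < \<sigma>E" and R: "0 \<le> R1" "0 \<le> R2"
    and bound: "\<And>n m1 m2. 0 < n \<Longrightarrow> m1 \<in> messages n R1 \<Longrightarrow> m2 \<in> messages n R2 \<Longrightarrow>
      nsq n (signal_E (c n) m1 m2) \<le> real n * K"
    and tv: "(\<lambda>n. tv_dist (warden_law \<sigma>B \<sigma>E R1 R2 n (c n)) (white_noise n \<sigma>E)) \<longlonglongrightarrow> 0"
  shows "(\<lambda>n. (\<Sum>p\<in>messages n R1 \<times> messages n R2. nsq n (signal_E (c n) (fst p) (snd p))) /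
     (real n * (real (card (messages n R1)) * real (card (messages n R2))))) \<longlonglongrightarrow> 0"
    (is "?E \<longlonglongrightarrow> 0")
proof (rule LIMSEQ_I)
  fix \<epsilon> :: real assume \<epsilon>: "0 < \<epsilon>"
  let ?M = "\<lambda>n. messages n R1 \<times> messages n R2"
  let ?N = "\<lambda>n. real (card (messages n R1)) * real (card (messages n R2))"
  let ?tv = "\<lambda>n. tv_dist (warden_law \<sigma>B \<sigma>E R1 R2 n (c n)) (white_noise n \<sigma>E)"
  define \<eta> where "\<eta> = \<epsilon> / 2"
  have \<eta>: "0 < \<eta>" using \<epsilon> by (simp add: \<eta>_def)
  define G where "G n = {p \<in> ?M n. real n * \<eta> \<le> nsq n (signal_E (c n) (fst p) (snd p))}" for n
  obtain r where r: "0 \<le> r" "r < 1"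
    "\<And>n. (1 - r ^ n) * (real (card (G n)) / ?N n) \<le> ?tv n + r ^ n"
    unfolding G_def by (rule covert_energy_fraction[OF s R \<eta>]) blast
  have N: "0 < ?N n" for n using R by (simp add: card_messages_pos)
  have rn: "r ^ n < 1" if "0 < n" for n using r that by (simp add: power_less_one_iff)
  have lim: "(\<lambda>n. \<eta> + \<bar>K\<bar> * ((?tv n + r ^ n) / (1 - r ^ n))) \<longlonglongrightarrow> \<eta> + \<bar>K\<bar> * ((0 + 0) / (1 - 0))"
    using r tv by (intro tendsto_intros LIMSEQ_realpow_zero) auto
  have le: "?E n \<le> \<eta> + \<bar>K\<bar> * ((?tv n + r ^ n) / (1 - r ^ n))" if n: "0 < n" for n
  proof -
    have "(\<Sum>p\<in>?M n. nsq n (signal_E (c n) (fst p) (snd p))) \<le>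
       (\<Sum>p\<in>?M n. real n * \<eta> + (if p \<in> G n then real n * \<bar>K\<bar> else 0))"
    proof (rule sum_mono)
      fix p assume p: "p \<in> ?M n"
      have "real n * K \<le> real n * \<bar>K\<bar>" by (intro mult_left_mono) auto
      moreover have "0 \<le> real n * \<eta>" using \<eta> by simp
      moreover have "nsq n (signal_E (c n) (fst p) (snd p)) \<le> real n * K"
        using bound[OF n, of "fst p" "snd p"] p by auto
      ultimately show "nsq n (signal_E (c n) (fst p) (snd p)) \<le>
          real n * \<eta> + (if p \<in> G n then real n * \<bar>K\<bar> else 0)"
        using p unfolding G_def by auto
    qed
    also have "\<dots> = ?N n * (real n * \<eta>) + real (card (G n)) * (real n * \<bar>K\<bar>)"
    proof -
      have "(\<Sum>p\<in>?M n. if p \<in> G n then real n * \<bar>K\<bar> else 0) = (\<Sum>p\<in>G n. real n * \<bar>K\<bar>)"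
        by (rule sum.mono_neutral_cong_right) (auto simp: G_def)
      then show ?thesis by (simp add: sum.distrib card_cartesian_product)
    qed
    finally have "?E n \<le> (?N n * (real n * \<eta>) + real (card (G n)) * (real n * \<bar>K\<bar>)) / (real n *
        ?N n)"
      using N[of n] n by (intro divide_right_mono) auto
    also have "\<dots> = \<eta> + \<bar>K\<bar> * (real (card (G n)) / ?N n)"
    proof -
      have "(N * (x * e) + g * (x * k)) / (x * N) = e + k * (g / N)" if "N \<noteq> 0" "x \<noteq> 0"
          for N x e g k :: real
        using that by (simp add: add_divide_distrib)
      from this[OF less_imp_neq[OF N, symmetric]] show ?thesis using n by simp
    qed
    also have "\<dots> \<le> \<eta> + \<bar>K\<bar> * ((?tv n + r ^ n) / (1 - r ^ n))"
      using r(3)[of n] rn[OF n] by (intro add_left_mono mult_left_mono) (auto simp: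
          pos_le_divide_eq mult.commute)
    finally show ?thesis .
  qed
  have "\<forall>\<^sub>F n in sequentially. \<eta> + \<bar>K\<bar> * ((?tv n + r ^ n) / (1 - r ^ n)) < \<epsilon>"
    using lim \<epsilon> by (intro order_tendstoD(2)[OF lim]) (simp add: \<eta>_def)
  then have "\<forall>\<^sub>F n in sequentially. norm (?E n - 0) < \<epsilon>"
    using eventually_gt_at_top[of 0]
  proof eventually_elim
    case (elim n)
    have "0 \<le> ?E n" by (intro divide_nonneg_nonneg sum_nonneg) auto
    with le[OF elim(2)] elim(1) show ?case by simp
  qed
  then show "\<exists>no. \<forall>n\<ge>no. norm (?E n - 0) < \<epsilon>" by (simp add: eventually_sequentially)
qed

text \<open>The common form of the single-rate and sum-rate bounds. \<open>I n\<close> holds the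
  messages to be decoded and \<open>K n\<close> the side information that is held fixed; the
  decoding sets ignore the latter, whereas the reference centre \<open>\<mu> n k\<close> may use it.
  \<open>q n\<close> bounds the probability of correct decoding from below, and the factor 4 covers
  a product of two message sets that each lose a factor 2 to the floor.\<close>

lemma gaussian_rate_bound:
  fixes v :: "nat \<Rightarrow> 'k \<Rightarrow> 'm \<Rightarrow> nat \<Rightarrow> real"
  assumes s: "0 < \<sigma>" and T0: "0 \<le> T0"
    and K: "\<And>n. finite (K n)" "\<And>n. K n \<noteq> {}" and I: "\<And>n. finite (I n)" "\<And>n. I n \<noteq> {}"
    and A: "\<And>n k m. 0 < n \<Longrightarrow> k \<in> K n \<Longrightarrow> m \<in> I n \<Longrightarrow> A n m \<in> sets (seq_space n)"
    and disj: "\<And>n. 0 < n \<Longrightarrow> disjoint_family_on (A n) (I n)"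
    and card: "\<And>n. 2 powr (real n * R) / 4 \<le> real (card (I n))"
    and q: "q \<longlonglongrightarrow> 1"
    and correct: "\<And>n. 0 < n \<Longrightarrow> q n * (real (card (K n)) * real (card (I n))) \<le>
       (\<Sum>k\<in>K n. \<Sum>m\<in>I n. measure (shifted_noise n \<sigma> (v n k m)) (A n m))"
    and energy: "\<And>T. T0 < T \<Longrightarrow> \<forall>\<^sub>F n in sequentially.
       (\<Sum>k\<in>K n. \<Sum>m\<in>I n. nsq n (\<lambda>i. v n k m i - \<mu> n k i)) \<le>
           real n * T * (real (card (K n)) * real (card (I n)))"
  shows "R \<le> 1 / 2 * log 2 (1 + T0 / \<sigma>\<^sup>2)"
proof -
  have main: "R * ln 2 \<le> ln (1 + T / \<sigma>\<^sup>2) / 2" if T: "T0 < T" for T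
  proof -
    have T': "0 < T" using T T0 by simp
    \<comment> \<open>The reference variance equals noise plus signal energy. With this choice the
      quadratic terms of the bound cancel \<open>1 / 2\<close>, and only the capacity term
      \<open>ln (s' / \<sigma>)\<close> survives.\<close>
    define s' where "s' = sqrt (\<sigma>\<^sup>2 + T)"
    have s': "0 < s'" "s'\<^sup>2 = \<sigma>\<^sup>2 + T" using T' s by (auto simp: s'_def add_pos_pos)
    have lns: "ln (s' / \<sigma>) = ln (1 + T / \<sigma>\<^sup>2) / 2"
    proof -
      have "1 + T / \<sigma>\<^sup>2 = (s' / \<sigma>)\<^sup>2" using s s' by (simp add: power_divide field_simps)
      then show ?thesis using s s' by (simp add: ln_realpow)
    qed
    have ev: "\<forall>\<^sub>F n in sequentially. q n * (R * ln 2 - ln 4 / real n) \<le>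
        ln 2 / real n + ln (1 + T / \<sigma>\<^sup>2) / 2"
      using energy[OF T] eventually_gt_at_top[of 0] order_tendstoD(1)[OF q, of 0, simplified]
    proof eventually_elim
      case (elim n)
      let ?k = "real (card (K n))" and ?m = "real (card (I n))"
      have k: "0 < ?k" and m: "0 < ?m" using K I by (auto simp: card_gt_0_iff)
      have m1: "1 \<le> ?m" using m by simp
      let ?J = "\<lambda>k. \<Sum>m\<in>I n. nsq n (\<lambda>i. v n k m i - \<mu> n k i)"
      have "q n * (?k * ?m) * ln ?m \<le> (\<Sum>k\<in>K n. \<Sum>m\<in>I n. measure (shifted_noise n \<sigma> (v n k m)) (A n
          m)) * ln ?m"
        using correct[OF elim(2)] m1 by (intro mult_right_mono) auto
      also have "\<dots> \<le> (\<Sum>k\<in>K n. ?m * (ln 2 + real n * (ln (s' / \<sigma>) + \<sigma>\<^sup>2 / (2 * s'\<^sup>2) - 1 / 2)) +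
          ?J k / (2 * s'\<^sup>2))"
        unfolding sum_distrib_right[of _ "K n"]
        by (intro sum_mono gaussian_fano[OF s s'(1) I(1) I(2)] A disj elim) auto
      also have "\<dots> = ?k * ?m * (ln 2 + real n * (ln (s' / \<sigma>) + \<sigma>\<^sup>2 / (2 * s'\<^sup>2) - 1 / 2)) +
          (\<Sum>k\<in>K n. ?J k) / (2 * s'\<^sup>2)"
        by (simp add: sum.distrib sum_divide_distrib)
      also have "\<dots> \<le> ?k * ?m * (ln 2 + real n * (ln (s' / \<sigma>) + \<sigma>\<^sup>2 / (2 * s'\<^sup>2) - 1 / 2)) +
          real n * T * (?k * ?m) / (2 * s'\<^sup>2)"
        using elim(1) by (intro add_left_mono divide_right_mono) auto
      also have "\<dots> = ?k * ?m * (ln 2 + real n * (ln (s' / \<sigma>) + (\<sigma>\<^sup>2 + T) / (2 * s'\<^sup>2) - 1 / 2))"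
        by (simp add: algebra_simps add_divide_distrib)
      also have "(\<sigma>\<^sup>2 + T) / (2 * s'\<^sup>2) = 1 / 2" unfolding s'(2)[symmetric] using s'(1) by simp
      finally have "(?k * ?m) * (q n * ln ?m) \<le> (?k * ?m) * (ln 2 + real n * ln (s' / \<sigma>))"
        by (simp add: mult_ac)
      then have 1: "q n * ln ?m \<le> ln 2 + real n * ln (s' / \<sigma>)" using k m
          by (simp add: mult_le_cancel_left_pos)
      have "ln (2 powr (real n * R) / 4) \<le> ln ?m" using card[of n] by (intro ln_mono) auto
      then have "real n * (R * ln 2 - ln 4 / real n) \<le> ln ?m"
        using elim(2) by (simp add: ln_div ln_powr algebra_simps)
      then have "q n * (real n * (R * ln 2 - ln 4 / real n)) \<le> q n * ln ?m"
        using elim(3) by (intro mult_left_mono) auto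
      with 1 have "real n * (q n * (R * ln 2 - ln 4 / real n)) \<le> ln 2 + real n * ln (s' / \<sigma>)"
        by (simp only: mult.left_commute)
      also have "\<dots> = real n * (ln 2 / real n + ln (1 + T / \<sigma>\<^sup>2) / 2)"
        unfolding lns using elim(2) by (simp add: field_simps)
      finally show ?case using elim(2) by (simp add: mult_le_cancel_left_pos)
    qed
    have l1: "(\<lambda>n. q n * (R * ln 2 - ln 4 / real n)) \<longlonglongrightarrow> 1 * (R * ln 2 - 0)"
      by (intro tendsto_intros q lim_const_over_n)
    have l2: "(\<lambda>n. ln 2 / real n + ln (1 + T / \<sigma>\<^sup>2) / 2) \<longlonglongrightarrow> 0 + ln (1 + T / \<sigma>\<^sup>2) / 2"
      by (intro tendsto_intros lim_const_over_n)
    from tendsto_le[OF _ l2 l1 ev] show ?thesis by simp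
  qed
  \<comment> \<open>The energy hypothesis gives nothing at \<open>T0\<close> itself, so the bound
    for every larger \<open>T\<close> is passed to the limit from the right.\<close>
  have "((\<lambda>T. ln (1 + T / \<sigma>\<^sup>2) / 2) \<longlongrightarrow> ln (1 + T0 / \<sigma>\<^sup>2) / 2) (at_right T0)"
    using s T0 by (intro tendsto_intros) (auto simp: add_nonneg_eq_0_iff)
  moreover have "\<forall>\<^sub>F T in at_right T0. R * ln 2 \<le> ln (1 + T / \<sigma>\<^sup>2) / 2"
    using main by (auto simp: eventually_at_filter)
  ultimately have "R * ln 2 \<le> ln (1 + T0 / \<sigma>\<^sup>2) / 2"
    by (rule tendsto_lowerbound) simp
  then show ?thesis by (simp add: log_def field_simps)
qed

text \<open>Adding a fixed multiple of a signal of negligible average energy raises the average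
  energy by arbitrarily little. This replaces the receiver's signal by a codeword combination plus a
  multiple of what the warden sees.\<close>

lemma perturbed_energy_eventually:
  fixes w S :: "nat \<Rightarrow> 'p \<Rightarrow> nat \<Rightarrow> real"
  assumes T: "0 \<le> T0" "T0 < T" and N: "\<And>n. 0 < N n"
    and w: "\<And>n. 0 < n \<Longrightarrow> (\<Sum>p\<in>M n. nsq n (w n p)) \<le> real n * T0 * N n"
    and S: "(\<lambda>n. (\<Sum>p\<in>M n. nsq n (S n p)) / (real n * N n)) \<longlonglongrightarrow> 0"
  shows "\<forall>\<^sub>F n in sequentially. (\<Sum>p\<in>M n. nsq n (\<lambda>i. w n p i + b * S n p i)) \<le> real n * T * N n"
proof -
  \<comment> \<open>The factor 1 + e then uses up at most half of the gap between \<open>T0\<close>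
    and \<open>T\<close>; the summand 1 keeps the denominator positive when T0 = 0.\<close>
  define e where "e = (T - T0) / (2 * (T0 + 1))"
  have e: "0 < e" using T by (simp add: e_def)
  have "e * T0 \<le> e * (T0 + 1)" using e by (intro mult_left_mono) auto
  also have "\<dots> = (T - T0) / 2"
  proof -
    have "T0 + 1 \<noteq> 0" using T by simp
    then show ?thesis by (simp only: e_def) (simp add: field_simps)
  qed
  finally have gap: "0 < T - (1 + e) * T0" using T by (simp add: algebra_simps)
  have "(\<lambda>n. (1 + 1 / e) * b\<^sup>2 * ((\<Sum>p\<in>M n. nsq n (S n p)) / (real n * N n))) \<longlonglongrightarrow> (1 + 1 / e) * b\<^sup>2 *
      0"
    by (intro tendsto_intros S)
  then have "\<forall>\<^sub>F n in sequentially. (1 + 1 / e) * b\<^sup>2 * ((\<Sum>p\<in>M n. nsq n (S n p)) / (real n *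
      N n)) < T - (1 + e) * T0"
    using gap by (intro order_tendstoD(2)) auto
  then show ?thesis using eventually_gt_at_top[of 0]
  proof eventually_elim
    case (elim n)
    have nN: "0 < real n * N n" using elim(2) N by simp
    have "(\<Sum>p\<in>M n. nsq n (\<lambda>i. w n p i + b * S n p i)) \<le>
        (\<Sum>p\<in>M n. (1 + e) * nsq n (w n p) + (1 + 1 / e) * b\<^sup>2 * nsq n (S n p))"
      by (intro sum_mono nsq_add_le e)
    also have "\<dots> = (1 + e) * (\<Sum>p\<in>M n. nsq n (w n p)) + (1 + 1 / e) * b\<^sup>2 * (\<Sum>p\<in>M n. nsq n (S n p))"
      by (simp only: sum.distrib sum_distrib_left)
    also have "\<dots> \<le> (1 + e) * (real n * T0 * N n) + (T - (1 + e) * T0) * (real n * N n)"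
    proof (rule add_mono)
      show "(1 + e) * (\<Sum>p\<in>M n. nsq n (w n p)) \<le> (1 + e) * (real n * T0 * N n)"
        using w[OF elim(2)] e by (intro mult_left_mono) auto
      have "(1 + 1 / e) * b\<^sup>2 * (\<Sum>p\<in>M n. nsq n (S n p)) / (real n * N n) \<le> T - (1 + e) * T0"
        using elim(1) by simp
      then show "(1 + 1 / e) * b\<^sup>2 * (\<Sum>p\<in>M n. nsq n (S n p)) \<le> (T - (1 + e) * T0) * (real n * N n)"
        using nN by (simp only: pos_divide_le_eq)
    qed
    also have "\<dots> = real n * T * N n" by (simp add: algebra_simps)
    finally show ?case .
  qed
qed

section \<open>Energy of centred sums over independent messages\<close>

lemma sum_centered_squares_le:
  fixes a :: "'a \<Rightarrow> real"
  assumes A: "finite A" "A \<noteq> {}"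
  defines "m \<equiv> sum a A / real (card A)"
  shows "(\<Sum>x\<in>A. a x - m) = 0" "(\<Sum>x\<in>A. (a x - m)\<^sup>2) \<le> (\<Sum>x\<in>A. (a x)\<^sup>2)"
proof -
  have c: "0 < real (card A)" using A by (simp add: card_gt_0_iff)
  then show z: "(\<Sum>x\<in>A. a x - m) = 0" by (simp add: sum_subtractf m_def)
  have "(\<Sum>x\<in>A. (a x)\<^sup>2) = (\<Sum>x\<in>A. (a x - m)\<^sup>2 + 2 * m * (a x - m) + m\<^sup>2)"
    by (intro sum.cong refl) (simp add: power2_eq_square algebra_simps)
  also have "\<dots> = (\<Sum>x\<in>A. (a x - m)\<^sup>2) + 2 * m * (\<Sum>x\<in>A. a x - m) + real (card A) * m\<^sup>2"
    by (simp only: sum.distrib sum_distrib_left sum_constant)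
  finally show "(\<Sum>x\<in>A. (a x - m)\<^sup>2) \<le> (\<Sum>x\<in>A. (a x)\<^sup>2)" using z by simp
qed

text \<open>Variances of independent variables add: after centring, the cross terms sum to a product
  of two zero sums. Without centring they could be positive, for instance for constant equal
  codewords, and the energy of the sum would exceed the sum of the energies.\<close>

lemma sum_squares_independent_le:
  fixes a :: "'a \<Rightarrow> real" and b :: "'b \<Rightarrow> real"
  assumes A: "finite A" "A \<noteq> {}" and B: "finite B" "B \<noteq> {}"
  shows "(\<Sum>p\<in>A \<times> B. (a (fst p) + b (snd p) - (sum a A / real (card A) +
      sum b B / real (card B)))\<^sup>2) \<le>
    real (card B) * (\<Sum>x\<in>A. (a x)\<^sup>2) + real (card A) * (\<Sum>y\<in>B. (b y)\<^sup>2)"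
proof -
  define a' where "a' x = a x - sum a A / real (card A)" for x
  define b' where "b' y = b y - sum b B / real (card B)" for y
  have z: "sum a' A = 0" "(\<Sum>x\<in>A. (a' x)\<^sup>2) \<le> (\<Sum>x\<in>A. (a x)\<^sup>2)"
    using sum_centered_squares_le[OF A, of a] by (simp_all add: a'_def)
  have z2: "(\<Sum>x\<in>B. (b' x)\<^sup>2) \<le> (\<Sum>x\<in>B. (b x)\<^sup>2)"
    using sum_centered_squares_le[OF B, of b] by (simp_all add: b'_def)
  have "(\<Sum>p\<in>A \<times> B. (a (fst p) + b (snd p) - (sum a A / real (card A) + sum b B / real (card B)))\<^sup>2)
    = (\<Sum>x\<in>A. \<Sum>y\<in>B. (a' x)\<^sup>2 + (b' y)\<^sup>2 + 2 * (a' x * b' y))"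
  proof -
    have "(a x + b y - (sum a A / real (card A) + sum b B / real (card B)))\<^sup>2 =
        (a' x)\<^sup>2 + (b' y)\<^sup>2 + 2 * (a' x * b' y)" for x y
      by (simp add: a'_def b'_def power2_eq_square algebra_simps add_divide_distrib)
    then show ?thesis by (simp add: sum.cartesian_product case_prod_beta)
  qed
  also have "\<dots> = real (card B) * (\<Sum>x\<in>A. (a' x)\<^sup>2) + real (card A) * (\<Sum>y\<in>B. (b' y)\<^sup>2) + 2 *
      (sum a' A * sum b' B)"
    by (simp add: sum.distrib sum_distrib_left[symmetric] sum_product)
  finally show ?thesis using z z2
    by (simp add: add_mono mult_left_mono)
qed

lemma energy_independent_le:
  assumes A: "finite A" "A \<noteq> {}" and B: "finite B" "B \<noteq> {}"
    and a: "\<And>x. x \<in> A \<Longrightarrow> nsq n (a x) \<le> P" and b: "\<And>y. y \<in> B \<Longrightarrow> nsq n (b y) \<le> Q"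
  shows "(\<Sum>p\<in>A \<times> B. nsq n (\<lambda>i. a (fst p) i + b (snd p) i -
      ((\<Sum>x\<in>A. a x i) / real (card A) + (\<Sum>y\<in>B. b y i) / real (card B)))) \<le>
          (P + Q) * (real (card A) * real (card B))"
proof -
  have "(\<Sum>p\<in>A \<times> B. nsq n (\<lambda>i. a (fst p) i + b (snd p) i -
      ((\<Sum>x\<in>A. a x i) / real (card A) + (\<Sum>y\<in>B. b y i) / real (card B)))) =
    (\<Sum>i<n. \<Sum>p\<in>A \<times> B. (a (fst p) i + b (snd p) i -
      ((\<Sum>x\<in>A. a x i) / real (card A) + (\<Sum>y\<in>B. b y i) / real (card B)))\<^sup>2)"
    unfolding nsq_def by (rule sum.swap)
  also have "\<dots> \<le> (\<Sum>i<n. real (card B) * (\<Sum>x\<in>A. (a x i)\<^sup>2) + real (card A) * (\<Sum>y\<in>B. (b y i)\<^sup>2))"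
    by (intro sum_mono sum_squares_independent_le A B)
  also have "\<dots> = real (card B) * (\<Sum>i<n. \<Sum>x\<in>A. (a x i)\<^sup>2) + real (card A) * (\<Sum>i<n. \<Sum>y\<in>B. (b y i)\<^sup>2)"
    by (simp add: sum.distrib sum_distrib_left)
  also have "\<dots> = real (card B) * (\<Sum>x\<in>A. nsq n (a x)) + real (card A) * (\<Sum>y\<in>B. nsq n (b y))"
    unfolding nsq_def by (subst (1 2) sum.swap) rule
  also have "\<dots> \<le> real (card B) * (\<Sum>x\<in>A. P) + real (card A) * (\<Sum>y\<in>B. Q)"
    by (intro add_mono mult_left_mono sum_mono a b) auto
  also have "\<dots> = (P + Q) * (real (card A) * real (card B))" by (simp add: algebra_simps)
  finally show ?thesis .
qed

text \<open>With \<open>S\<close> the warden's and \<open>V\<close> the receiver's signal, V = (1 -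
  h)(x1 + x2) + h S and also V = (h - 1) x3 + S. As \<open>S\<close> has negligible energy, each of
  the three rates is bounded once through the first form and once through the second, and the
  minimum follows.\<close>

lemma covert_region_outer_bound:
  assumes s: "0 < \<sigma>B" "0 < \<sigma>E" and P: "0 \<le> P1" "0 \<le> P2" "0 \<le> P3"
    and ach: "achievable h \<sigma>B \<sigma>E P1 P2 P3 R1 R2"
  shows "R1 \<le> 1 / 2 * log 2 (1 + (h - 1)\<^sup>2 * min P1 P3 / \<sigma>B\<^sup>2)"
    and "R2 \<le> 1 / 2 * log 2 (1 + (h - 1)\<^sup>2 * min P2 P3 / \<sigma>B\<^sup>2)"
    and "R1 + R2 \<le> 1 / 2 * log 2 (1 + (h - 1)\<^sup>2 * min (P1 + P2) P3 / \<sigma>B\<^sup>2)"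
proof -
  from ach obtain c where R: "0 \<le> R1" "0 \<le> R2"
    and code: "\<And>n. 0 < n \<Longrightarrow> is_code P1 P2 P3 R1 R2 n (c n)"
    and err: "(\<lambda>n. error_prob h \<sigma>B \<sigma>E R1 R2 n (c n)) \<longlonglongrightarrow> 0"
    and tv: "(\<lambda>n. tv_dist (warden_law \<sigma>B \<sigma>E R1 R2 n (c n)) (white_noise n \<sigma>E)) \<longlonglongrightarrow> 0"
    unfolding achievable_def by blast
  define A1 where "A1 n = messages n R1" for n
  define A2 where "A2 n = messages n R2" for n
  define N where "N n = real (card (A1 n)) * real (card (A2 n))" for n
  define x1 where "x1 n p = enc1 (c n) (fst p)" for n and p :: "nat \<times> nat"
  define x2 where "x2 n p = enc2 (c n) (snd p)" for n and p :: "nat \<times> nat"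
  define x3 where "x3 n p = enc3 (c n) (fst p) (snd p)" for n and p :: "nat \<times> nat"
  define S where "S n p = signal_E (c n) (fst p) (snd p)" for n and p :: "nat \<times> nat"
  define V where "V n p = signal_B h (c n) (fst p) (snd p)" for n and p :: "nat \<times> nat"
  have A: "finite (A1 n)" "A1 n \<noteq> {}" "finite (A2 n)" "A2 n \<noteq> {}" for n
    using R by (auto simp: A1_def A2_def messages_nonempty)
  have N: "0 < N n" for n using A by (simp add: N_def card_gt_0_iff)
  have pow: "nsq n (x1 n p) \<le> real n * P1" "nsq n (x2 n p) \<le> real n * P2" "nsq n (x3 n p) \<le>
      real n * P3"
    if "0 < n" "p \<in> A1 n \<times> A2 n" for n p
    using code[OF that(1)] that unfolding is_code_def A1_def A2_def x1_def x2_def x3_def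
    by (auto simp: power_ok_iff)
  have Seq: "S n p i = x1 n p i + x2 n p i + x3 n p i" for n p i
    by (simp add: S_def signal_E_def x1_def x2_def x3_def)
  have Veq: "V n p i = x1 n p i + x2 n p i + h * x3 n p i" for n p i
    by (simp add: V_def signal_B_def x1_def x2_def x3_def)
  have energy: "(\<lambda>n. (\<Sum>p\<in>A1 n \<times> A2 n. nsq n (S n p)) / (real n * N n)) \<longlonglongrightarrow> 0"
    unfolding A1_def A2_def N_def S_def
  proof (rule covert_energy_vanishes[OF s R _ tv])
    fix n m1 m2 :: nat assume n: "0 < n" and m: "m1 \<in> messages n R1" "m2 \<in> messages n R2"
    let ?p = "(m1, m2)"
    have p: "?p \<in> A1 n \<times> A2 n" using m by (simp add: A1_def A2_def)
    have "nsq n (S n ?p) \<le> 2 * nsq n (\<lambda>i. x1 n ?p i + 1 * x2 n ?p i) + 2 * nsq n (x3 n ?p)"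
      using nsq_add_le[of 1 n "\<lambda>i. x1 n ?p i + 1 * x2 n ?p i" 1 "x3 n ?p"]
          by (simp add: Seq[abs_def])
    also have "nsq n (\<lambda>i. x1 n ?p i + 1 * x2 n ?p i) \<le> 2 * nsq n (x1 n ?p) + 2 * nsq n (x2 n ?p)"
      using nsq_add_le[of 1 n "x1 n ?p" 1 "x2 n ?p"] by simp
    finally have "nsq n (S n ?p) \<le> 2 * (2 * (real n * P1) + 2 * (real n * P2)) + 2 * (real n * P3)"
      using pow[OF n p] by simp
    also have "\<dots> = real n * (4 * P1 + 4 * P2 + 2 * P3)" by (simp add: algebra_simps)
    finally show "nsq n (signal_E (c n) m1 m2) \<le> real n * (4 * P1 + 4 * P2 + 2 * P3)"
        by (simp add: S_def)
  qed
  define q where "q n = 1 - error_prob h \<sigma>B \<sigma>E R1 R2 n (c n)" for n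
  have q: "q \<longlonglongrightarrow> 1"
    unfolding q_def using tendsto_diff[OF tendsto_const err, of 1] by simp
  have dec: "dec (c n) \<in> seq_space n \<rightarrow>\<^sub>M count_space (A1 n \<times> A2 n)" if "0 < n" for n
    using code[OF that] by (simp add: is_code_def A1_def A2_def)
  have pre: "{y \<in> space (seq_space n). Q (dec (c n) y)} \<in> sets (seq_space n)" if "0 < n" for n Q
  proof -
    have "dec (c n) -` {p \<in> A1 n \<times> A2 n. Q p} \<inter> space (seq_space n) \<in> sets (seq_space n)"
      by (rule measurable_sets[OF dec[OF that]]) auto
    also have "dec (c n) -` {p \<in> A1 n \<times> A2 n. Q p} \<inter> space (seq_space n) =
        {y \<in> space (seq_space n). Q (dec (c n) y)}"
      using measurable_space[OF dec[OF that]] by auto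
    finally show ?thesis .
  qed
  \<comment> \<open>Decoding the whole pair correctly implies every reflexive relation
    \<open>Q\<close> between the true and the decoded pair. Equality of first components, of second
    components and of pairs yields the three kinds of decoding sets.\<close>
  have correct: "q n * N n \<le> (\<Sum>p\<in>A1 n \<times> A2 n. measure (shifted_noise n \<sigma>B (V n p)) {y \<in> space
      (seq_space n). Q p (dec (c n) y)})"
    if n: "0 < n" and Q: "\<And>p. Q p p" for n Q
  proof -
    have "1 - measure (shifted_noise n \<sigma>B (V n p)) {y \<in> space (seq_space n). dec (c n) y \<noteq> p} \<le>
       measure (shifted_noise n \<sigma>B (V n p)) {y \<in> space (seq_space n). Q p (dec (c n) y)}" for p
    proof -
      interpret prob_space "shifted_noise n \<sigma>B (V n p)" by (rule prob_space_shifted_noise[OF s(1)])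
      have "1 - prob {y \<in> space (seq_space n). dec (c n) y \<noteq> p} =
          prob (space (seq_space n) - {y \<in> space (seq_space n). dec (c n) y \<noteq> p})"
        using prob_compl[of "{y \<in> space (seq_space n). dec (c n) y \<noteq> p}"] pre[OF n] by simp
      also have "\<dots> \<le> prob {y \<in> space (seq_space n). Q p (dec (c n) y)}"
        using pre[OF n] by (intro finite_measure_mono) (auto intro: Q)
      finally show ?thesis .
    qed
    then have "(\<Sum>p\<in>A1 n \<times> A2 n. 1 - measure (shifted_noise n \<sigma>B (V n p)) {y \<in> space (seq_space n).
        dec (c n) y \<noteq> p})
       \<le> (\<Sum>p\<in>A1 n \<times> A2 n. measure (shifted_noise n \<sigma>B (V n p)) {y \<in> space (seq_space n). Q p (dec
           (c n) y)})"
      by (rule sum_mono)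
    moreover have "error_prob h \<sigma>B \<sigma>E R1 R2 n (c n) = (\<Sum>p\<in>A1 n \<times> A2 n.
        measure (shifted_noise n \<sigma>B (V n p)) {y \<in> space (seq_space n). dec (c n) y \<noteq> p}) / N n"
      using error_prob_eq[OF s R, of "c n" n h] dec[OF n]
      by (simp add: sum.cartesian_product case_prod_beta V_def N_def A1_def A2_def)
    moreover have "(\<Sum>p\<in>A1 n \<times> A2 n. 1 :: real) = N n" by (simp add: N_def card_cartesian_product)
    ultimately show ?thesis using N[of n] by (simp add: q_def sum_subtractf field_simps)
  qed
  have c1: "2 powr (real n * R1) / 4 \<le> real (card (A1 n))" for n
    using card_messages_lower[OF R(1), of n] by (simp add: A1_def)
  have c2: "2 powr (real n * R2) / 4 \<le> real (card (A2 n))" for n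
    using card_messages_lower[OF R(2), of n] by (simp add: A2_def)
  have c12: "2 powr (real n * (R1 + R2)) / 4 \<le> real (card (A1 n \<times> A2 n))" for n
    using mult_mono[OF card_messages_lower[OF R(1), of n] card_messages_lower[OF R(2), of n]]
    by (simp add: A1_def A2_def card_cartesian_product powr_add distrib_left)
  \<comment> \<open>The second message is the side information, so the reference centre may contain
    the second codeword and only the energy of the first remains.\<close>
  have bound1: "R1 \<le> 1 / 2 * log 2 (1 + T0 / \<sigma>B\<^sup>2)"
    if T0: "0 \<le> T0" and w: "\<And>n. 0 < n \<Longrightarrow> (\<Sum>p\<in>A1 n \<times> A2 n. nsq n (w n p)) \<le> real n * T0 * N n"
      and V: "\<And>n p i. V n p i - \<mu> n (snd p) i = w n p i + b * S n p i" for T0 w b \<mu>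
  proof (rule gaussian_rate_bound[where K = A2 and I = A1 and q = q and v = "\<lambda>n m2 m1. V n (m1, m2)"
        and A = "\<lambda>n m1. {y \<in> space (seq_space n). fst (dec (c n) y) = m1}" and \<mu> = \<mu>, OF s(1) T0])
    show "q n * (real (card (A2 n)) * real (card (A1 n))) \<le>
      (\<Sum>k\<in>A2 n. \<Sum>m\<in>A1 n. measure (shifted_noise n \<sigma>B (V n (m,
          k))) {y \<in> space (seq_space n). fst (dec (c n) y) = m})"
      if "0 < n" for n
      using correct[OF that, of "\<lambda>p p'. fst p' = fst p"]
      by (subst sum.swap) (simp add: sum.cartesian_product case_prod_beta N_def mult.commute)
    show "\<forall>\<^sub>F n in sequentially. (\<Sum>k\<in>A2 n. \<Sum>m\<in>A1 n. nsq n (\<lambda>i. V n (m, k) i - \<mu> n k i))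
       \<le> real n * T * (real (card (A2 n)) * real (card (A1 n)))" if "T0 < T" for T
    proof -
      have "\<forall>\<^sub>F n in sequentially. (\<Sum>p\<in>A1 n \<times> A2 n. nsq n (\<lambda>i. V n p i - \<mu> n (snd p) i)) \<le>
          real n * T * N n"
        unfolding V by (rule perturbed_energy_eventually[OF T0 that N w energy])
      then show ?thesis
        by (subst sum.swap) (simp add: sum.cartesian_product case_prod_beta N_def mult_ac)
    qed
  qed (use A q c1 pre in \<open>auto simp: disjoint_family_on_def\<close>)
  have bound2: "R2 \<le> 1 / 2 * log 2 (1 + T0 / \<sigma>B\<^sup>2)"
    if T0: "0 \<le> T0" and w: "\<And>n. 0 < n \<Longrightarrow> (\<Sum>p\<in>A1 n \<times> A2 n. nsq n (w n p)) \<le> real n * T0 * N n"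
      and V: "\<And>n p i. V n p i - \<mu> n (fst p) i = w n p i + b * S n p i" for T0 w b \<mu>
  proof (rule gaussian_rate_bound[where K = A1 and I = A2 and q = q and v = "\<lambda>n m1 m2. V n (m1, m2)"
        and A = "\<lambda>n m2. {y \<in> space (seq_space n). snd (dec (c n) y) = m2}" and \<mu> = \<mu>, OF s(1) T0])
    show "q n * (real (card (A1 n)) * real (card (A2 n))) \<le>
      (\<Sum>k\<in>A1 n. \<Sum>m\<in>A2 n. measure (shifted_noise n \<sigma>B (V n (k,
          m))) {y \<in> space (seq_space n). snd (dec (c n) y) = m})"
      if "0 < n" for n
      using correct[OF that, of "\<lambda>p p'. snd p' = snd p"]
      by (simp add: sum.cartesian_product case_prod_beta N_def)
    show "\<forall>\<^sub>F n in sequentially. (\<Sum>k\<in>A1 n. \<Sum>m\<in>A2 n. nsq n (\<lambda>i. V n (k, m) i - \<mu> n k i))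
       \<le> real n * T * (real (card (A1 n)) * real (card (A2 n)))" if "T0 < T" for T
    proof -
      have "\<forall>\<^sub>F n in sequentially. (\<Sum>p\<in>A1 n \<times> A2 n. nsq n (\<lambda>i. V n p i - \<mu> n (fst p) i)) \<le>
          real n * T * N n"
        unfolding V by (rule perturbed_energy_eventually[OF T0 that N w energy])
      then show ?thesis
        by (simp add: sum.cartesian_product case_prod_beta N_def)
    qed
  qed (use A q c2 pre in \<open>auto simp: disjoint_family_on_def\<close>)
  \<comment> \<open>Both messages are decoded, so the side information is trivial and the centre may
    not depend on any message.\<close>
  have bound12: "R1 + R2 \<le> 1 / 2 * log 2 (1 + T0 / \<sigma>B\<^sup>2)"
    if T0: "0 \<le> T0" and w: "\<And>n. 0 < n \<Longrightarrow> (\<Sum>p\<in>A1 n \<times> A2 n. nsq n (w n p)) \<le> real n * T0 * N n"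
      and V: "\<And>n p i. V n p i - \<mu> n i = w n p i + b * S n p i" for T0 w b \<mu>
  proof (rule gaussian_rate_bound[where K = "\<lambda>_. {()}" and I = "\<lambda>n. A1 n \<times> A2 n" and q = q and v =
      "\<lambda>n _ p. V n p"
        and A = "\<lambda>n p. {y \<in> space (seq_space n). dec (c n) y = p}" and \<mu> = "\<lambda>n _. \<mu> n", OF s(1) T0])
    show "q n * (real (card {()}) * real (card (A1 n \<times> A2 n))) \<le>
      (\<Sum>k\<in>{()}. \<Sum>m\<in>A1 n \<times> A2 n. measure (shifted_noise n \<sigma>B (V n m)) {y \<in> space (seq_space n). dec
          (c n) y = m})"
      if "0 < n" for n
      using correct[OF that, of "\<lambda>p p'. p' = p"]
      by (simp add: N_def card_cartesian_product)
    show "\<forall>\<^sub>F n in sequentially. (\<Sum>k\<in>{()}. \<Sum>m\<in>A1 n \<times> A2 n. nsq n (\<lambda>i. V n m i - \<mu> n i))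
       \<le> real n * T * (real (card {()}) * real (card (A1 n \<times> A2 n)))" if "T0 < T" for T
    proof -
      have "\<forall>\<^sub>F n in sequentially. (\<Sum>p\<in>A1 n \<times> A2 n. nsq n (\<lambda>i. V n p i - \<mu> n i)) \<le> real n * T * N n"
        unfolding V by (rule perturbed_energy_eventually[OF T0 that N w energy])
      then show ?thesis
        by (simp add: N_def card_cartesian_product)
    qed
  qed (use A q c12 pre in \<open>auto simp: disjoint_family_on_def\<close>)
  have each: "(\<Sum>p\<in>A1 n \<times> A2 n. nsq n (w p)) \<le> real n * T * N n"
    if "\<And>p. p \<in> A1 n \<times> A2 n \<Longrightarrow> nsq n (w p) \<le> real n * T" for n w T
    using sum_bounded_above[of "A1 n \<times> A2 n" "\<lambda>p. nsq n (w p)" "real n * T"] that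
    by (simp add: N_def card_cartesian_product mult_ac)
  have scale: "nsq n (\<lambda>i. a * x i) \<le> real n * (a\<^sup>2 * P)" if "nsq n x \<le> real n * P" for n a x P
    using mult_left_mono[OF that, of "a\<^sup>2"] by (simp add: nsq_scale mult_ac)
  have helper: "(\<Sum>p\<in>A1 n \<times> A2 n. nsq n (\<lambda>i. (h - 1) * x3 n p i)) \<le> real n * ((h - 1)\<^sup>2 * P3) * N n"
    if "0 < n" for n
    using pow(3)[OF that] by (intro each scale)
  \<comment> \<open>The second form of the receiver's signal, with reference centre 0; it serves all
    three rates.\<close>
  have V3: "V n p i - 0 = (h - 1) * x3 n p i + 1 * S n p i" for n p i
    by (simp add: Veq Seq algebra_simps)
  have sq: "(1 - h)\<^sup>2 = (h - 1)\<^sup>2" by (simp add: power2_commute)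
  have "R1 \<le> 1 / 2 * log 2 (1 + (h - 1)\<^sup>2 * P1 / \<sigma>B\<^sup>2)"
  proof (rule bound1[where w = "\<lambda>n p i. (1 - h) * x1 n p i" and b = h and \<mu> =
      "\<lambda>n m2 i. (1 - h) * enc2 (c n) m2 i"])
    show "(\<Sum>p\<in>A1 n \<times> A2 n. nsq n (\<lambda>i. (1 - h) * x1 n p i)) \<le> real n * ((h - 1)\<^sup>2 * P1) * N n"
        if "0 < n" for n
      using pow(1)[OF that] unfolding sq[symmetric] by (intro each scale)
  qed (use P in \<open>simp_all add: Veq Seq x2_def algebra_simps\<close>)
  moreover have "R1 \<le> 1 / 2 * log 2 (1 + (h - 1)\<^sup>2 * P3 / \<sigma>B\<^sup>2)"
    by (rule bound1[OF _ helper V3]) (use P in auto)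
  ultimately show "R1 \<le> 1 / 2 * log 2 (1 + (h - 1)\<^sup>2 * min P1 P3 / \<sigma>B\<^sup>2)" by (simp add: min_def)
  have "R2 \<le> 1 / 2 * log 2 (1 + (h - 1)\<^sup>2 * P2 / \<sigma>B\<^sup>2)"
  proof (rule bound2[where w = "\<lambda>n p i. (1 - h) * x2 n p i" and b = h and \<mu> =
      "\<lambda>n m1 i. (1 - h) * enc1 (c n) m1 i"])
    show "(\<Sum>p\<in>A1 n \<times> A2 n. nsq n (\<lambda>i. (1 - h) * x2 n p i)) \<le> real n * ((h - 1)\<^sup>2 * P2) * N n"
        if "0 < n" for n
      using pow(2)[OF that] unfolding sq[symmetric] by (intro each scale)
  qed (use P in \<open>simp_all add: Veq Seq x1_def algebra_simps\<close>)
  moreover have "R2 \<le> 1 / 2 * log 2 (1 + (h - 1)\<^sup>2 * P3 / \<sigma>B\<^sup>2)"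
    by (rule bound2[OF _ helper V3]) (use P in auto)
  ultimately show "R2 \<le> 1 / 2 * log 2 (1 + (h - 1)\<^sup>2 * min P2 P3 / \<sigma>B\<^sup>2)" by (simp add: min_def)
  \<comment> \<open>Centring at the message average makes the independent codewords uncorrelated, so
    that the energy of their sum is at most P1 + P2 per symbol.\<close>
  define mean where "mean n i = (\<Sum>x\<in>A1 n. enc1 (c n) x i) / real (card (A1 n)) +
      (\<Sum>y\<in>A2 n. enc2 (c n) y i) / real (card (A2 n))" for n i
  have "R1 + R2 \<le> 1 / 2 * log 2 (1 + (h - 1)\<^sup>2 * (P1 + P2) / \<sigma>B\<^sup>2)"
  proof (rule bound12[where w = "\<lambda>n p i. (1 - h) * (x1 n p i + x2 n p i - mean n i)" and b =
      h and \<mu> = "\<lambda>n i. (1 - h) * mean n i"])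
    show "(\<Sum>p\<in>A1 n \<times> A2 n. nsq n (\<lambda>i. (1 - h) * (x1 n p i + x2 n p i - mean n i))) \<le>
        real n * ((h - 1)\<^sup>2 * (P1 + P2)) * N n" if n: "0 < n" for n
    proof -
      have "(\<Sum>p\<in>A1 n \<times> A2 n. nsq n (\<lambda>i. x1 n p i + x2 n p i - mean n i)) \<le>
          (real n * P1 + real n * P2) * N n"
        unfolding x1_def x2_def mean_def N_def
      proof (rule energy_independent_le)
        fix x assume "x \<in> A1 n"
        moreover obtain y where "y \<in> A2 n" using A by blast
        ultimately show "nsq n (enc1 (c n) x) \<le> real n * P1" using pow(1)[OF n, of "(x, y)"]
            by (simp add: x1_def)
      next
        fix y assume "y \<in> A2 n"
        moreover obtain x where "x \<in> A1 n" using A by blast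
        ultimately show "nsq n (enc2 (c n) y) \<le> real n * P2" using pow(2)[OF n, of "(x, y)"]
            by (simp add: x2_def)
      qed (use A in auto)
      then have "(h - 1)\<^sup>2 * (\<Sum>p\<in>A1 n \<times> A2 n. nsq n (\<lambda>i. x1 n p i + x2 n p i - mean n i)) \<le>
         (h - 1)\<^sup>2 * ((real n * P1 + real n * P2) * N n)" by (intro mult_left_mono) auto
      also have "\<dots> = real n * ((h - 1)\<^sup>2 * (P1 + P2)) * N n" by (simp add: algebra_simps)
      finally show ?thesis by (simp only: nsq_scale sum_distrib_left[symmetric] sq)
    qed
  qed (use P in \<open>simp_all add: Veq Seq algebra_simps\<close>)
  moreover have "R1 + R2 \<le> 1 / 2 * log 2 (1 + (h - 1)\<^sup>2 * P3 / \<sigma>B\<^sup>2)"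
    by (rule bound12[OF _ helper V3]) (use P in auto)
  ultimately show "R1 + R2 \<le> 1 / 2 * log 2 (1 + (h - 1)\<^sup>2 * min (P1 + P2) P3 / \<sigma>B\<^sup>2)"
      by (simp add: min_def)
qed

section \<open>Achievability\<close>

text \<open>A random codebook is indexed by \<open>Inl m\<^sub>1\<close> for the codewords of transmitter 1 and \<open>Inr m\<^sub>2\<close> for
  those of transmitter 2. Codewords are standard Gaussian and scaled by amplitudes, so that zero
  power needs no degenerate measure.\<close>

definition mix :: "real \<Rightarrow> real \<Rightarrow> (nat + nat \<Rightarrow> nat \<Rightarrow> real) \<Rightarrow> nat \<Rightarrow> nat \<Rightarrow> nat \<Rightarrow> real" where
  "mix a b c m1 m2 = (\<lambda>i. a * c (Inl m1) i + b * c (Inr m2) i)"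

abbreviation codebook :: "nat \<Rightarrow> (nat + nat) set \<Rightarrow> (nat + nat \<Rightarrow> nat \<Rightarrow> real) measure" where
  "codebook n J \<equiv> \<Pi>\<^sub>M j\<in>J. white_noise n 1"

section \<open>Random Gaussian codebooks\<close>

lemma product_white_noise: "product_prob_space (\<lambda>_::'j. white_noise n 1)"
  by (simp add: product_prob_space_def product_sigma_finite_def product_prob_space_axioms_def
      prob_space_white_noise prob_space_imp_sigma_finite)

lemma prob_space_codebook: "prob_space (codebook n J)"
  by (intro prob_space_PiM prob_space_white_noise) simp

lemma measurable_codeword:
  assumes f: "f \<in> M \<rightarrow>\<^sub>M codebook n J" and "j \<in> J" "i < n"
  shows "(\<lambda>w. f w j i) \<in> borel_measurable M"
proof -
  have "(\<lambda>w. f w j) \<in> M \<rightarrow>\<^sub>M white_noise n 1"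
    using measurable_compose[OF f measurable_component_singleton[OF assms(2)]] .
  then have "(\<lambda>w. f w j) \<in> M \<rightarrow>\<^sub>M seq_space n"
    by (simp add: measurable_cong_sets[OF refl sets_white_noise])
  from measurable_compose[OF this measurable_component_singleton[of i]] assms(3) show ?thesis
      by simp
qed

lemma measurable_nsq_mix:
  assumes f: "f \<in> M \<rightarrow>\<^sub>M codebook n J" and m: "Inl m1 \<in> J" "Inr m2 \<in> J"
    and g: "\<And>i. i < n \<Longrightarrow> (\<lambda>w. g w i) \<in> borel_measurable M"
  shows "(\<lambda>w. nsq n (\<lambda>i. mix a b (f w) m1 m2 i + g w i)) \<in> borel_measurable M"
  unfolding mix_def
  by (intro measurable_nsq borel_measurable_add borel_measurable_times borel_measurable_const
      measurable_codeword[OF f] m g)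

text \<open>Only two codewords matter at a time: a bound on the integral over codewords
  \<open>j\<close> and \<open>k\<close>, uniform in the rest of the codebook, bounds the average
  over the whole codebook.\<close>

lemma codebook_integral_le:
  assumes J: "finite J" and jk: "j \<in> J" "k \<in> J" "j \<noteq> k"
    and f: "f \<in> borel_measurable (codebook n J)"
    and le: "\<And>c. (\<integral>\<^sup>+x. \<integral>\<^sup>+y. f (c(j := x, k := y)) \<partial>white_noise n 1 \<partial>white_noise n 1) \<le> K"
  shows "(\<integral>\<^sup>+c. f c \<partial>codebook n J) \<le> K"
proof -
  interpret product_prob_space "\<lambda>_::nat + nat. white_noise n 1" by (rule product_white_noise)
  define J' where "J' = J - {j, k}"
  have J': "J = insert k (insert j J')" "finite J'" "j \<notin> J'" "k \<notin> insert j J'"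
    using jk J by (auto simp: J'_def)
  interpret C: prob_space "codebook n J'" by (rule prob_space_codebook)
  have f': "f \<in> borel_measurable (codebook n (insert k (insert j J')))" using f J'(1) by simp
  have "(\<integral>\<^sup>+c. f c \<partial>codebook n J) = (\<integral>\<^sup>+c. \<integral>\<^sup>+y. f (c(k :=
      y)) \<partial>white_noise n 1 \<partial>codebook n (insert j J'))"
    unfolding J'(1) using J' f' by (intro product_nn_integral_insert) auto
  also have "\<dots> = (\<integral>\<^sup>+c. \<integral>\<^sup>+x. \<integral>\<^sup>+y. f (c(j := x, k :=
      y)) \<partial>white_noise n 1 \<partial>white_noise n 1 \<partial>codebook n J')"
  proof (rule product_nn_integral_insert)
    note f'[measurable]
    show "(\<lambda>c. \<integral>\<^sup>+y. f (c(k := y)) \<partial>white_noise n 1) \<in> borel_measurable (codebook n (insert j J'))"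
      by measurable
  qed (use J' in auto)
  also have "\<dots> \<le> (\<integral>\<^sup>+c. K \<partial>codebook n J')" by (intro nn_integral_mono le)
  finally show ?thesis by (simp add: C.emeasure_space_1)
qed

section \<open>Error events under the joint law of codebook and noise\<close>

abbreviation code_noise :: "nat \<Rightarrow> (nat + nat) set \<Rightarrow> real \<Rightarrow> ((nat +
    nat \<Rightarrow> nat \<Rightarrow> real) \<times> (nat \<Rightarrow> real)) measure" where
  "code_noise n J s \<equiv> codebook n J \<Otimes>\<^sub>M white_noise n s"

lemma measurable_noise:
  "i < n \<Longrightarrow> (\<lambda>w. snd w i) \<in> borel_measurable (codebook n J \<Otimes>\<^sub>M white_noise n s)"
  using measurable_compose[OF measurable_snd measurable_component_singleton[of i "{..<n}" "\<lambda>_.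
      gaussian s"]]
  by (simp add: white_noise_def measurable_cong_sets[OF refl sets_gaussian])

text \<open>The first conjunct restricts the event to outputs of typical energy, the condition under
  which a wrong codeword has the sharp exponent. A zero amplitude removes one transmitter, so the
  same event also describes confusion in a single message.\<close>

definition confusable ::
  "nat \<Rightarrow> real \<Rightarrow> real \<Rightarrow> real \<Rightarrow> real \<Rightarrow> nat \<Rightarrow> nat \<Rightarrow> nat \<Rightarrow> nat \<Rightarrow>
    (nat + nat \<Rightarrow> nat \<Rightarrow> real) \<times> (nat \<Rightarrow> real) \<Rightarrow> bool" where
  "confusable n a b t \<tau> m1 m2 m1' m2' w \<longleftrightarrow>
    real n * t \<le> nsq n (\<lambda>i. mix a b (fst w) m1 m2 i + snd w i) \<and>
    nsq n (\<lambda>i. mix a b (fst w) m1 m2 i + snd w i - mix a b (fst w) m1' m2' i) \<le> real n * \<tau>"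

lemma pred_confusable:
  assumes "Inl m1 \<in> J" "Inr m2 \<in> J" "Inl m1' \<in> J" "Inr m2' \<in> J"
  shows "Measurable.pred (code_noise n J s) (confusable n a b t \<tau> m1 m2 m1' m2')"
proof -
  have 1[measurable]: "(\<lambda>w. nsq n (\<lambda>i. mix a b (fst w) m1 m2 i +
      snd w i)) \<in> borel_measurable (code_noise n J s)"
    by (intro measurable_nsq_mix[OF measurable_fst] assms measurable_noise)
  have 2[measurable]: "(\<lambda>w. nsq n (\<lambda>i. mix a b (fst w) m1 m2 i +
      snd w i - mix a b (fst w) m1' m2' i)) \<in> borel_measurable (code_noise n J s)"
    unfolding mix_def
    by (intro measurable_nsq borel_measurable_add borel_measurable_diff borel_measurable_times
        borel_measurable_const
      measurable_codeword[OF measurable_fst] measurable_noise assms)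
  show ?thesis unfolding confusable_def by measurable
qed

lemma emeasure_code_noise:
  assumes "0 < s" "Measurable.pred (code_noise n J s) Q"
  shows "emeasure (code_noise n J s) {w \<in> space (code_noise n J s). Q w} =
      (\<integral>\<^sup>+c. \<integral>\<^sup>+z. indicator {w. Q w} (c, z) \<partial>white_noise n s \<partial>codebook n J)"
proof -
  interpret W: prob_space "white_noise n s" by (rule prob_space_white_noise[OF assms(1)])
  have "emeasure (code_noise n J s) {w \<in> space (code_noise n J s). Q w} =
      (\<integral>\<^sup>+w. indicator {w. Q w} w \<partial>code_noise n J s)"
  proof -
    have "(\<integral>\<^sup>+w. indicator {w. Q w} w \<partial>code_noise n J s) =
        (\<integral>\<^sup>+w. indicator {w \<in> space (code_noise n J s). Q w} w \<partial>code_noise n J s)"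
      by (intro nn_integral_cong) (simp add: indicator_def)
    with assms(2) show ?thesis by simp
  qed
  also have "\<dots> = (\<integral>\<^sup>+c. \<integral>\<^sup>+z. indicator {w. Q w} (c, z) \<partial>white_noise n s \<partial>codebook n J)"
    using assms(2) by (subst W.nn_integral_fst[symmetric]) (auto simp: indicator_def)
  finally show ?thesis .
qed

text \<open>Where the amplitude is nonzero the competing index differs from the true one, so the
  competing codewords are independent of the output. With the noise as outer variable, the two
  competing codewords are integrated while the rest of the codebook is frozen, and the bound for
  wrong codewords applies.\<close>

lemma confusable_prob:
  assumes s: "0 < s" and J: "finite J" "Inl m1 \<in> J" "Inr m2 \<in> J" "Inl m1' \<in> J" "Inr m2' \<in> J"
    and ne: "a = 0 \<or> m1' \<noteq> m1" "b = 0 \<or> m2' \<noteq> m2"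
  defines "S \<equiv> a\<^sup>2 + b\<^sup>2 + s\<^sup>2"
  shows "emeasure (code_noise n J s) {w \<in> space (code_noise n J s). confusable n a b t \<tau> m1 m2 m1'
      m2' w} \<le>
    ennreal (exp (\<tau> / (2 * s\<^sup>2) - t / (2 * S) - ln (S / s\<^sup>2) / 2) ^ n)" (is "_ \<le> ?K")
proof -
  interpret W: prob_space "white_noise n s" by (rule prob_space_white_noise[OF s])
  interpret C: prob_space "codebook n J" by (rule prob_space_codebook)
  interpret CW: pair_prob_space "codebook n J" "white_noise n s" ..
  let ?Q = "{w. confusable n a b t \<tau> m1 m2 m1' m2' w}"
  have m[measurable]: "Measurable.pred (code_noise n J s) (confusable n a b t \<tau> m1 m2 m1' m2')"
    by (rule pred_confusable[OF J(2-)])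
  have Qm: "(\<lambda>w. indicator ?Q w :: ennreal) \<in> borel_measurable (code_noise n J s)"
    by (simp add: indicator_def)
  have "emeasure (code_noise n J s) {w \<in> space (code_noise n J s). confusable n a b t \<tau> m1 m2 m1'
      m2' w} =
     (\<integral>\<^sup>+z. \<integral>\<^sup>+c. indicator ?Q (c, z) \<partial>codebook n J \<partial>white_noise n s)"
    unfolding emeasure_code_noise[OF s m] using Qm
        by (intro CW.Fubini'[symmetric]) (simp add: case_prod_beta')
  also have "\<dots> \<le> (\<integral>\<^sup>+z. ?K \<partial>white_noise n s)"
  proof (rule nn_integral_mono)
    fix z assume z: "z \<in> space (white_noise n s)"
    show "(\<integral>\<^sup>+c. indicator ?Q (c, z) \<partial>codebook n J) \<le> ?K"
    proof (rule codebook_integral_le[OF J(1) J(4,5)])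
      show "(\<lambda>c. indicator ?Q (c, z) :: ennreal) \<in> borel_measurable (codebook n J)"
        using measurable_compose[OF measurable_Pair2'[OF z] Qm] .
      fix c :: "nat + nat \<Rightarrow> nat \<Rightarrow> real"
      let ?u = "\<lambda>i. mix a b c m1 m2 i + z i"
      \<comment> \<open>Overwriting the competing codewords leaves the transmitted signal unchanged:
        each overwritten index is either foreign to it or enters with amplitude 0.\<close>
      have same: "mix a b (c(Inl m1' := x, Inr m2' := y)) m1 m2 = mix a b c m1 m2" for x y
        using ne by (auto simp: mix_def)
      have "(\<integral>\<^sup>+x. \<integral>\<^sup>+y. indicator ?Q (c(Inl m1' := x, Inr m2' :=
          y), z) \<partial>white_noise n 1 \<partial>white_noise n 1) =
        (\<integral>\<^sup>+x. \<integral>\<^sup>+y. indicator {v. real n * t \<le> nsq n ?u \<and> nsq n v \<le>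
            real n * \<tau>} (\<lambda>i. ?u i - a * x i - b * y i)
        \<partial>white_noise n 1 \<partial>white_noise n 1)"
        by (intro nn_integral_cong) (simp add: indicator_def confusable_def same,
            simp add: mix_def algebra_simps)
      also have "\<dots> \<le> ?K" unfolding S_def by (rule wrong_codeword_bound[OF s])
      finally show "(\<integral>\<^sup>+x. \<integral>\<^sup>+y. indicator ?Q (c(Inl m1' := x, Inr m2' :=
          y), z) \<partial>white_noise n 1 \<partial>white_noise n 1) \<le> ?K" .
    qed simp
  qed
  also have "\<dots> = ?K" by (simp add: W.emeasure_space_1)
  finally show ?thesis .
qed

lemma power_violation_prob:
  assumes t: "a\<^sup>2 + b\<^sup>2 < P \<or> a\<^sup>2 + b\<^sup>2 = 0 \<and> 0 \<le> P" and s: "0 < s"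
  obtains r where "0 \<le> r" "r < 1"
    "\<And>n J m1 m2. finite J \<Longrightarrow> Inl m1 \<in> J \<Longrightarrow> Inr m2 \<in> J \<Longrightarrow>
      emeasure (code_noise n J s) {w \<in> space (code_noise n J s). real n *
          P < nsq n (mix a b (fst w) m1 m2)} \<le> ennreal (r ^ n)"
proof -
  interpret W: prob_space "white_noise n s" for n by (rule prob_space_white_noise[OF s])
  obtain r where r: "0 \<le> r" "r < 1"
    "\<And>n. (\<integral>\<^sup>+x. \<integral>\<^sup>+y. indicator {x. real n * P < nsq n x} (\<lambda>i. a * x i + b * y i)
        \<partial>white_noise n 1 \<partial>white_noise n 1) \<le> ennreal (r ^ n)"
    using codeword_upper_tail[OF t] by blast
  show ?thesis
  proof (rule that[OF r(1,2)])
    fix n and J :: "(nat + nat) set" and m1 m2 assume J: "finite J" "Inl m1 \<in> J" "Inr m2 \<in> J"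
    have m[measurable]: "(\<lambda>w. nsq n (mix a b (f w) m1 m2)) \<in> borel_measurable M"
        if "f \<in> M \<rightarrow>\<^sub>M codebook n J" for f M
      using measurable_nsq_mix[OF that J(2,3), of "\<lambda>_ _. 0" a b] by simp
    have m1: "Measurable.pred (code_noise n J s) (\<lambda>w. real n * P < nsq n (mix a b (fst w) m1 m2))"
      by measurable
    have "emeasure (code_noise n J s) {w \<in> space (code_noise n J s). real n *
        P < nsq n (mix a b (fst w) m1 m2)} =
      (\<integral>\<^sup>+c. indicator {c. real n * P < nsq n (mix a b c m1 m2)} c \<partial>codebook n J)"
      unfolding emeasure_code_noise[OF s m1]
      by (intro nn_integral_cong) (simp add: indicator_def W.emeasure_space_1)
    also have "\<dots> \<le> ennreal (r ^ n)"
    proof (rule codebook_integral_le[OF J])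
      have "(\<lambda>c. nsq n (mix a b c m1 m2)) \<in> borel_measurable (codebook n J)" by (rule m) simp
      then show "(\<lambda>c. indicator {c. real n * P < nsq n (mix a b c m1 m2)} c :: ennreal) \<in>
          borel_measurable (codebook n J)"
        unfolding indicator_def by measurable
      fix c :: "nat + nat \<Rightarrow> nat \<Rightarrow> real"
      show "(\<integral>\<^sup>+x. \<integral>\<^sup>+y. indicator {c. real n * P < nsq n (mix a b c m1 m2)} (c(Inl m1 :=
          x, Inr m2 := y))
         \<partial>white_noise n 1 \<partial>white_noise n 1) \<le> ennreal (r ^ n)"
        using r(3)[of n] by (simp add: mix_def indicator_def)
    qed simp
    finally show "emeasure (code_noise n J s) {w \<in> space (code_noise n J s). real n *
        P < nsq n (mix a b (fst w) m1 m2)} \<le> ennreal (r ^ n)" .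
  qed
qed

lemma atypical_output_prob:
  assumes s: "0 < s" and t: "t < a\<^sup>2 + b\<^sup>2 + s\<^sup>2"
  obtains r where "0 \<le> r" "r < 1"
    "\<And>n J m1 m2. finite J \<Longrightarrow> Inl m1 \<in> J \<Longrightarrow> Inr m2 \<in> J \<Longrightarrow>
      emeasure (code_noise n J s) {w \<in> space (code_noise n J s). nsq n (\<lambda>i. mix a b (fst w) m1 m2
          i + snd w i) < real n * t} \<le> ennreal (r ^ n)"
proof -
  interpret W: prob_space "white_noise n s" for n by (rule prob_space_white_noise[OF s])
  obtain r where r: "0 \<le> r" "r < 1"
    "\<And>n. (\<integral>\<^sup>+x. \<integral>\<^sup>+y. \<integral>\<^sup>+z. indicator {x. nsq n x < real n * t} (\<lambda>i. a * x i + b * y i + z i)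
        \<partial>white_noise n s \<partial>white_noise n 1 \<partial>white_noise n 1) \<le> ennreal (r ^ n)"
    using output_lower_tail[OF s t] by blast
  show ?thesis
  proof (rule that[OF r(1,2)])
    fix n and J :: "(nat + nat) set" and m1 m2 assume J: "finite J" "Inl m1 \<in> J" "Inr m2 \<in> J"
    have m[measurable]: "(\<lambda>w. nsq n (\<lambda>i. mix a b (fst w) m1 m2 i +
        snd w i)) \<in> borel_measurable (code_noise n J s)"
      by (intro measurable_nsq_mix[OF measurable_fst] J measurable_noise)
    have m1: "Measurable.pred (code_noise n J s) (\<lambda>w. nsq n (\<lambda>i. mix a b (fst w) m1 m2 i +
        snd w i) < real n * t)"
      by measurable
    show "emeasure (code_noise n J s) {w \<in> space (code_noise n J s). nsq n (\<lambda>i. mix a b (fst w) m1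
        m2 i + snd w i) < real n * t} \<le> ennreal (r ^ n)"
      unfolding emeasure_code_noise[OF s m1]
    proof (rule codebook_integral_le[OF J])
      have "(\<lambda>w. indicator {w. nsq n (\<lambda>i. mix a b (fst w) m1 m2 i + snd w i) < real n *
          t} w :: ennreal) \<in> borel_measurable (code_noise n J s)"
        unfolding indicator_def by measurable
      then show "(\<lambda>c. \<integral>\<^sup>+z. indicator {w. nsq n (\<lambda>i. mix a b (fst w) m1 m2 i + snd w i) < real n *
          t} (c, z) \<partial>white_noise n s) \<in> borel_measurable (codebook n J)"
        by (rule W.borel_measurable_nn_integral_fst)
      fix c :: "nat + nat \<Rightarrow> nat \<Rightarrow> real"
      show "(\<integral>\<^sup>+x. \<integral>\<^sup>+y. \<integral>\<^sup>+z. indicator {w. nsq n (\<lambda>i. mix a b (fst w) m1 m2 i +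
          snd w i) < real n * t} (c(Inl m1 := x, Inr m2 := y), z)
         \<partial>white_noise n s \<partial>white_noise n 1 \<partial>white_noise n 1) \<le> ennreal (r ^ n)"
        using r(3)[of n] by (simp add: mix_def indicator_def)
    qed simp
  qed
qed

lemma noise_upper_tail_prob:
  assumes s: "0 < s" and t: "s\<^sup>2 < t"
  obtains r where "0 \<le> r" "r < 1"
    "\<And>n J. emeasure (code_noise n J s) {w \<in> space (code_noise n J s). real n *
        t < nsq n (snd w)} \<le> ennreal (r ^ n)"
proof -
  obtain r where r: "0 \<le> r" "r < 1"
    "\<And>n. (\<integral>\<^sup>+z. indicator {z. real n * t < nsq n z} z \<partial>white_noise n s) \<le> ennreal (r ^ n)"
    using white_noise_upper_tail[OF s t] by blast
  show ?thesis
  proof (rule that[OF r(1,2)])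
    fix n and J :: "(nat + nat) set"
    interpret C: prob_space "codebook n J" by (rule prob_space_codebook)
    have [measurable]: "(\<lambda>w. nsq n (snd w)) \<in> borel_measurable (code_noise n J s)"
      by (intro measurable_nsq measurable_noise)
    have m: "Measurable.pred (code_noise n J s) (\<lambda>w. real n * t < nsq n (snd w))" by measurable
    show "emeasure (code_noise n J s) {w \<in> space (code_noise n J s). real n * t < nsq n (snd w)} \<le>
        ennreal (r ^ n)"
      unfolding emeasure_code_noise[OF s m] using r(3)[of n]
          by (simp add: indicator_def C.emeasure_space_1)
  qed
qed

text \<open>The third condition belongs to the helper, which transmits the negative of
  \<open>mix a1 a2\<close>. The event depends on the codebook alone, not on the noise.\<close>

definition violation ::
  "nat \<Rightarrow> real \<Rightarrow> real \<Rightarrow> real \<Rightarrow> real \<Rightarrow> real \<Rightarrow> nat \<times> nat \<Rightarrow> (nat + nat \<Rightarrow> nat \<Rightarrow> real) \<Rightarrow> bool" where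
  "violation n P1 P2 P3 a1 a2 m c \<longleftrightarrow>
    real n * P1 < nsq n (mix a1 0 c (fst m) (snd m)) \<or>
    real n * P2 < nsq n (mix 0 a2 c (fst m) (snd m)) \<or>
    real n * P3 < nsq n (mix a1 a2 c (fst m) (snd m))"

text \<open>Every error of the distance decoder is a \<open>miss\<close>: the true signal is too far from the output,
    or
  another one is too close.\<close>

definition miss ::
  "nat \<Rightarrow> real \<Rightarrow> real \<Rightarrow> real \<Rightarrow> (nat \<times> nat) set \<Rightarrow> nat \<times> nat \<Rightarrow>
    (nat + nat \<Rightarrow> nat \<Rightarrow> real) \<times> (nat \<Rightarrow> real) \<Rightarrow> bool" where
  "miss n b1 b2 \<tau> M m w \<longleftrightarrow> real n * \<tau> < nsq n (snd w) \<or>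
    (\<exists>m'\<in>M - {m}. nsq n (\<lambda>i. mix b1 b2 (fst w) (fst m) (snd m) i + snd w i -
      mix b1 b2 (fst w) (fst m') (snd m') i) \<le> real n * \<tau>)"

lemma pred_violation:
  assumes "Inl (fst m) \<in> J" "Inr (snd m) \<in> J"
  shows "Measurable.pred (code_noise n J s) (\<lambda>w. violation n P1 P2 P3 a1 a2 m (fst w))"
proof -
  have [measurable]: "(\<lambda>w. nsq n (mix a b (fst w) (fst m) (snd m))) \<in> borel_measurable (code_noise
      n J s)" for a b
    using measurable_nsq_mix[OF measurable_fst assms, where g = "\<lambda>_ _. 0" and a = a and b = b]
        by simp
  show ?thesis unfolding violation_def by measurable
qed

lemma pred_miss:
  assumes "finite M" "\<And>m. m \<in> M \<Longrightarrow> Inl (fst m) \<in> J \<and> Inr (snd m) \<in> J" "m \<in> M"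
  shows "Measurable.pred (code_noise n J s) (miss n b1 b2 \<tau> M m)"
proof -
  have [measurable]: "(\<lambda>w. nsq n (snd w)) \<in> borel_measurable (code_noise n J s)"
    by (intro measurable_nsq measurable_noise)
  have [measurable]: "(\<lambda>w. nsq n (\<lambda>i. mix b1 b2 (fst w) (fst m) (snd m) i + snd w i -
      mix b1 b2 (fst w) (fst m') (snd m') i)) \<in> borel_measurable (code_noise n J s)"
          if "m' \<in> M - {m}" for m'
    unfolding mix_def using assms(2)[of m'] assms(2)[OF assms(3)] that
    by (intro measurable_nsq borel_measurable_add borel_measurable_diff borel_measurable_times
        borel_measurable_const
      measurable_codeword[OF measurable_fst] measurable_noise) auto
  have "finite (M - {m})" using assms(1) by simp
  then have "Measurable.pred (code_noise n J s) (\<lambda>w. \<exists>m'\<in>M - {m}. nsq n (\<lambda>i. mix b1 b2 (fst w)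
      (fst m) (snd m) i + snd w i -
      mix b1 b2 (fst w) (fst m') (snd m') i) \<le> real n * \<tau>)"
    by (intro pred_intros_finite) auto
  then show ?thesis unfolding miss_def by measurable
qed

section \<open>Decoding by distance\<close>

lemma nsq_cong: "(\<And>i. i < n \<Longrightarrow> x i = y i) \<Longrightarrow> nsq n x = nsq n y"
  by (simp add: nsq_def)

text \<open>Uniqueness within the radius is part of the test, so the choice has at most one
  candidate. The fallback \<open>(1, 1)\<close> is a legal message pair for all nonnegative rates,
  which keeps the values inside the message set.\<close>

definition distance_decoder ::
  "nat \<Rightarrow> real \<Rightarrow> (nat \<times> nat) set \<Rightarrow> (nat \<times> nat \<Rightarrow> nat \<Rightarrow> real) \<Rightarrow> (nat \<Rightarrow> real) \<Rightarrow> nat \<times> nat" where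
  "distance_decoder n r M x y =
    (let U = (\<lambda>m. nsq n (\<lambda>i. y i - x m i) \<le> r \<and> (\<forall>m'\<in>M - {m}. \<not> nsq n (\<lambda>i. y i - x m' i) \<le> r))
     in if \<exists>m\<in>M. U m then SOME m. m \<in> M \<and> U m else (1, 1))"

lemma distance_decoder_eq:
  assumes "m \<in> M" "nsq n (\<lambda>i. y i - x m i) \<le> r"
    and "\<And>m'. m' \<in> M \<Longrightarrow> m' \<noteq> m \<Longrightarrow> \<not> nsq n (\<lambda>i. y i - x m' i) \<le> r"
  shows "distance_decoder n r M x y = m"
proof -
  have "distance_decoder n r M x y = (SOME m. m \<in> M \<and> nsq n (\<lambda>i. y i - x m i) \<le> r \<and>
      (\<forall>m'\<in>M - {m}. \<not> nsq n (\<lambda>i. y i - x m' i) \<le> r))"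
  proof -
    have "\<exists>m\<in>M. nsq n (\<lambda>i. y i - x m i) \<le> r \<and> (\<forall>m'\<in>M - {m}. \<not> nsq n (\<lambda>i. y i - x m' i) \<le> r)"
      using assms by (intro bexI[of _ m]) auto
    then show ?thesis unfolding distance_decoder_def Let_def by (rule if_P)
  qed
  also have "\<dots> = m" using assms by (intro some_equality) auto
  finally show ?thesis .
qed

text \<open>Since at most one message passes the test \<open>U\<close>, the preimage of
  \<open>m\<close> is the set where \<open>m\<close> passes, enlarged for the default pair by the
  set where no message passes. This eliminates the choice operator.\<close>

lemma measurable_distance_decoder:
  assumes "finite M" "(1, 1) \<in> M"
  shows "distance_decoder n r M x \<in> seq_space n \<rightarrow>\<^sub>M count_space M"
proof -
  define U where "U y m \<longleftrightarrow> nsq n (\<lambda>i. y i - x m i) \<le> r \<and> (\<forall>m'\<in>M - {m}. \<not> nsq n (\<lambda>i. y i - x m' i) \<le>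
      r)" for y m
  have unique: "m = m'" if "m \<in> M" "m' \<in> M" "U y m" "U y m'" for m m' y
    using that by (auto simp: U_def)
  have dec: "distance_decoder n r M x y = (if \<exists>m\<in>M. U y m then SOME m. m \<in> M \<and> U y m else (1, 1))"
      for y
    unfolding distance_decoder_def Let_def U_def by (rule refl)
  have eq: "distance_decoder n r M x y = m \<longleftrightarrow> U y m \<or> (m = (1, 1) \<and> \<not> (\<exists>m\<in>M. U y m))" if "m \<in> M"
      for m y
  proof (cases "\<exists>m\<in>M. U y m")
    case True
    then obtain m0 where m0: "m0 \<in> M" "U y m0" by blast
    then have "(SOME m. m \<in> M \<and> U y m) = m0" using unique by (intro some_equality) blast+
    then have "distance_decoder n r M x y = m0" using True by (simp add: dec)
    then show ?thesis using True m0 that unique[of m0 m y] by auto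
  qed (auto simp: dec that)
  have [measurable]: "(\<lambda>y. nsq n (\<lambda>i. y i - x m i)) \<in> borel_measurable (seq_space n)" for m
    by (intro measurable_nsq) simp
  have "finite (M - {m})" for m using assms(1) by simp
  then have U[measurable]: "Measurable.pred (seq_space n) (\<lambda>y. U y m)" for m
    unfolding U_def by (intro pred_intros_logic pred_intros_finite) measurable
  have ex[measurable]: "Measurable.pred (seq_space n) (\<lambda>y. \<exists>m\<in>M. U y m)"
    using assms(1) by (intro pred_intros_finite) measurable
  show ?thesis
  proof (subst measurable_count_space_eq2[OF assms(1)], intro conjI ballI)
    have "distance_decoder n r M x y \<in> M" for y
      using assms(2) by (auto simp: dec intro: someI2_ex)
    then show "distance_decoder n r M x \<in> space (seq_space n) \<rightarrow> M" by auto
    fix m assume m: "m \<in> M"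
    have "distance_decoder n r M x -` {m} \<inter> space (seq_space n) =
        {y \<in> space (seq_space n). U y m \<or> (m = (1, 1) \<and> \<not> (\<exists>m\<in>M. U y m))}"
      unfolding eq[OF m, symmetric] by auto
    also have "\<dots> \<in> sets (seq_space n)" by measurable
    finally show "distance_decoder n r M x -` {m} \<inter> space (seq_space n) \<in> sets (seq_space n)" .
  qed
qed

text \<open>If every codebook exceeded the bound, so would the average over codebooks, which is at
  most \<open>e * card M\<close>. The factor 2 makes this a strict contradiction. Summing over
  messages before choosing the codebook gives one codebook that is good on average for all of
  them.\<close>

lemma exists_good_codebook:
  assumes s: "0 < s" and e: "0 < (e::real)" and M: "finite M" "M \<noteq> {}"
    and Q: "\<And>m. m \<in> M \<Longrightarrow> Measurable.pred (code_noise n J s) (Q m)"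
    and le: "\<And>m. m \<in> M \<Longrightarrow> emeasure (code_noise n J s) {w \<in> space (code_noise n J s). Q m w} \<le>
        ennreal e"
  obtains c where "c \<in> space (codebook n J)"
    "(\<Sum>m\<in>M. measure (white_noise n s) {z \<in> space (white_noise n s). Q m (c, z)}) \<le>
        2 * e * real (card M)"
proof -
  interpret W: prob_space "white_noise n s" by (rule prob_space_white_noise[OF s])
  interpret C: prob_space "codebook n J" by (rule prob_space_codebook)
  let ?f = "\<lambda>c. \<Sum>m\<in>M. measure (white_noise n s) {z \<in> space (white_noise n s). Q m (c, z)}"
  have f: "ennreal (?f c) = (\<Sum>m\<in>M. \<integral>\<^sup>+z. indicator {w. Q m w} (c, z) \<partial>white_noise n s)"
    if c: "c \<in> space (codebook n J)" for c
  proof -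
    have "ennreal (measure (white_noise n s) {z \<in> space (white_noise n s). Q m (c, z)}) =
        (\<integral>\<^sup>+z. indicator {w. Q m w} (c, z) \<partial>white_noise n s)" if m: "m \<in> M" for m
    proof -
      have "{z \<in> space (white_noise n s). Q m (c, z)} \<in> sets (white_noise n s)"
        using measurable_compose[OF measurable_Pair1'[OF c] Q[OF m]] by (simp add: pred_def)
      then have "ennreal (measure (white_noise n s) {z \<in> space (white_noise n s). Q m (c, z)}) =
         (\<integral>\<^sup>+z. indicator {z \<in> space (white_noise n s). Q m (c, z)} z \<partial>white_noise n s)"
        by (simp add: W.emeasure_eq_measure)
      also have "\<dots> = (\<integral>\<^sup>+z. indicator {w. Q m w} (c, z) \<partial>white_noise n s)"
        by (intro nn_integral_cong) (simp add: indicator_def)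
      finally show ?thesis .
    qed
    then show ?thesis by (simp add: sum_ennreal[symmetric])
  qed
  have "\<exists>c\<in>space (codebook n J). ?f c \<le> 2 * e * real (card M)"
  proof (rule ccontr)
    assume "\<not> ?thesis"
    then have gt: "2 * e * real (card M) \<le> ?f c" if "c \<in> space (codebook n J)" for c using that
        by force
    have "ennreal (2 * e * real (card M)) = (\<integral>\<^sup>+c. ennreal (2 * e * real (card M)) \<partial>codebook n J)"
      by (simp add: C.emeasure_space_1)
    also have "\<dots> \<le> (\<integral>\<^sup>+c. (\<Sum>m\<in>M. \<integral>\<^sup>+z. indicator {w. Q m w} (c, z) \<partial>white_noise n s) \<partial>codebook n J)"
    proof (rule nn_integral_mono)
      fix c assume c: "c \<in> space (codebook n J)"
      show "ennreal (2 * e * real (card M)) \<le> (\<Sum>m\<in>M. \<integral>\<^sup>+z. indicator {w. Q m w} (c,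
          z) \<partial>white_noise n s)"
        unfolding f[OF c, symmetric] by (rule ennreal_leI[OF gt[OF c]])
    qed
    also have "\<dots> = (\<Sum>m\<in>M. \<integral>\<^sup>+c. \<integral>\<^sup>+z. indicator {w. Q m w} (c, z) \<partial>white_noise n s \<partial>codebook n J)"
    proof (rule nn_integral_sum)
      fix m assume "m \<in> M"
      then have "(\<lambda>w. indicator {w. Q m w} w :: ennreal) \<in> borel_measurable (code_noise n J s)"
        using Q by (simp add: indicator_def)
      then show "(\<lambda>c. \<integral>\<^sup>+z. indicator {w. Q m w} (c,
          z) \<partial>white_noise n s) \<in> borel_measurable (codebook n J)"
        by (rule W.borel_measurable_nn_integral_fst)
    qed
    also have "\<dots> = (\<Sum>m\<in>M. emeasure (code_noise n J s) {w \<in> space (code_noise n J s). Q m w})"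
      by (intro sum.cong refl emeasure_code_noise[symmetric] s Q)
    also have "\<dots> \<le> (\<Sum>m\<in>M. ennreal e)" by (intro sum_mono le)
    also have "\<dots> = ennreal (e * real (card M))" using e
        by (simp add: ennreal_mult'' ennreal_of_nat_eq_real_of_nat mult.commute)
    finally have "2 * e * real (card M) \<le> e * real (card M)" using e by simp
    then show False using e M by (simp add: card_gt_0_iff)
  qed
  then show ?thesis using that by blast
qed

text \<open>For the chosen codebook, \<open>\<beta> m\<close> is the noise probability of the bad
  event of message pair \<open>m\<close>. Without a violation the warden's signal is exactly 0 and
  decoding fails only on a miss; with a violation \<open>\<beta> m\<close> is 1. Hence the average
  of \<open>\<beta>\<close> dominates both the error probability and the total variation.\<close>

lemma random_code:
  assumes s: "0 < \<sigma>B" "0 < \<sigma>E" and P: "0 \<le> P1" "0 \<le> P2" "0 \<le> P3" and R: "0 \<le> R1" "0 \<le> R2"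
    and n: "0 < n" and e: "0 < e"
  defines "M \<equiv> messages n R1 \<times> messages n R2" and "J \<equiv> Inl ` messages n R1 \<union> Inr ` messages n R2"
  assumes le: "\<And>m. m \<in> M \<Longrightarrow> emeasure (code_noise n J \<sigma>B) {w \<in> space (code_noise n J \<sigma>B).
      violation n P1 P2 P3 a1 a2 m (fst w) \<or> miss n ((1 - h) * a1) ((1 - h) * a2) \<tau> M m w} \<le>
          ennreal e"
  obtains c where "is_code P1 P2 P3 R1 R2 n c" "error_prob h \<sigma>B \<sigma>E R1 R2 n c \<le> 2 * e"
    "tv_dist (warden_law \<sigma>B \<sigma>E R1 R2 n c) (white_noise n \<sigma>E) \<le> 2 * e"
proof -
  interpret W: prob_space "white_noise n \<sigma>B" by (rule prob_space_white_noise[OF s(1)])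
  let ?b1 = "(1 - h) * a1" and ?b2 = "(1 - h) * a2"
  define Q where "Q m w \<longleftrightarrow> violation n P1 P2 P3 a1 a2 m (fst w) \<or> miss n ?b1 ?b2 \<tau> M m w" for m w
  have M: "finite M" "M \<noteq> {}" using R by (auto simp: M_def messages_nonempty)
  have one: "1 \<in> messages n R" if "0 \<le> R" for R
    using messages_nonempty[OF that, of n] by (auto simp: messages_def)
  then have M1: "(1, 1) \<in> M" using R by (auto simp: M_def)
  have mJ: "Inl (fst m) \<in> J" "Inr (snd m) \<in> J" if "m \<in> M" for m using that
      by (auto simp: M_def J_def)
  have Qm: "Measurable.pred (code_noise n J \<sigma>B) (Q m)" if "m \<in> M" for m
    unfolding Q_def using pred_violation[OF mJ[OF that]] pred_miss[OF M(1) _ that, of J] mJ by simp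
  obtain c where c: "c \<in> space (codebook n J)"
    and sum: "(\<Sum>m\<in>M. measure (white_noise n \<sigma>B) {z \<in> space (white_noise n \<sigma>B). Q m (c, z)}) \<le>
        2 * e * real (card M)"
    by (rule exists_good_codebook[OF s(1) e M Qm]) (use le in \<open>simp_all add: Q_def\<close>)
  define \<beta> where "\<beta> m = measure (white_noise n \<sigma>B) {z \<in> space (white_noise n \<sigma>B). Q m (c, z)}" for m
  have Qc: "{z \<in> space (white_noise n \<sigma>B). Q m (c, z)} \<in> sets (white_noise n \<sigma>B)" if "m \<in> M" for m
    using measurable_compose[OF measurable_Pair1'[OF c] Qm[OF that]] by (simp add: pred_def)
  define x1 where "x1 m1 = (if nsq n (\<lambda>i. a1 * c (Inl m1) i) \<le>
      real n * P1 then \<lambda>i. a1 * c (Inl m1) i else (\<lambda>_. 0))" for m1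
  define x2 where "x2 m2 = (if nsq n (\<lambda>i. a2 * c (Inr m2) i) \<le>
      real n * P2 then \<lambda>i. a2 * c (Inr m2) i else (\<lambda>_. 0))" for m2
  \<comment> \<open>The helper cancels what the other two actually send, after their own replacement
    by 0, and checks its own constraint on that.\<close>
  define x3 where "x3 m1 m2 = (if nsq n (\<lambda>i. - (x1 m1 i + x2 m2 i)) \<le>
      real n * P3 then \<lambda>i. - (x1 m1 i + x2 m2 i) else (\<lambda>_. 0))" for m1 m2
  define x where "x m = mix ?b1 ?b2 c (fst m) (snd m)" for m
  define C where "C = \<lparr>enc1 = x1, enc2 = x2, enc3 = x3, dec = distance_decoder n (real n * \<tau>) M x\<rparr>"
  have zero: "nsq n (\<lambda>_. 0) = 0" by (simp add: nsq_def)
  have neg: "nsq n (\<lambda>i. - y i) = nsq n y" for y by (simp add: nsq_def)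
  have dec: "dec C \<in> seq_space n \<rightarrow>\<^sub>M count_space (messages n R1 \<times> messages n R2)"
    using measurable_distance_decoder[OF M(1) M1] by (simp add: C_def M_def)
  have code: "is_code P1 P2 P3 R1 R2 n C"
    unfolding is_code_def using dec P n
    by (auto simp: C_def power_ok_iff x1_def x2_def x3_def zero)
  have sig: "signal_E C (fst m) (snd m) = (\<lambda>_. 0)" "signal_B h C (fst m) (snd m) = x m"
    if "\<not> violation n P1 P2 P3 a1 a2 m c" for m
  proof -
    have "nsq n (\<lambda>i. a1 * c (Inl (fst m)) i) \<le> real n * P1" "nsq n (\<lambda>i. a2 * c (Inr (snd m)) i) \<le>
        real n * P2"
      "nsq n (\<lambda>i. a1 * c (Inl (fst m)) i + a2 * c (Inr (snd m)) i) \<le> real n * P3"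
      using that by (auto simp: violation_def mix_def)
    then have eqs: "x1 (fst m) = (\<lambda>i. a1 * c (Inl (fst m)) i)" "x2 (snd m) =
        (\<lambda>i. a2 * c (Inr (snd m)) i)"
      "x3 (fst m) (snd m) = (\<lambda>i. - (a1 * c (Inl (fst m)) i + a2 * c (Inr (snd m)) i))"
      by (simp_all add: x1_def x2_def x3_def neg[of "\<lambda>i. _ i + _ i"] del: minus_add_distrib)
    show "signal_E C (fst m) (snd m) = (\<lambda>_. 0)" "signal_B h C (fst m) (snd m) = x m"
      unfolding signal_E_def signal_B_def C_def mac_code.simps eqs x_def mix_def
      by (simp_all add: fun_eq_iff algebra_simps)
  qed
  \<comment> \<open>A violation holds for every noise sequence or for none, so it has conditional
    probability 1 and the trivial bounds below suffice.\<close>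
  have viol: "\<beta> m = 1" if "violation n P1 P2 P3 a1 a2 m c" for m
    using that W.prob_space by (simp add: \<beta>_def Q_def)
  have N: "real (card M) = real (card (messages n R1)) * real (card (messages n R2))"
    by (simp add: M_def card_cartesian_product)
  have N0: "0 < real (card M)" using M by (simp add: card_gt_0_iff)
  have avg: "(\<Sum>m\<in>M. \<beta> m) / real (card M) \<le> 2 * e"
    using sum N0 by (simp add: \<beta>_def pos_divide_le_eq)
  have "measure (shifted_noise n \<sigma>B (signal_B h C (fst m) (snd m))) {y \<in> space (seq_space n). dec
      C y \<noteq> m} \<le> \<beta> m"
    if m: "m \<in> M" for m
  proof (cases "violation n P1 P2 P3 a1 a2 m c")
    case True
    interpret prob_space "shifted_noise n \<sigma>B (signal_B h C (fst m) (snd m))"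
        by (rule prob_space_shifted_noise[OF s(1)])
    show ?thesis using viol[OF True] by simp
  next
    case False
    have A: "{y \<in> space (seq_space n). dec C y \<noteq> m} \<in> sets (seq_space n)"
    proof -
      have "dec C -` (M - {m}) \<inter> space (seq_space n) \<in> sets (seq_space n)"
        by (rule measurable_sets[OF dec]) (auto simp: M_def)
      also have "dec C -` (M - {m}) \<inter> space (seq_space n) = {y \<in> space (seq_space n). dec C y \<noteq> m}"
        using measurable_space[OF dec] by (auto simp: M_def)
      finally show ?thesis .
    qed
    have "{z \<in> space (seq_space n). (\<lambda>i\<in>{..<n}. x m i +
        z i) \<in> {y \<in> space (seq_space n). dec C y \<noteq> m}}
       \<subseteq> {z \<in> space (white_noise n \<sigma>B). Q m (c, z)}"
    proof safe
      fix z assume z: "z \<in> space (seq_space n)" and ne: "dec C (\<lambda>i\<in>{..<n}. x m i + z i) \<noteq> m"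
      show "z \<in> space (white_noise n \<sigma>B)" using z by (simp add: space_white_noise)
      show "Q m (c, z)"
      proof (rule ccontr)
        assume "\<not> Q m (c, z)"
        then have nm: "nsq n z \<le> real n * \<tau>"
          "\<And>m'. m' \<in> M \<Longrightarrow> m' \<noteq> m \<Longrightarrow> \<not> nsq n (\<lambda>i. x m i + z i - x m' i) \<le> real n * \<tau>"
          by (auto simp: Q_def miss_def x_def)
        have sh: "nsq n (\<lambda>i. (\<lambda>i\<in>{..<n}. x m i + z i) i - x m' i) =
            nsq n (\<lambda>i. x m i + z i - x m' i)" for m'
          by (rule nsq_cong) simp
        \<comment> \<open>The distance from the output to the true signal is the noise energy, which
          is within the radius; every other signal lies beyond it.\<close>
        have "dec C (\<lambda>i\<in>{..<n}. x m i + z i) = m"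
          unfolding C_def mac_code.simps using nm m
              by (intro distance_decoder_eq) (simp_all only: sh, simp_all)
        with ne show False by simp
      qed
    qed
    then show ?thesis
      unfolding measure_shifted_noise[OF A] sig[OF False] \<beta>_def
      by (intro W.finite_measure_mono Qc[OF m])
  qed
  then have "(\<Sum>m\<in>M. measure (shifted_noise n \<sigma>B (signal_B h C (fst m) (snd m))) {y \<in> space
      (seq_space n). dec C y \<noteq> m}) / real (card M)
      \<le> (\<Sum>m\<in>M. \<beta> m) / real (card M)"
    by (intro divide_right_mono sum_mono) auto
  then have err: "error_prob h \<sigma>B \<sigma>E R1 R2 n C \<le> 2 * e"
    using avg unfolding error_prob_eq[OF s R dec]
    by (simp add: N[symmetric] sum.cartesian_product case_prod_beta M_def[symmetric])
  have tv: "tv_dist (warden_law \<sigma>B \<sigma>E R1 R2 n C) (white_noise n \<sigma>E) \<le> 2 * e"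
    unfolding tv_dist_def
  proof (rule cSUP_least)
    show "sets (warden_law \<sigma>B \<sigma>E R1 R2 n C) \<noteq> {}" using sets.top by blast
    fix A assume "A \<in> sets (warden_law \<sigma>B \<sigma>E R1 R2 n C)"
    then have A: "A \<in> sets (seq_space n)" by (simp add: warden_law_def)
    let ?d = "\<lambda>m. measure (shifted_noise n \<sigma>E (signal_E C (fst m) (snd m))) A - measure
        (white_noise n \<sigma>E) A"
    interpret WE: prob_space "white_noise n \<sigma>E" by (rule prob_space_white_noise[OF s(2)])
    have "\<bar>?d m\<bar> \<le> \<beta> m" for m
    proof (cases "violation n P1 P2 P3 a1 a2 m c")
      case True
      interpret S: prob_space "shifted_noise n \<sigma>E (signal_E C (fst m) (snd m))"
          by (rule prob_space_shifted_noise[OF s(2)])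
      show ?thesis using viol[OF True] S.prob_le_1[of A] WE.prob_le_1[of A] 
          measure_nonneg[of "white_noise n \<sigma>E" A] measure_nonneg[of "shifted_noise n \<sigma>E (signal_E
              C (fst m) (snd m))" A]
        by linarith
    next
      case False
      \<comment> \<open>A zero shift followed by restriction is the identity on extensional
        sequences, so the warden's law given such a pair is the noise law itself.\<close>
      have "{z \<in> space (seq_space n). (\<lambda>i\<in>{..<n}. 0 + z i) \<in> A} = A"
      proof -
        have "(\<lambda>i\<in>{..<n}. 0 + z i) = z" if "z \<in> space (seq_space n)" for z
          using that by (auto simp: space_PiM PiE_def extensional_def fun_eq_iff)
        then show ?thesis using sets.sets_into_space[OF A] by auto
      qed
      then show ?thesis unfolding sig[OF False] measure_shifted_noise[OF A] by (simp add: \<beta>_def)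
    qed
    then have d: "(\<Sum>m\<in>M. \<bar>?d m\<bar>) \<le> (\<Sum>m\<in>M. \<beta> m)" by (intro sum_mono)
    have "measure (warden_law \<sigma>B \<sigma>E R1 R2 n C) A - measure (white_noise n \<sigma>E) A =
        (\<Sum>m\<in>M. ?d m) / real (card M)"
      unfolding measure_warden_law[OF s R A] using N0
      by (simp add: N[symmetric] sum.cartesian_product case_prod_beta M_def[symmetric]
          sum_subtractf field_simps)
    then have "\<bar>measure (warden_law \<sigma>B \<sigma>E R1 R2 n C) A - measure (white_noise n \<sigma>E) A\<bar> \<le>
        (\<Sum>m\<in>M. \<bar>?d m\<bar>) / real (card M)"
      by (simp add: abs_divide divide_right_mono sum_abs)
    also have "\<dots> \<le> (\<Sum>m\<in>M. \<beta> m) / real (card M)" by (intro divide_right_mono d) simp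
    also have "\<dots> \<le> 2 * e" by (rule avg)
    finally show "\<bar>measure (warden_law \<sigma>B \<sigma>E R1 R2 n C) A - measure (white_noise n \<sigma>E) A\<bar> \<le> 2 * e" .
  qed
  from that[OF code err tv] show ?thesis .
qed

section \<open>Events of exponentially small probability\<close>

definition msgs :: "real \<Rightarrow> real \<Rightarrow> nat \<Rightarrow> (nat \<times> nat) set" where
  "msgs R1 R2 n = messages n R1 \<times> messages n R2"

definition code_ensemble ::
  "real \<Rightarrow> real \<Rightarrow> real \<Rightarrow> nat \<Rightarrow> ((nat + nat \<Rightarrow> nat \<Rightarrow> real) \<times> (nat \<Rightarrow> real)) measure" where
  "code_ensemble s R1 R2 n = code_noise n (Inl ` messages n R1 \<union> Inr ` messages n R2) s"

text \<open>The constants are uniform over the message pairs. Measurability is included so that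
  unions can be bounded without side conditions, and \<open>K\<close> makes the notion closed under
  finite disjunctions.\<close>

definition exp_small ::
  "real \<Rightarrow> real \<Rightarrow> real \<Rightarrow>
    (nat \<Rightarrow> nat \<times> nat \<Rightarrow> (nat + nat \<Rightarrow> nat \<Rightarrow> real) \<times> (nat \<Rightarrow> real) \<Rightarrow> bool) \<Rightarrow> bool" where
  "exp_small s R1 R2 Q \<longleftrightarrow> (\<exists>K r. 0 \<le> K \<and> 0 \<le> r \<and> r < 1 \<and> (\<forall>n>0. \<forall>m\<in>msgs R1 R2 n.
     Measurable.pred (code_ensemble s R1 R2 n) (Q n m) \<and>
     emeasure (code_ensemble s R1 R2 n) {w \<in> space (code_ensemble s R1 R2 n). Q n m w} \<le>
         ennreal (K * r ^ n)))"

lemma exp_smallI: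
  assumes "0 \<le> r" "r < 1"
    and "\<And>n m. 0 < n \<Longrightarrow> m \<in> msgs R1 R2 n \<Longrightarrow> Measurable.pred (code_ensemble s R1 R2 n) (Q n m)"
    and "\<And>n m. 0 < n \<Longrightarrow> m \<in> msgs R1 R2 n \<Longrightarrow>
      emeasure (code_ensemble s R1 R2 n) {w \<in> space (code_ensemble s R1 R2 n). Q n m w} \<le>
          ennreal (r ^ n)"
  shows "exp_small s R1 R2 Q"
  unfolding exp_small_def using assms by - (rule exI[of _ 1], rule exI[of _ r], auto)

lemma exp_small_disj:
  assumes "exp_small s R1 R2 Q" "exp_small s R1 R2 Q'"
  shows "exp_small s R1 R2 (\<lambda>n m w. Q n m w \<or> Q' n m w)"
proof -
  from assms(1) obtain K r where K: "0 \<le> K" "0 \<le> r" "r < 1"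
    and Q: "\<And>n m. 0 < n \<Longrightarrow> m \<in> msgs R1 R2 n \<Longrightarrow> Measurable.pred (code_ensemble s R1 R2 n) (Q n m)"
      "\<And>n m. 0 < n \<Longrightarrow> m \<in> msgs R1 R2 n \<Longrightarrow>
      emeasure (code_ensemble s R1 R2 n) {w \<in> space (code_ensemble s R1 R2 n). Q n m w} \<le>
          ennreal (K * r ^ n)"
    unfolding exp_small_def by blast
  from assms(2) obtain K' r' where K': "0 \<le> K'" "0 \<le> r'" "r' < 1"
    and Q': "\<And>n m. 0 < n \<Longrightarrow> m \<in> msgs R1 R2 n \<Longrightarrow> Measurable.pred (code_ensemble s R1 R2 n) (Q' n m)"
      "\<And>n m. 0 < n \<Longrightarrow> m \<in> msgs R1 R2 n \<Longrightarrow>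
      emeasure (code_ensemble s R1 R2 n) {w \<in> space (code_ensemble s R1 R2 n). Q' n m w} \<le>
          ennreal (K' * r' ^ n)"
    unfolding exp_small_def by blast
  show ?thesis unfolding exp_small_def
  proof (rule exI[of _ "K + K'"], rule exI[of _ "max r r'"], intro conjI allI impI ballI)
    fix n :: nat and m assume n: "0 < n" and m: "m \<in> msgs R1 R2 n"
    let ?M = "code_ensemble s R1 R2 n"
    note [measurable] = Q(1)[OF n m] Q'(1)[OF n m]
    show "Measurable.pred ?M (\<lambda>w. Q n m w \<or> Q' n m w)" by measurable
    have "emeasure ?M {w \<in> space ?M. Q n m w \<or> Q' n m w} =
        emeasure ?M ({w \<in> space ?M. Q n m w} \<union> {w \<in> space ?M. Q' n m w})"
      by (rule arg_cong[where f = "emeasure ?M"]) auto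
    also have "\<dots> \<le> emeasure ?M {w \<in> space ?M. Q n m w} + emeasure ?M {w \<in> space ?M. Q' n m w}"
      by (rule emeasure_subadditive) measurable
    also have "\<dots> \<le> ennreal (K * r ^ n) + ennreal (K' * r' ^ n)"
      by (intro add_mono Q(2)[OF n m] Q'(2)[OF n m])
    also have "\<dots> \<le> ennreal ((K + K') * max r r' ^ n)"
      using K K' by (simp add: ennreal_plus[symmetric] distrib_right del: ennreal_plus)
        (intro ennreal_leI add_mono mult_left_mono power_mono; simp)
    finally show "emeasure ?M {w \<in> space ?M. Q n m w \<or> Q' n m w} \<le>
        ennreal ((K + K') * max r r' ^ n)" .
  qed (use K K' in auto)
qed

text \<open>The union bound of random coding: at most v^n competitors, each of probability at most
  w^n. The condition v w < 1 says that the rate stays below the exponent.\<close>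

lemma exp_small_bex:
  assumes r: "0 \<le> v" "0 \<le> w" "v * w < 1"
    and I: "\<And>n m. 0 < n \<Longrightarrow> m \<in> msgs R1 R2 n \<Longrightarrow> finite (I n m) \<and> real (card (I n m)) \<le> v ^ n"
    and Q: "\<And>n m i. 0 < n \<Longrightarrow> m \<in> msgs R1 R2 n \<Longrightarrow> i \<in> I n m \<Longrightarrow>
        Measurable.pred (code_ensemble s R1 R2 n) (Q n m i)"
    and le: "\<And>n m i. 0 < n \<Longrightarrow> m \<in> msgs R1 R2 n \<Longrightarrow> i \<in> I n m \<Longrightarrow>
      emeasure (code_ensemble s R1 R2 n) {x \<in> space (code_ensemble s R1 R2 n). Q n m i x} \<le>
          ennreal (w ^ n)"
  shows "exp_small s R1 R2 (\<lambda>n m x. \<exists>i\<in>I n m. Q n m i x)"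
proof (rule exp_smallI[of "v * w"])
  fix n m assume n: "0 < n" and m: "m \<in> msgs R1 R2 n"
  let ?M = "code_ensemble s R1 R2 n"
  have fin: "finite (I n m)" using I[OF n m] by simp
  show "Measurable.pred ?M (\<lambda>x. \<exists>i\<in>I n m. Q n m i x)"
    using fin Q[OF n m] by (intro pred_intros_finite) auto
  have "emeasure ?M {x \<in> space ?M. \<exists>i\<in>I n m. Q n m i x} =
      emeasure ?M (\<Union>i\<in>I n m. {x \<in> space ?M. Q n m i x})"
    by (rule arg_cong[where f = "emeasure ?M"]) auto
  also have "\<dots> \<le> (\<Sum>i\<in>I n m. emeasure ?M {x \<in> space ?M. Q n m i x})"
    using fin Q[OF n m] by (intro emeasure_subadditive_finite) auto
  also have "\<dots> \<le> (\<Sum>i\<in>I n m. ennreal (w ^ n))" by (intro sum_mono le n m)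
  also have "\<dots> = ennreal (real (card (I n m)) * w ^ n)"
    using r by (simp add: ennreal_mult'' ennreal_of_nat_eq_real_of_nat)
  also have "\<dots> \<le> ennreal ((v * w) ^ n)"
    unfolding power_mult_distrib using r I[OF n m] by (intro ennreal_leI mult_right_mono) auto
  finally show "emeasure ?M {x \<in> space ?M. \<exists>i\<in>I n m. Q n m i x} \<le> ennreal ((v * w) ^ n)" .
qed (use r in auto)

lemma exp_small_violation:
  assumes s: "0 < s"
    and a: "a1\<^sup>2 < P1 \<or> a1 = 0 \<and> 0 \<le> P1" "a2\<^sup>2 < P2 \<or> a2 = 0 \<and> 0 \<le> P2"
      "a1\<^sup>2 + a2\<^sup>2 < P3 \<or> a1\<^sup>2 + a2\<^sup>2 = 0 \<and> 0 \<le> P3"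
  shows "exp_small s R1 R2 (\<lambda>n m w. violation n P1 P2 P3 a1 a2 m (fst w))"
proof -
  have one: "exp_small s R1 R2 (\<lambda>n m w. real n * P < nsq n (mix a b (fst w) (fst m) (snd m)))"
    if c: "a\<^sup>2 + b\<^sup>2 < P \<or> a\<^sup>2 + b\<^sup>2 = 0 \<and> 0 \<le> P" for a b P
  proof -
    obtain r where r: "0 \<le> r" "r < 1"
      "\<And>n J m1 m2. finite J \<Longrightarrow> Inl m1 \<in> J \<Longrightarrow> Inr m2 \<in> J \<Longrightarrow>
        emeasure (code_noise n J s) {w \<in> space (code_noise n J s). real n *
            P < nsq n (mix a b (fst w) m1 m2)} \<le> ennreal (r ^ n)"
      by (rule power_violation_prob[OF c s]) blast
    show ?thesis
    proof (rule exp_smallI[OF r(1,2)])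
      fix n m assume m: "m \<in> msgs R1 R2 n"
      then have mJ: "Inl (fst m) \<in> Inl ` messages n R1 \<union> Inr ` messages n R2" "Inr (snd m) \<in> Inl `
          messages n R1 \<union> Inr ` messages n R2"
        by (auto simp: msgs_def)
      have [measurable]: "(\<lambda>w. nsq n (mix a b (fst w) (fst m) (snd m))) \<in> borel_measurable
          (code_ensemble s R1 R2 n)"
        using measurable_nsq_mix[OF measurable_fst mJ, where g = "\<lambda>_ _. 0" and a = a and b = b]
        by (simp add: code_ensemble_def)
      show "Measurable.pred (code_ensemble s R1 R2 n) (\<lambda>w. real n *
          P < nsq n (mix a b (fst w) (fst m) (snd m)))"
        by measurable
      show "emeasure (code_ensemble s R1 R2 n) {w \<in> space (code_ensemble s R1 R2 n). real n *
          P < nsq n (mix a b (fst w) (fst m) (snd m))} \<le> ennreal (r ^ n)"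
        unfolding code_ensemble_def by (rule r(3)[OF _ mJ]) simp
    qed
  qed
  show ?thesis unfolding violation_def
    by (intro exp_small_disj one) (use a in auto)
qed

lemma exp_small_atypical:
  assumes s: "0 < s" and t: "t < a\<^sup>2 + b\<^sup>2 + s\<^sup>2"
  shows "exp_small s R1 R2 (\<lambda>n m w. nsq n (\<lambda>i. mix a b (fst w) (fst m) (snd m) i +
      snd w i) < real n * t)"
proof -
  obtain r where r: "0 \<le> r" "r < 1"
    "\<And>n J m1 m2. finite J \<Longrightarrow> Inl m1 \<in> J \<Longrightarrow> Inr m2 \<in> J \<Longrightarrow>
      emeasure (code_noise n J s) {w \<in> space (code_noise n J s). nsq n (\<lambda>i. mix a b (fst w) m1 m2
          i + snd w i) < real n * t} \<le> ennreal (r ^ n)"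
    by (rule atypical_output_prob[OF s t]) blast
  show ?thesis
  proof (rule exp_smallI[OF r(1,2)])
    fix n m assume m: "m \<in> msgs R1 R2 n"
    then have mJ: "Inl (fst m) \<in> Inl ` messages n R1 \<union> Inr ` messages n R2" "Inr (snd m) \<in> Inl `
        messages n R1 \<union> Inr ` messages n R2"
      by (auto simp: msgs_def)
    have [measurable]: "(\<lambda>w. nsq n (\<lambda>i. mix a b (fst w) (fst m) (snd m) i +
        snd w i)) \<in> borel_measurable (code_ensemble s R1 R2 n)"
      unfolding code_ensemble_def by (intro measurable_nsq_mix[OF measurable_fst mJ]
          measurable_noise)
    show "Measurable.pred (code_ensemble s R1 R2 n) (\<lambda>w. nsq n (\<lambda>i. mix a b (fst w) (fst m) (snd
        m) i + snd w i) < real n * t)"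
      by measurable
    show "emeasure (code_ensemble s R1 R2 n) {w \<in> space (code_ensemble s R1 R2 n). nsq n (\<lambda>i. mix
        a b (fst w) (fst m) (snd m) i + snd w i) < real n * t} \<le> ennreal (r ^ n)"
      unfolding code_ensemble_def by (rule r(3)[OF _ mJ]) simp
  qed
qed

lemma exp_small_noise:
  assumes s: "0 < s" and t: "s\<^sup>2 < t"
  shows "exp_small s R1 R2 (\<lambda>n m w. real n * t < nsq n (snd w))"
proof -
  obtain r where r: "0 \<le> r" "r < 1"
    "\<And>n J. emeasure (code_noise n J s) {w \<in> space (code_noise n J s). real n *
        t < nsq n (snd w)} \<le> ennreal (r ^ n)"
    by (rule noise_upper_tail_prob[OF s t]) blast
  show ?thesis
  proof (rule exp_smallI[OF r(1,2)])
    fix n m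
    have [measurable]: "(\<lambda>w. nsq n (snd w)) \<in> borel_measurable (code_ensemble s R1 R2 n)"
      unfolding code_ensemble_def by (intro measurable_nsq measurable_noise)
    show "Measurable.pred (code_ensemble s R1 R2 n) (\<lambda>w. real n * t < nsq n (snd w))" by measurable
    show "emeasure (code_ensemble s R1 R2 n) {w \<in> space (code_ensemble s R1 R2 n). real n *
        t < nsq n (snd w)} \<le> ennreal (r ^ n)"
      unfolding code_ensemble_def by (rule r(3))
  qed
qed

lemma exp_small_confusable:
  assumes s: "0 < s" and v: "0 \<le> v"
    and vw: "v * exp (\<tau> / (2 * s\<^sup>2) - t / (2 * (a\<^sup>2 + b\<^sup>2 + s\<^sup>2)) - ln ((a\<^sup>2 + b\<^sup>2 +
        s\<^sup>2) / s\<^sup>2) / 2) < 1"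
    and I: "\<And>n m. 0 < n \<Longrightarrow> m \<in> msgs R1 R2 n \<Longrightarrow> I n m \<subseteq> msgs R1 R2 n \<and> real (card (I n m)) \<le> v ^ n"
    and ne: "\<And>n m i. m \<in> msgs R1 R2 n \<Longrightarrow> i \<in> I n m \<Longrightarrow> (a = 0 \<or> fst i \<noteq> fst m) \<and> (b =
        0 \<or> snd i \<noteq> snd m)"
  shows "exp_small s R1 R2 (\<lambda>n m w. \<exists>i\<in>I n m. confusable n a b t \<tau> (fst m) (snd m) (fst i) (snd i)
      w)"
proof (rule exp_small_bex[OF v _ vw])
  fix n m assume nm: "0 < n" "m \<in> msgs R1 R2 n"
  have "finite (msgs R1 R2 n)" by (simp add: msgs_def)
  then show "finite (I n m) \<and> real (card (I n m)) \<le> v ^ n"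
    using I[OF nm] finite_subset by blast
  fix i assume i: "i \<in> I n m"
  let ?J = "Inl ` messages n R1 \<union> Inr ` messages n R2 :: (nat + nat) set"
  have J: "Inl (fst m) \<in> ?J" "Inr (snd m) \<in> ?J" "Inl (fst i) \<in> ?J" "Inr (snd i) \<in> ?J"
    using nm(2) I[OF nm] i by (auto simp: msgs_def)
  show "Measurable.pred (code_ensemble s R1 R2 n) (confusable n a b t \<tau> (fst m) (snd m) (fst i)
      (snd i))"
    unfolding code_ensemble_def by (rule pred_confusable[OF J])
  show "emeasure (code_ensemble s R1 R2 n) {x \<in> space (code_ensemble s R1 R2 n). confusable n a b
      t \<tau> (fst m) (snd m) (fst i) (snd i) x} \<le>
      ennreal (exp (\<tau> / (2 * s\<^sup>2) - t / (2 * (a\<^sup>2 + b\<^sup>2 + s\<^sup>2)) - ln ((a\<^sup>2 + b\<^sup>2 +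
          s\<^sup>2) / s\<^sup>2) / 2) ^ n)"
    unfolding code_ensemble_def using ne[OF nm(2) i] by (intro confusable_prob s J) auto
qed simp

lemma exp_small_mono:
  assumes "exp_small s R1 R2 Q"
    and "\<And>n m. 0 < n \<Longrightarrow> m \<in> msgs R1 R2 n \<Longrightarrow> Measurable.pred (code_ensemble s R1 R2 n) (Q' n m)"
    and imp: "\<And>n m w. 0 < n \<Longrightarrow> m \<in> msgs R1 R2 n \<Longrightarrow> Q' n m w \<Longrightarrow> Q n m w"
  shows "exp_small s R1 R2 Q'"
proof -
  from assms(1) obtain K r where K: "0 \<le> K" "0 \<le> r" "r < 1"
    and Q: "\<And>n m. 0 < n \<Longrightarrow> m \<in> msgs R1 R2 n \<Longrightarrow> Measurable.pred (code_ensemble s R1 R2 n) (Q n m)"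
      "\<And>n m. 0 < n \<Longrightarrow> m \<in> msgs R1 R2 n \<Longrightarrow>
      emeasure (code_ensemble s R1 R2 n) {w \<in> space (code_ensemble s R1 R2 n). Q n m w} \<le>
          ennreal (K * r ^ n)"
    unfolding exp_small_def by blast
  show ?thesis unfolding exp_small_def
  proof (rule exI[of _ K], rule exI[of _ r], intro conjI allI impI ballI)
    fix n :: nat and m assume nm: "0 < n" "m \<in> msgs R1 R2 n"
    show "Measurable.pred (code_ensemble s R1 R2 n) (Q' n m)" by (rule assms(2)[OF nm])
    have "emeasure (code_ensemble s R1 R2 n) {w \<in> space (code_ensemble s R1 R2 n). Q' n m w} \<le>
       emeasure (code_ensemble s R1 R2 n) {w \<in> space (code_ensemble s R1 R2 n). Q n m w}"
      using imp[OF nm] Q(1)[OF nm] by (intro emeasure_mono) auto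
    also note Q(2)[OF nm]
    finally show "emeasure (code_ensemble s R1 R2 n) {w \<in> space (code_ensemble s R1 R2 n). Q' n m
        w} \<le> ennreal (K * r ^ n)" .
  qed (use K in auto)
qed

text \<open>The competitors fall into three classes: wrong first message only, wrong second only,
  both wrong. Each class contributes one rate condition. Excluding the true message lowers a message
  count by 1, so a rate of 0 leaves no competitors and permits a base of 0.\<close>

lemma exp_small_miss:
  assumes s: "0 < s" and R: "0 \<le> R1" "0 \<le> R2" and d: "0 < d"
    and v: "0 \<le> v1" "0 \<le> v2" "\<And>n. 0 < n \<Longrightarrow> real (card (messages n R1)) - 1 \<le> v1 ^ n"
       "\<And>n. 0 < n \<Longrightarrow> real (card (messages n R2)) - 1 \<le> v2 ^ n"
  defines "w \<equiv> \<lambda>x. exp ((s\<^sup>2 + d) / (2 * s\<^sup>2) - (x + s\<^sup>2 - d) / (2 * (x + s\<^sup>2)) - ln ((x +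
      s\<^sup>2) / s\<^sup>2) / 2)"
  assumes vw: "v1 * w (b1\<^sup>2) < 1" "v2 * w (b2\<^sup>2) < 1" "v1 * v2 * w (b1\<^sup>2 + b2\<^sup>2) < 1"
  shows "exp_small s R1 R2 (\<lambda>n m. miss n b1 b2 (s\<^sup>2 + d) (msgs R1 R2 n) m)"
proof -
  let ?\<tau> = "s\<^sup>2 + d"
  \<comment> \<open>Slack \<open>d\<close> below the output variance and above the noise variance
    makes atypical outputs and large noise exponentially rare.\<close>
  let ?t = "\<lambda>a b. a\<^sup>2 + b\<^sup>2 + s\<^sup>2 - d"
  let ?A = "\<lambda>a b n m w. nsq n (\<lambda>i. mix a b (fst w) (fst m) (snd m) i + snd w i) < real n * ?t a b"
  let ?C = "\<lambda>a b I n m w. \<exists>i\<in>I n m. confusable n a b (?t a b) ?\<tau> (fst m) (snd m) (fst i) (snd i) w"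
  let ?I1 = "\<lambda>n m. (messages n R1 - {fst m}) \<times> {snd m}"
  let ?I2 = "\<lambda>n m. {fst m} \<times> (messages n R2 - {snd m})"
  let ?I3 = "\<lambda>n m. (messages n R1 - {fst m}) \<times> (messages n R2 - {snd m})"
  have card: "real (card (messages n R - {x})) = real (card (messages n R)) - 1"
      if "x \<in> messages n R" for n R x
  proof -
    have "0 < card (messages n R)" using that by (auto simp: card_gt_0_iff)
    then show ?thesis using that by (simp add: card_Diff_singleton of_nat_diff Suc_le_eq)
  qed
  have A: "exp_small s R1 R2 (?A a b)" for a b
    by (rule exp_small_atypical[OF s]) (use d in simp)
  have C1: "exp_small s R1 R2 (?C b1 0 ?I1)"
    by (rule exp_small_confusable[OF s v(1)])
       (use vw(1) v(3) in \<open>auto simp: w_def msgs_def card_cartesian_product card simp del: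
           card_Diff_singleton card_Diff_insert\<close>)
  have C2: "exp_small s R1 R2 (?C 0 b2 ?I2)"
    by (rule exp_small_confusable[OF s v(2)])
       (use vw(2) v(4) in \<open>auto simp: w_def msgs_def card_cartesian_product card simp del:
           card_Diff_singleton card_Diff_insert\<close>)
  have C3: "exp_small s R1 R2 (?C b1 b2 ?I3)"
  proof (rule exp_small_confusable[OF s, of "v1 * v2"])
    fix n m assume nm: "0 < n" "m \<in> msgs R1 R2 n"
    have "real (card (?I3 n m)) = (real (card (messages n R1)) - 1) *
        (real (card (messages n R2)) - 1)"
      using nm(2) by (auto simp: card_cartesian_product card msgs_def simp del:
          card_Diff_singleton card_Diff_insert)
    also have "\<dots> \<le> v1 ^ n * v2 ^ n"
      using v(3,4)[OF nm(1)] card_messages_pos[OF R(2), of n] v(1) by (intro mult_mono) auto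
    finally show "?I3 n m \<subseteq> msgs R1 R2 n \<and> real (card (?I3 n m)) \<le> (v1 * v2) ^ n"
      by (auto simp: power_mult_distrib msgs_def)
  qed (use vw(3) v(1,2) in \<open>auto simp: w_def\<close>)
  have N: "exp_small s R1 R2 (\<lambda>n m w. real n * ?\<tau> < nsq n (snd w))"
    by (rule exp_small_noise[OF s]) (use d in simp)
  show ?thesis
  proof (rule exp_small_mono[OF exp_small_disj[OF N exp_small_disj[OF exp_small_disj[OF A[of b1 0]
      C1]
        exp_small_disj[OF exp_small_disj[OF A[of 0 b2] C2] exp_small_disj[OF A[of b1 b2] C3]]]]])
    fix n m assume nm: "0 < n" "m \<in> msgs R1 R2 n"
    show "Measurable.pred (code_ensemble s R1 R2 n) (miss n b1 b2 ?\<tau> (msgs R1 R2 n) m)"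
      unfolding code_ensemble_def by (rule pred_miss) (use nm in \<open>auto simp: msgs_def\<close>)
    fix x assume "miss n b1 b2 ?\<tau> (msgs R1 R2 n) m x"
    then consider "real n * ?\<tau> < nsq n (snd x)" | m' where "m' \<in> msgs R1 R2 n" "m' \<noteq> m"
      "nsq n (\<lambda>i. mix b1 b2 (fst x) (fst m) (snd m) i +
          snd x i - mix b1 b2 (fst x) (fst m') (snd m') i) \<le> real n * ?\<tau>"
      unfolding miss_def by blast
    then show "real n * ?\<tau> < nsq n (snd x) \<or> (?A b1 0 n m x \<or> ?C b1 0 ?I1 n m x) \<or>
      (?A 0 b2 n m x \<or> ?C 0 b2 ?I2 n m x) \<or> (?A b1 b2 n m x \<or> ?C b1 b2 ?I3 n m x)"
    proof cases
      case 2
      let ?d = "\<lambda>i. mix b1 b2 (fst x) (fst m) (snd m) i +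
          snd x i - mix b1 b2 (fst x) (fst m') (snd m') i"
      consider "fst m' \<noteq> fst m" "snd m' = snd m" | "fst m' =
          fst m" "snd m' \<noteq> snd m" | "fst m' \<noteq> fst m" "snd m' \<noteq> snd m"
        using 2(2) by (auto simp: prod_eq_iff)
      then show ?thesis
      proof cases
        case 1
        \<comment> \<open>The shared second codeword cancels in the difference, so the event is one
          for amplitudes \<open>b1\<close> and 0, with the output typicality taken for these
          amplitudes.\<close>
        have eq: "?d = (\<lambda>i. mix b1 0 (fst x) (fst m) (snd m) i +
            snd x i - mix b1 0 (fst x) (fst m') (snd m') i)"
          using 1 by (simp add: mix_def fun_eq_iff algebra_simps)
        have "m' \<in> ?I1 n m" using 1 2(1) by (auto simp: msgs_def mem_Times_iff)
        moreover have "?A b1 0 n m x \<or> confusable n b1 0 (?t b1 0) ?\<tau> (fst m) (snd m) (fst m')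
            (snd m') x"
          using \<open>nsq n ?d \<le> _\<close> unfolding confusable_def eq by linarith
        ultimately show ?thesis by blast
      next
        case 2
        have eq: "?d = (\<lambda>i. mix 0 b2 (fst x) (fst m) (snd m) i +
            snd x i - mix 0 b2 (fst x) (fst m') (snd m') i)"
          using 2 by (simp add: mix_def fun_eq_iff algebra_simps)
        have "m' \<in> ?I2 n m" using 2 \<open>m' \<in> msgs R1 R2 n\<close> by (auto simp: msgs_def mem_Times_iff)
        moreover have "?A 0 b2 n m x \<or> confusable n 0 b2 (?t 0 b2) ?\<tau> (fst m) (snd m) (fst m')
            (snd m') x"
          using \<open>nsq n ?d \<le> _\<close> unfolding confusable_def eq by linarith
        ultimately show ?thesis by blast
      next
        case 3
        have "m' \<in> ?I3 n m" using 3 2(1) by (auto simp: msgs_def mem_Times_iff)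
        moreover have "?A b1 b2 n m x \<or> confusable n b1 b2 (?t b1 b2) ?\<tau> (fst m) (snd m) (fst m')
            (snd m') x"
          using \<open>nsq n ?d \<le> _\<close> unfolding confusable_def by linarith
        ultimately show ?thesis by blast
      qed
    qed simp
  qed
qed

section \<open>The capacity region\<close>

text \<open>At d = 0 the two fractions cancel and the exponential equals (1 + x/s^2) to the power
  -1/2, so the strict rate condition gives a value below 1; continuity extends this to small
  positive \<open>d\<close>.\<close>

lemma confusion_rate_eventually:
  fixes s v x :: real
  assumes s: "0 < s" and x: "0 \<le> x" and v: "v = 0 \<or> 0 < v \<and> ln v < ln (1 + x / s\<^sup>2) / 2"
  shows "\<forall>\<^sub>F d in at_right 0. v * exp ((s\<^sup>2 + d) / (2 * s\<^sup>2) - (x + s\<^sup>2 - d) / (2 * (x +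
      s\<^sup>2)) - ln ((x + s\<^sup>2) / s\<^sup>2) / 2) < 1"
proof -
  let ?f = "\<lambda>d. v * exp ((s\<^sup>2 + d) / (2 * s\<^sup>2) - (x + s\<^sup>2 - d) / (2 * (x + s\<^sup>2)) - ln ((x +
      s\<^sup>2) / s\<^sup>2) / 2)"
  have xs: "0 < x + s\<^sup>2" using s x by (simp add: add_nonneg_pos)
  have "(?f \<longlongrightarrow> ?f 0) (at_right 0)"
    using s xs by (intro tendsto_intros) auto
  moreover have "?f 0 < 1"
  proof (cases "v = 0")
    case False
    with v have v0: "0 < v" "ln v < ln (1 + x / s\<^sup>2) / 2" by auto
    have "1 + x / s\<^sup>2 = (x + s\<^sup>2) / s\<^sup>2" using s by (simp add: field_simps)
    moreover have "(s\<^sup>2 + 0) / (2 * s\<^sup>2) - (x + s\<^sup>2 - 0) / (2 * (x + s\<^sup>2)) = 0" using s xs by simp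
    ultimately have "?f 0 = exp (ln v) * exp (- (ln (1 + x / s\<^sup>2) / 2))" using v0 by simp
    also have "\<dots> = exp (ln v - ln (1 + x / s\<^sup>2) / 2)"
        by (simp only: exp_add[symmetric] diff_conv_add_uminus)
    also have "\<dots> < 1" using v0 by simp
    finally show ?thesis .
  qed simp
  ultimately show ?thesis by (rule order_tendstoD)
qed

text \<open>At rate 0 there is a single message, so the left side is 0; the base 0 is then correct
  because n > 0.\<close>

lemma card_messages_le_power:
  assumes "0 \<le> R" "0 < n"
  shows "real (card (messages n R)) - 1 \<le> (if R = 0 then 0 else 2 powr R) ^ n"
proof (cases "R = 0")
  case False
  have "2 powr (real n * R) = (2 powr R) ^ n"
    by (simp add: powr_realpow[symmetric] powr_powr mult.commute)
  with card_messages_upper[of n R] False show ?thesis by simp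
qed (use assms in \<open>simp add: messages_def\<close>)

text \<open>The Gaussian multiple-access pentagon for fixed amplitudes. A zero rate meets its
  condition automatically, and the sum condition is asked only when both rates are positive, since
  otherwise no competitor has both messages wrong.\<close>

lemma achievable_split:
  assumes s: "0 < \<sigma>B" "0 < \<sigma>E" and P: "0 \<le> P1" "0 \<le> P2" "0 \<le> P3" and R: "0 \<le> R1" "0 \<le> R2"
    and a: "a1\<^sup>2 < P1 \<or> a1 = 0" "a2\<^sup>2 < P2 \<or> a2 = 0" "a1\<^sup>2 + a2\<^sup>2 < P3 \<or> a1\<^sup>2 + a2\<^sup>2 = 0"
    and r1: "R1 = 0 \<or> R1 * ln 2 < ln (1 + ((1 - h) * a1)\<^sup>2 / \<sigma>B\<^sup>2) / 2"
    and r2: "R2 = 0 \<or> R2 * ln 2 < ln (1 + ((1 - h) * a2)\<^sup>2 / \<sigma>B\<^sup>2) / 2"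
    and r12: "R1 = 0 \<or> R2 = 0 \<or> (R1 + R2) * ln 2 < ln (1 + (((1 - h) * a1)\<^sup>2 + ((1 - h) *
        a2)\<^sup>2) / \<sigma>B\<^sup>2) / 2"
  shows "achievable h \<sigma>B \<sigma>E P1 P2 P3 R1 R2"
proof -
  let ?b1 = "(1 - h) * a1" and ?b2 = "(1 - h) * a2"
  define v1 :: real where "v1 = (if R1 = 0 then 0 else 2 powr R1)"
  define v2 :: real where "v2 = (if R2 = 0 then 0 else 2 powr R2)"
  define w where "w d x = exp ((\<sigma>B\<^sup>2 + d) / (2 * \<sigma>B\<^sup>2) - (x + \<sigma>B\<^sup>2 - d) / (2 * (x +
      \<sigma>B\<^sup>2)) - ln ((x + \<sigma>B\<^sup>2) / \<sigma>B\<^sup>2) / 2)" for d x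
  have v0: "0 \<le> v1" "0 \<le> v2" by (simp_all add: v1_def v2_def)
  have e1: "\<forall>\<^sub>F d in at_right 0. v1 * w d (?b1\<^sup>2) < 1"
    unfolding w_def by (rule confusion_rate_eventually[OF s(1)]) (use r1 in \<open>auto simp: v1_def\<close>)
  have e2: "\<forall>\<^sub>F d in at_right 0. v2 * w d (?b2\<^sup>2) < 1"
    unfolding w_def by (rule confusion_rate_eventually[OF s(1)]) (use r2 in \<open>auto simp: v2_def\<close>)
  have e12: "\<forall>\<^sub>F d in at_right 0. v1 * v2 * w d (?b1\<^sup>2 + ?b2\<^sup>2) < 1"
  proof -
    have v12: "v1 * v2 = (if R1 = 0 \<or> R2 = 0 then 0 else 2 powr (R1 + R2))"
      by (simp add: v1_def v2_def powr_add)
    show ?thesis unfolding w_def v12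
      by (rule confusion_rate_eventually[OF s(1)]) (use r12 in auto)
  qed
  have "\<forall>\<^sub>F d in at_right 0. 0 < d \<and> v1 * w d (?b1\<^sup>2) < 1 \<and> v2 * w d (?b2\<^sup>2) < 1 \<and> v1 * v2 *
      w d (?b1\<^sup>2 + ?b2\<^sup>2) < 1"
    by (intro eventually_conj e1 e2 e12 eventually_at_right_less)
  then obtain d where d: "0 < d" "v1 * w d (?b1\<^sup>2) < 1" "v2 * w d (?b2\<^sup>2) < 1" "v1 * v2 *
      w d (?b1\<^sup>2 + ?b2\<^sup>2) < 1"
    using eventually_happens'[OF trivial_limit_at_right_real] by blast
  have "exp_small \<sigma>B R1 R2 (\<lambda>n m w. violation n P1 P2 P3 a1 a2 m (fst w) \<or>
      miss n ?b1 ?b2 (\<sigma>B\<^sup>2 + d) (msgs R1 R2 n) m w)"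
  proof (rule exp_small_disj)
    show "exp_small \<sigma>B R1 R2 (\<lambda>n m w. violation n P1 P2 P3 a1 a2 m (fst w))"
      by (rule exp_small_violation[OF s(1)]) (use a P in auto)
    show "exp_small \<sigma>B R1 R2 (\<lambda>n m. miss n ?b1 ?b2 (\<sigma>B\<^sup>2 + d) (msgs R1 R2 n) m)"
    proof (rule exp_small_miss[OF s(1) R d(1) v0])
      show "real (card (messages n R1)) - 1 \<le> v1 ^ n" if "0 < n" for n
        unfolding v1_def by (rule card_messages_le_power[OF R(1) that])
      show "real (card (messages n R2)) - 1 \<le> v2 ^ n" if "0 < n" for n
        unfolding v2_def by (rule card_messages_le_power[OF R(2) that])
    qed (use d in \<open>simp_all add: w_def\<close>)
  qed
  then obtain K r where K: "0 \<le> K" "0 \<le> r" "r < 1"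
    and le: "\<And>n m. 0 < n \<Longrightarrow> m \<in> msgs R1 R2 n \<Longrightarrow> emeasure (code_ensemble \<sigma>B R1 R2 n)
       {w \<in> space (code_ensemble \<sigma>B R1 R2 n). violation n P1 P2 P3 a1 a2 m (fst w) \<or>
        miss n ?b1 ?b2 (\<sigma>B\<^sup>2 + d) (msgs R1 R2 n) m w} \<le> ennreal (K * r ^ n)"
    unfolding exp_small_def by blast
  \<comment> \<open>The added (1/2)^n makes the bound strictly positive even if K or r is 0, as the
    selection of a codebook requires.\<close>
  define e where "e n = K * r ^ n + (1 / 2) ^ n" for n
  have e0: "0 < e n" for n unfolding e_def using K by (intro add_nonneg_pos) auto
  have "\<exists>c. 0 < n \<longrightarrow> is_code P1 P2 P3 R1 R2 n c \<and> error_prob h \<sigma>B \<sigma>E R1 R2 n c \<le> 2 * e n \<and>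
      tv_dist (warden_law \<sigma>B \<sigma>E R1 R2 n c) (white_noise n \<sigma>E) \<le> 2 * e n" for n
  proof (cases "0 < n")
    case True
    have "emeasure (code_ensemble \<sigma>B R1 R2 n)
       {w \<in> space (code_ensemble \<sigma>B R1 R2 n). violation n P1 P2 P3 a1 a2 m (fst w) \<or>
        miss n ?b1 ?b2 (\<sigma>B\<^sup>2 + d) (msgs R1 R2 n) m w} \<le> ennreal (e n)" if "m \<in> msgs R1 R2 n" for m
      using le[OF True that] by (rule order_trans) (auto simp: e_def intro: ennreal_leI)
    note bound = this[unfolded code_ensemble_def msgs_def]
    obtain c where "is_code P1 P2 P3 R1 R2 n c" "error_prob h \<sigma>B \<sigma>E R1 R2 n c \<le> 2 * e n"
        "tv_dist (warden_law \<sigma>B \<sigma>E R1 R2 n c) (white_noise n \<sigma>E) \<le> 2 * e n"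
      by (rule random_code[OF s P R True e0 bound])
    then show ?thesis by blast
  qed simp
  then obtain c where c: "\<And>n. 0 < n \<Longrightarrow> is_code P1 P2 P3 R1 R2 n (c n)"
    "\<And>n. 0 < n \<Longrightarrow> error_prob h \<sigma>B \<sigma>E R1 R2 n (c n) \<le> 2 * e n"
    "\<And>n. 0 < n \<Longrightarrow> tv_dist (warden_law \<sigma>B \<sigma>E R1 R2 n (c n)) (white_noise n \<sigma>E) \<le> 2 * e n"
    by metis
  have "(\<lambda>n. 2 * e n) \<longlonglongrightarrow> 2 * (K * 0 + 0)"
    unfolding e_def using K by (intro tendsto_intros LIMSEQ_realpow_zero) auto
  then have elim: "(\<lambda>n. 2 * e n) \<longlonglongrightarrow> 0" by simp
  have pos: "\<forall>\<^sub>F n :: nat in sequentially. 0 < n" by (rule eventually_gt_at_top)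
  have "(\<lambda>n. error_prob h \<sigma>B \<sigma>E R1 R2 n (c n)) \<longlonglongrightarrow> 0"
  proof (rule real_tendsto_sandwich[OF _ _ tendsto_const elim])
    show "\<forall>\<^sub>F n in sequentially. 0 \<le> error_prob h \<sigma>B \<sigma>E R1 R2 n (c n)" by (simp add: error_prob_def)
    show "\<forall>\<^sub>F n in sequentially. error_prob h \<sigma>B \<sigma>E R1 R2 n (c n) \<le> 2 * e n"
      using pos by eventually_elim (rule c(2))
  qed
  moreover have "(\<lambda>n. tv_dist (warden_law \<sigma>B \<sigma>E R1 R2 n (c n)) (white_noise n \<sigma>E)) \<longlonglongrightarrow> 0"
  proof (rule real_tendsto_sandwich[OF _ _ tendsto_const elim])
    have "0 \<le> tv_dist (warden_law \<sigma>B \<sigma>E R1 R2 n (c n)) (white_noise n \<sigma>E)" for n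
      by (rule order_trans[OF abs_ge_zero
          tv_dist_upper[OF prob_space_warden_law[OF s R] prob_space_white_noise[OF s(2)]
              sets.empty_sets]])
    then show "\<forall>\<^sub>F n in sequentially. 0 \<le> tv_dist (warden_law \<sigma>B \<sigma>E R1 R2 n (c n)) (white_noise n
        \<sigma>E)" by simp
    show "\<forall>\<^sub>F n in sequentially. tv_dist (warden_law \<sigma>B \<sigma>E R1 R2 n (c n)) (white_noise n \<sigma>E) \<le>
        2 * e n"
      using pos by eventually_elim (rule c(3))
  qed
  ultimately show ?thesis unfolding achievable_def using R c(1) by blast
qed

text \<open>Concavity of the logarithm on the segment from 1 to 1 + x: scaling the power by
  \<open>t\<close> costs at most a factor \<open>t\<close> in rate.\<close>

lemma scaled_ln_le:
  fixes x t :: real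
  assumes "0 \<le> x" "0 \<le> t" "t \<le> 1"
  shows "t * ln (1 + x) \<le> ln (1 + t * x)"
proof -
  have "t * ln (1 + x) + (1 - t) * ln 1 \<le> ln (t * (1 + x) + (1 - t) * 1)"
    using concave_onD[OF ln_concave, of "1 - t" "1 + x" 1] assms by (simp add: algebra_simps)
  then show ?thesis by (simp add: algebra_simps)
qed

text \<open>If \<open>P\<^sub>3 < P\<^sub>1 + P\<^sub>2\<close>, the least powers \<open>q\<^sub>i\<close> supporting \<open>x\<^sub>i\<close> satisfy \<open>q\<^sub>1 + q\<^sub>2 \<le>
    P\<^sub>3\<close>, because
  \<open>(1 + k q\<^sub>1) (1 + k q\<^sub>2) \<le> 1 + k P\<^sub>3\<close>, and can be raised until their sum is \<open>P\<^sub>3\<close>.\<close>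

lemma power_split:
  fixes k P1 P2 P3 x1 x2 :: real
  assumes k: "0 \<le> k" and P: "0 \<le> P1" "0 \<le> P2" "0 \<le> P3" and x: "0 \<le> x1" "0 \<le> x2"
    and le: "x1 \<le> ln (1 + k * min P1 P3)" "x2 \<le> ln (1 + k * min P2 P3)" "x1 + x2 \<le>
        ln (1 + k * min (P1 + P2) P3)"
  obtains Q1 Q2 where "0 \<le> Q1" "Q1 \<le> P1" "0 \<le> Q2" "Q2 \<le> P2" "Q1 + Q2 \<le> P3"
    "x1 \<le> ln (1 + k * Q1)" "x2 \<le> ln (1 + k * Q2)" "x1 + x2 \<le> ln (1 + k * (Q1 + Q2))"
proof -
  consider "k = 0" | "P1 + P2 \<le> P3" | "0 < k" "P3 < P1 + P2" using k by linarith
  then show ?thesis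
  proof cases
    case 1
    show ?thesis by (rule that[of 0 0]) (use 1 P x le in simp_all)
  next
    case 2
    then have "min P1 P3 = P1" "min P2 P3 = P2" "min (P1 + P2) P3 = P1 + P2" using P by auto
    then show ?thesis using that[of P1 P2] 2 P le by simp
  next
    case 3
    define q1 where "q1 = (exp x1 - 1) / k"
    define q2 where "q2 = (exp x2 - 1) / k"
    have q: "0 \<le> q1" "0 \<le> q2" "1 + k * q1 = exp x1" "1 + k * q2 = exp x2"
      using x 3 by (auto simp: q1_def q2_def)
    have inv: "y \<le> m" if "1 + k * y \<le> 1 + k * m" for y m using that 3(1) by simp
    have exple: "exp y \<le> 1 + k * m" if "y \<le> ln (1 + k * m)" "0 \<le> m" for y m
    proof -
      have "0 < 1 + k * m" using that 3(1) by (simp add: add_pos_nonneg)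
      then show ?thesis using that(1) by (simp add: ln_ge_iff)
    qed
    have m1: "q1 \<le> min P1 P3"
      by (rule inv) (use exple[OF le(1)] q(3) P in linarith)
    have m2: "q2 \<le> min P2 P3"
      by (rule inv) (use exple[OF le(2)] q(4) P in linarith)
    have "1 + k * (q1 + q2) \<le> (1 + k * q1) * (1 + k * q2)"
    proof -
      have "(1 + k * q1) * (1 + k * q2) = 1 + k * (q1 + q2) + k * q1 * (k * q2)"
        by (simp add: algebra_simps)
      then show ?thesis using q(1,2) 3(1) by simp
    qed
    also have "\<dots> = exp (x1 + x2)" by (simp add: q exp_add)
    also have "\<dots> \<le> 1 + k * min (P1 + P2) P3" by (rule exple[OF le(3)]) (use P in simp)
    finally have sum: "q1 + q2 \<le> P3" using inv[of "q1 + q2" "min (P1 + P2) P3"] by simp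
    \<comment> \<open>The least admissible first power: it must support \<open>x1\<close> and leave
      the second transmitter at most \<open>P2\<close>. Then Q2 is the minimum of P3 - q1 and P2,
      hence at least \<open>q2\<close>.\<close>
    define Q1 where "Q1 = max q1 (P3 - P2)"
    define Q2 where "Q2 = P3 - Q1"
    have Q: "q1 \<le> Q1" "Q1 \<le> P1" "q2 \<le> Q2" "Q2 \<le> P2" "Q1 + Q2 = P3"
      using m1 m2 sum 3 unfolding Q1_def Q2_def by linarith+
    have lnle: "y \<le> ln (1 + k * Q)" if "1 + k * r = exp y" "r \<le> Q" for y r Q
    proof -
      have "exp y \<le> 1 + k * Q" unfolding that(1)[symmetric] using that(2) 3(1) by simp
      then show ?thesis using exp_gt_zero[of y] by (subst ln_ge_iff) linarith+
    qed
    have "x1 + x2 \<le> ln (1 + k * (Q1 + Q2))" using le(3) 3(2) Q(5) by simp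
    then show ?thesis
      by (intro that[of Q1 Q2] lnle[OF q(3) Q(1)] lnle[OF q(4) Q(3)]) (use Q q in linarith)+
  qed
qed

text \<open>One factor \<open>t\<close> pays for shrinking the powers strictly below their
  constraints, the other makes the rates strictly smaller than the resulting capacities.\<close>

lemma scaled_pair_achievable:
  assumes s: "0 < \<sigma>B" "0 < \<sigma>E" and P: "0 \<le> P1" "0 \<le> P2" "0 \<le> P3" and R: "0 \<le> R1" "0 \<le> R2"
    and le: "R1 \<le> 1 / 2 * log 2 (1 + (h - 1)\<^sup>2 * min P1 P3 / \<sigma>B\<^sup>2)"
      "R2 \<le> 1 / 2 * log 2 (1 + (h - 1)\<^sup>2 * min P2 P3 / \<sigma>B\<^sup>2)"
      "R1 + R2 \<le> 1 / 2 * log 2 (1 + (h - 1)\<^sup>2 * min (P1 + P2) P3 / \<sigma>B\<^sup>2)"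
    and t: "0 \<le> t" "t < 1"
  shows "achievable h \<sigma>B \<sigma>E P1 P2 P3 (t * t * R1) (t * t * R2)"
proof -
  define k where "k = (h - 1)\<^sup>2 / \<sigma>B\<^sup>2"
  have k: "0 \<le> k" by (simp add: k_def)
  have conv: "2 * R * ln 2 \<le> ln (1 + k * Q)" if "R \<le> 1 / 2 * log 2 (1 + (h - 1)\<^sup>2 * Q / \<sigma>B\<^sup>2)"
      for R Q
    using that by (simp add: k_def log_def field_simps)
  obtain Q1 Q2 where Q: "0 \<le> Q1" "Q1 \<le> P1" "0 \<le> Q2" "Q2 \<le> P2" "Q1 + Q2 \<le> P3"
    "2 * R1 * ln 2 \<le> ln (1 + k * Q1)" "2 * R2 * ln 2 \<le> ln (1 + k * Q2)"
    "2 * R1 * ln 2 + 2 * R2 * ln 2 \<le> ln (1 + k * (Q1 + Q2))"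
    by (rule power_split[OF k P, of "2 * R1 * ln 2" "2 * R2 * ln 2"])
       (use R conv[OF le(1)] conv[OF le(2)] conv[OF le(3)] in \<open>auto simp: algebra_simps\<close>)
  have strict: "t * t * R = 0 \<or> t * t * R * ln 2 < ln (1 + k * (t * q)) / 2"
    if "2 * R * ln 2 \<le> ln (1 + k * q)" "0 \<le> R" "0 \<le> q" for R q
  proof (cases "t * t * R = 0")
    case False
    then have tR: "0 < t * R" using t that by (simp add: zero_less_mult_iff)
    have "t * (t * R) < 1 * (t * R)" using t tR by (intro mult_strict_right_mono) auto
    from mult_strict_right_mono[OF this, of "ln 2"] have "t * t * R * ln 2 < t * R * ln 2"
      by (simp add: mult.assoc)
    also have "t * R * ln 2 \<le> t * ln (1 + k * q) / 2"
      using mult_left_mono[OF that(1) t(1)] by (simp add: mult_ac)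
    also have "\<dots> \<le> ln (1 + t * (k * q)) / 2"
      using scaled_ln_le[of "k * q" t] k that(3) t by simp
    finally show ?thesis by (simp add: mult.left_commute)
  qed simp
  define a1 where "a1 = sqrt (t * Q1)"
  define a2 where "a2 = sqrt (t * Q2)"
  have asq: "a1\<^sup>2 = t * Q1" "a2\<^sup>2 = t * Q2" using t Q by (auto simp: a1_def a2_def)
  have bsq: "((1 - h) * a)\<^sup>2 / \<sigma>B\<^sup>2 = k * a\<^sup>2" for a
    by (simp add: k_def power_mult_distrib power2_commute[of 1 h])
  have tq: "t * q < p \<or> t * q = 0" if "0 \<le> q" "q \<le> p" for q p
  proof (cases "q = 0")
    case False
    then have "t * q < 1 * q" using t that by (intro mult_strict_right_mono) auto
    with that show ?thesis by simp
  qed simp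
  show ?thesis
  proof (rule achievable_split[OF s P, where ?a1.0 = a1 and ?a2.0 = a2])
    show "a1\<^sup>2 < P1 \<or> a1 = 0" using tq[OF Q(1,2)] asq(1) by auto
    show "a2\<^sup>2 < P2 \<or> a2 = 0" using tq[OF Q(3,4)] asq(2) by auto
    show "a1\<^sup>2 + a2\<^sup>2 < P3 \<or> a1\<^sup>2 + a2\<^sup>2 = 0"
      using tq[of "Q1 + Q2" P3] Q unfolding asq distrib_left[symmetric] by simp
    show "t * t * R1 = 0 \<or> t * t * R1 * ln 2 < ln (1 + ((1 - h) * a1)\<^sup>2 / \<sigma>B\<^sup>2) / 2"
      using strict[OF Q(6) R(1) Q(1)] by (simp only: bsq asq)
    show "t * t * R2 = 0 \<or> t * t * R2 * ln 2 < ln (1 + ((1 - h) * a2)\<^sup>2 / \<sigma>B\<^sup>2) / 2"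
      using strict[OF Q(7) R(2) Q(3)] by (simp only: bsq asq)
    have "t * t * (R1 + R2) = 0 \<or> t * t * (R1 + R2) * ln 2 < ln (1 + k * (t * (Q1 + Q2))) / 2"
      using Q R by (intro strict) (auto simp: algebra_simps)
    then show "t * t * R1 = 0 \<or> t * t * R2 = 0 \<or> (t * t * R1 + t * t * R2) * ln 2 <
        ln (1 + (((1 - h) * a1)\<^sup>2 + ((1 - h) * a2)\<^sup>2) / \<sigma>B\<^sup>2) / 2"
    proof
      assume "t * t * (R1 + R2) = 0"
      then have "t = 0 \<or> R1 = 0" using R by auto
      then show ?thesis by auto
    next
      assume "t * t * (R1 + R2) * ln 2 < ln (1 + k * (t * (Q1 + Q2))) / 2"
      then show ?thesis by (simp only: add_divide_distrib bsq asq distrib_left) blast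
    qed
  qed (use R t in auto)
qed

theorem theorem4:
  fixes h \<sigma>B \<sigma>E P1 P2 P3 :: real
  assumes "0 < \<sigma>B" and "0 < \<sigma>E"
    and "0 \<le> P1" and "0 \<le> P2" and "0 \<le> P3"
  shows "covert_capacity_region h \<sigma>B \<sigma>E P1 P2 P3 =
    {(R1, R2). 0 \<le> R1 \<and> 0 \<le> R2 \<and>
       R1 \<le> 1 / 2 * log 2 (1 + (h - 1)\<^sup>2 * min P1 P3 / \<sigma>B\<^sup>2) \<and>
       R2 \<le> 1 / 2 * log 2 (1 + (h - 1)\<^sup>2 * min P2 P3 / \<sigma>B\<^sup>2) \<and>
       R1 + R2 \<le> 1 / 2 * log 2 (1 + (h - 1)\<^sup>2 * min (P1 + P2) P3 / \<sigma>B\<^sup>2)}"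
    (is "_ = ?region")
proof
  \<comment> \<open>Closedness lets the outer bound for achievable pairs pass to their
    closure.\<close>
  have "closed ?region"
    unfolding case_prod_beta
    by (intro closed_Collect_conj closed_Collect_le continuous_intros)
  moreover have "{(R1, R2). achievable h \<sigma>B \<sigma>E P1 P2 P3 R1 R2} \<subseteq> ?region"
  proof clarify
    fix R1 R2 assume ach: "achievable h \<sigma>B \<sigma>E P1 P2 P3 R1 R2"
    then have "0 \<le> R1" "0 \<le> R2" by (simp_all add: achievable_def)
    with covert_region_outer_bound[OF assms ach] show "0 \<le> R1 \<and> 0 \<le> R2 \<and>
       R1 \<le> 1 / 2 * log 2 (1 + (h - 1)\<^sup>2 * min P1 P3 / \<sigma>B\<^sup>2) \<and>
       R2 \<le> 1 / 2 * log 2 (1 + (h - 1)\<^sup>2 * min P2 P3 / \<sigma>B\<^sup>2) \<and>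
       R1 + R2 \<le> 1 / 2 * log 2 (1 + (h - 1)\<^sup>2 * min (P1 + P2) P3 / \<sigma>B\<^sup>2)" by blast
  qed
  ultimately show "covert_capacity_region h \<sigma>B \<sigma>E P1 P2 P3 \<subseteq> ?region"
    unfolding covert_capacity_region_def by (rule closure_minimal[rotated])
  show "?region \<subseteq> covert_capacity_region h \<sigma>B \<sigma>E P1 P2 P3"
  proof (rule subsetI)
    fix p assume "p \<in> ?region"
    then obtain R1 R2 where p: "p = (R1, R2)" and R: "0 \<le> R1" "0 \<le> R2"
      "R1 \<le> 1 / 2 * log 2 (1 + (h - 1)\<^sup>2 * min P1 P3 / \<sigma>B\<^sup>2)"
      "R2 \<le> 1 / 2 * log 2 (1 + (h - 1)\<^sup>2 * min P2 P3 / \<sigma>B\<^sup>2)"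
      "R1 + R2 \<le> 1 / 2 * log 2 (1 + (h - 1)\<^sup>2 * min (P1 + P2) P3 / \<sigma>B\<^sup>2)" by auto
    \<comment> \<open>Scalings strictly below 1 that tend to 1 exhibit every point of the region as
      a limit of achievable pairs.\<close>
    define t where "t k = real k / real (Suc k)" for k
    have t: "0 \<le> t k" "t k < 1" for k by (auto simp: t_def)
    have "t \<longlonglongrightarrow> 1" unfolding t_def by (rule LIMSEQ_n_over_Suc_n)
    then have "(\<lambda>k. (t k * t k * R1, t k * t k * R2)) \<longlonglongrightarrow> (1 * 1 * R1, 1 * 1 * R2)"
      by (intro tendsto_intros)
    moreover have "(t k * t k * R1, t k * t k * R2) \<in> {(R1, R2). achievable h \<sigma>B \<sigma>E P1 P2 P3 R1 R2}" for k
      using scaled_pair_achievable[OF assms R t] by simp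
    ultimately show "p \<in> covert_capacity_region h \<sigma>B \<sigma>E P1 P2 P3"
      unfolding covert_capacity_region_def closure_sequential p
      by (intro exI[of _ "\<lambda>k. (t k * t k * R1, t k * t k * R2)"]) simp
  qed
qed

end
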